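(* Let $K(\mathcal{X})/K(x)$ be a linearized function field given by $L(y)=h(x)$, with $q$, $s$, $m$, $r$, $P_1,\dots,P_r$, $\lambda_1,\dots,\lambda_r$ and $Q_1,\dots,Q_r$ as in the context. Assume that $2\leq n\leq q^s$ with $n\leq r$, let $\mathbf{Q}=(Q_1,\dots,Q_n)$ be an $n$-tuple of distinct totally ramified places of degree one in $K(\mathcal{X})/K(x)$, and let $\boldsymbol{\alpha}=(\alpha_1,\dots,\alpha_n)\in\mathbb{Z}^n$. Let $\Upsilon$ denote either $\Gamma$ or $\Lambda$. Then $\boldsymbol{\alpha}\in\widehat{\Upsilon}(\mathbf{Q})$ if and only if there exists a unique $t\in\{0,\dots,q^m-1\}$ such that $\alpha_k-t\lambda_k\equiv 0\pmod{q^m}$ for every $1\leq k\leq n$ and $$\sum_{k=1}^{n}\left\lceil\frac{\alpha_k}{q^m}\right\rceil-\sum_{k=1}^{r}\left\lceil\frac{t\lambda_k}{q^m}\right\rceil\deg(P_k)=\rho,\qquad\text{where}\quad \rho=\begin{cases}0,&\text{if }\Upsilon=\Gamma,\\ n-2,&\text{if }\Upsilon=\Lambda.\end{cases}$$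
   Context: Setting. Let $s,m$ be positive integers with $m\leq s$, let $q$ be a power of a prime $p$, and let $K=\mathbb{F}_{q^s}$. Let $L(y)=\sum_{k=0}^m a_k y^{q^k}\in K[y]$ be a linearized polynomial with $a_m\neq 0$, $a_0\neq 0$, all of whose roots lie in $K$. Let $h(x)\in K(x)$ be a rational function whose principal divisor in the rational function field $K(x)$ is $$(h(x))_{K(x)}=\gamma_1T_1+\cdots+\gamma_uT_u-\lambda_1P_1-\cdots-\lambda_rP_r,$$ where $T_1,\dots,T_u$ are the (distinct) places of $K(x)$ that are zeros of $h(x)$, $P_1,\dots,P_r$ are the (distinct) places of $K(x)$ that are poles of $h(x)$, and $\gamma_1,\dots,\gamma_u,\lambda_1,\dots,\lambda_r$ are positive integers with $p\nmid\lambda_k$ for all $1\leq k\leq r$. Let $\mathcal{X}$ be the curve over $K$ with affine equation $L(y)=h(x)$ and $K(\mathcal{X})=K(x,y)$ its function field (a linearized function field); one has $[K(\mathcal{X}):K(x)]=q^m$. The places $P_1,\dots,P_r$ are exactly the places of $K(x)$ totally ramified in $K(\mathcal{X})/K(x)$; for $1\leq i\leq r$, $Q_i$ denotes the unique place of $K(\mathcal{X})$ lying over $P_i$. Generalized Weierstrass semigroup. For an $n$-tuple $\mathbf{Q}=(Q_1,\dots,Q_n)$ of distinct rational (degree one) places, let $R_{\mathbf{Q}}$ be the ring of functions in $K(\mathcal{X})$ that are regular outside $\{Q_1,\dots,Q_n\}$, let $\nu_{Q_i}$ be the discrete valuation at $Q_i$, and set $$\widehat{H}(\mathbf{Q})=\{(-\nu_{Q_1}(z),\dots,-\nu_{Q_n}(z))\in\mathbb{Z}^n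 : z\in R_{\mathbf{Q}}\setminus\{0\}\}.$$ Maximal elements. Let $I=\{1,\dots,n\}$. For a nonempty $J\subsetneq I$ and $\boldsymbol{\alpha}\in\mathbb{Z}^n$ put $$\nabla_J(\boldsymbol{\alpha})=\{\boldsymbol{\beta}\in\widehat{H}(\mathbf{Q}) : \beta_j=\alpha_j\text{ for }j\in J\text{ and }\beta_i<\alpha_i\text{ for }i\notin J\},\qquad \nabla(\boldsymbol{\alpha})=\bigcup_{i=1}^n\nabla_{\{i\}}(\boldsymbol{\alpha}).$$ An element $\boldsymbol{\alpha}\in\widehat{H}(\mathbf{Q})$ is maximal if $\nabla(\boldsymbol{\alpha})=\emptyset$. It is absolute maximal if it is maximal and $\nabla_J(\boldsymbol{\alpha})=\emptyset$ for every $J\subsetneq I$ with $|J|\geq 2$. It is relative maximal if it is maximal and $\nabla_J(\boldsymbol{\alpha})\neq\emptyset$ for every $J\subsetneq I$ with $|J|\geq 2$. The sets of absolute and relative maximal elements of $\widehat{H}(\mathbf{Q})$ are denoted $\widehat{\Gamma}(\mathbf{Q})$ and $\widehat{\Lambda}(\mathbf{Q})$, respectively. *)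

theory Defs
  imports
    Complex_Main
    "HOL-Library.FuncSet"
    "HOL-Library.Cardinality"
    "HOL-Computational_Algebra.Computational_Algebra"
    "HOL-Number_Theory.Cong"
    "HOL-Algebra.Algebraic_Closure_Type"
    "HOL-Algebra.Embedded_Algebras"
    "HOL-Algebra.Generated_Fields"
    "HOL-Algebra.QuotRing"
begin

section \<open>Places of a function field\<close>

text \<open>
  A function field is given by a field type \<open>'f\<close> together with the set \<open>C\<close> of its constants, a
  subfield of \<open>'f\<close>. As in Stichtenoth's book, a place is the maximal ideal of a valuation ring
  \<open>V\<close> with \<open>C \<subset> V \<subset> 'f\<close>; the ring is recovered from the place by \<open>place_ring\<close>. The case \<open>z = 0\<close>
  is singled out only because \<open>inverse 0 = 0\<close> in HOL.
\<close>

definition valuation_ring :: "'f::field set \<Rightarrow> 'f set \<Rightarrow> bool" where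
  "valuation_ring C V \<longleftrightarrow>
     subring V ring_of_type_algebra \<and> C \<subset> V \<and> V \<subset> UNIV \<and> (\<forall>z. z \<in> V \<or> inverse z \<in> V)"

definition place :: "'f::field set \<Rightarrow> 'f set \<Rightarrow> bool" where
  "place C P \<longleftrightarrow> (\<exists>V. valuation_ring C V \<and> P = {z \<in> V. z = 0 \<or> inverse z \<notin> V})"

definition place_ring :: "'f::field set \<Rightarrow> 'f set" where
  "place_ring P = {z. z = 0 \<or> inverse z \<notin> P}"

text \<open>
  The discrete valuation at \<open>P\<close>: the exponent \<open>k\<close> in \<open>z = t\<^sup>k u\<close>, where \<open>t\<close> generates \<open>P\<close> and \<open>u\<close> is a
  unit of the valuation ring. Its value at \<open>z = 0\<close> is unspecified.
\<close>

definition place_val :: "'f::field set \<Rightarrow> 'f \<Rightarrow> int" where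
  "place_val P z =
     (THE k. \<exists>t u. P = (\<lambda>w. t * w) ` place_ring P \<and> u \<in> place_ring P - P \<and> z = (t powi k) * u)"

definition residue_field :: "'f::field set \<Rightarrow> 'f set ring" where
  "residue_field P = (ring_of_type_algebra\<lparr>carrier := place_ring P\<rparr>) Quot P"

text \<open>
  The degree of a place, i.e. the dimension of its residue field over the image of \<open>C\<close> in it.
\<close>

definition place_degree :: "'f::field set \<Rightarrow> 'f set \<Rightarrow> nat" where
  "place_degree C P =
     ring.dim (residue_field P)
       ((\<lambda>c. P +>\<^bsub>ring_of_type_algebra\<lparr>carrier := place_ring P\<rparr>\<^esub> c) ` C)
       (carrier (residue_field P))"

text \<open>Divisors are written as integer-valued functions on sets, vanishing outside the places.\<close>

definition principal_divisor :: "'f::field set \<Rightarrow> 'f \<Rightarrow> 'f set \<Rightarrow> int" where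
  "principal_divisor C z = (\<lambda>P. if place C P then place_val P z else 0)"

definition zeros :: "'f::field set \<Rightarrow> 'f \<Rightarrow> 'f set set" where
  "zeros C z = {P. place C P \<and> place_val P z > 0}"

definition poles :: "'f::field set \<Rightarrow> 'f \<Rightarrow> 'f set set" where
  "poles C z = {P. place C P \<and> place_val P z < 0}"

text \<open>
  Extensions of function fields are given by a field embedding \<open>\<iota>\<close> rather than by an inclusion.
\<close>

definition lies_over :: "('e::field \<Rightarrow> 'f::field) \<Rightarrow> 'f set \<Rightarrow> 'e set \<Rightarrow> bool" where
  "lies_over \<iota> Q P \<longleftrightarrow> \<iota> ` P \<subseteq> Q"


section \<open>Linearized function fields\<close>

definition const_fract :: "'k::field \<Rightarrow> 'k poly fract" where
  "const_fract c = to_fract [:c:]"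

definition rat_consts :: "'k::field poly fract set" where
  "rat_consts = range const_fract"

definition ext_consts :: "('k::field poly fract \<Rightarrow> 'f::field) \<Rightarrow> 'f set" where
  "ext_consts \<iota> = \<iota> ` rat_consts"

definition linearized_poly :: "nat \<Rightarrow> nat \<Rightarrow> (nat \<Rightarrow> 'k::field) \<Rightarrow> 'k poly" where
  "linearized_poly q m a = (\<Sum>k\<le>m. monom (a k) (q ^ k))"

definition all_roots_in_base :: "'k::field poly \<Rightarrow> bool" where
  "all_roots_in_base L \<longleftrightarrow>
     (\<forall>z :: 'k alg_closure. poly (map_poly to_ac L) z = 0 \<longrightarrow> z \<in> range to_ac)"

text \<open>
  The field \<open>'f\<close>, with \<open>\<iota>\<close> embedding the rational function field \<open>K(x)\<close> into it, is \<open>K(x, y)\<close> with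
  \<open>L(y) = h(x)\<close>.
\<close>

definition linearized_function_field ::
    "'k::field poly \<Rightarrow> 'k poly fract \<Rightarrow> ('k poly fract \<Rightarrow> 'f::field) \<Rightarrow> 'f \<Rightarrow> bool" where
  "linearized_function_field L h \<iota> y \<longleftrightarrow>
     \<iota> \<in> ring_hom ring_of_type_algebra ring_of_type_algebra \<and>
     poly (map_poly (\<iota> \<circ> const_fract) L) y = \<iota> h \<and>
     generate_field ring_of_type_algebra (insert y (range \<iota>)) = UNIV"


section \<open>Generalized Weierstrass semigroups and maximal elements\<close>

text \<open>
  A tuple indexed by \<open>{1..n}\<close> is a function on \<open>nat\<close>; tuples in \<open>\<int>\<^sup>n\<close> are elements of
  \<open>{1..n} \<rightarrow>\<^sub>E UNIV\<close>, so that equality of functions is equality of tuples.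
\<close>

definition regular_outside :: "'f::field set \<Rightarrow> 'f set set \<Rightarrow> 'f set" where
  "regular_outside C S = {z. \<forall>R. place C R \<and> R \<notin> S \<longrightarrow> z \<in> place_ring R}"

definition gen_weierstrass_semigroup ::
    "'f::field set \<Rightarrow> nat \<Rightarrow> (nat \<Rightarrow> 'f set) \<Rightarrow> (nat \<Rightarrow> int) set" where
  "gen_weierstrass_semigroup C n Q =
     {(\<lambda>i\<in>{1..n}. - place_val (Q i) z) | z. z \<in> regular_outside C (Q ` {1..n}) - {0}}"

definition nabla_on ::
    "nat \<Rightarrow> (nat \<Rightarrow> int) set \<Rightarrow> nat set \<Rightarrow> (nat \<Rightarrow> int) \<Rightarrow> (nat \<Rightarrow> int) set" where
  "nabla_on n H J \<alpha> = {\<beta> \<in> H. (\<forall>j\<in>J. \<beta> j = \<alpha> j) \<and> (\<forall>i\<in>{1..n} - J. \<beta> i < \<alpha> i)}"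

definition nabla :: "nat \<Rightarrow> (nat \<Rightarrow> int) set \<Rightarrow> (nat \<Rightarrow> int) \<Rightarrow> (nat \<Rightarrow> int) set" where
  "nabla n H \<alpha> = (\<Union>i\<in>{1..n}. nabla_on n H {i} \<alpha>)"

definition maximal_elements :: "nat \<Rightarrow> (nat \<Rightarrow> int) set \<Rightarrow> (nat \<Rightarrow> int) set" where
  "maximal_elements n H = {\<alpha> \<in> H. nabla n H \<alpha> = {}}"

definition absolute_maximal_elements :: "nat \<Rightarrow> (nat \<Rightarrow> int) set \<Rightarrow> (nat \<Rightarrow> int) set" where
  "absolute_maximal_elements n H =
     {\<alpha> \<in> maximal_elements n H. \<forall>J. J \<subset> {1..n} \<and> card J \<ge> 2 \<longrightarrow> nabla_on n H J \<alpha> = {}}"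

definition relative_maximal_elements :: "nat \<Rightarrow> (nat \<Rightarrow> int) set \<Rightarrow> (nat \<Rightarrow> int) set" where
  "relative_maximal_elements n H =
     {\<alpha> \<in> maximal_elements n H. \<forall>J. J \<subset> {1..n} \<and> card J \<ge> 2 \<longrightarrow> nabla_on n H J \<alpha> \<noteq> {}}"

end

theory Submission
  imports Defs "HOL-Number_Theory.Residues"
begin

text \<open>
  Write \<open>N = q\<^sup>m\<close>. Every function is uniquely a sum \<open>\<Sum>t<N. f\<^sub>t y\<^sup>t\<close> with \<open>f\<^sub>t\<close> in the rational function field, and the
  question about maximal elements reduces to single monomials \<open>f y\<^sup>t\<close>.

  At a place \<open>Q k\<close> over a pole \<open>P k\<close> of \<open>h\<close> of order \<open>lam k\<close> prime to \<open>p\<close>, the monomial \<open>f y\<^sup>t\<close> has order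
  \<open>N v - t lam k\<close>, where \<open>v\<close> is the order of \<open>f\<close> at \<open>P k\<close> (\<open>ex_adapted\<close>). These orders are distinct modulo \<open>N\<close> for
  distinct \<open>t\<close>, so the order of a sum is the minimum of the orders of its monomials (\<open>ev_ramified\<close>). Away
  from the poles of \<open>h\<close> the powers of \<open>y\<close> form an integral basis (\<open>coeffs_regular\<close>), because the
  translations \<open>y \<mapsto> y + \<beta>\<close> by roots of the linearized polynomial permute the places over a given
  one, and their values differ by nonzero constants. Hence a function is regular outside \<open>Q 1, \<dots>, Q n\<close> if and only if each of its
  monomials is (\<open>regular_outside_iff\<close>), and the congruence class of a pole order modulo \<open>N\<close> decides
  which monomial is responsible for it (\<open>semigroup_component\<close>).

  For a fixed \<open>t\<close>, the functions \<open>f\<close> for which \<open>f y\<^sup>t\<close> is regular outside the tuple with pole orders at most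
  \<open>\<alpha>\<close> form a Riemann-Roch space on the projective line. When all \<open>\<alpha> k\<close> are congruent to \<open>t lam k\<close> modulo \<open>N\<close>, the
  degree \<open>d\<close> of its divisor is the left-hand side of the equation in the theorem. The leading
  coefficients of these functions at the \<open>n\<close> rational points form an evaluation code of length \<open>n\<close> and
  dimension \<open>d + 1\<close>, as long as \<open>0 \<le> d < n\<close>, whose minimum weight is \<open>n - d\<close>. An element is absolute
  maximal when all nonzero words have full support, which means \<open>d = 0\<close> (\<open>absolute_maximal_iff\<close>). It is
  relative maximal when no word has weight one but all supports of size at least two occur, which means
  \<open>d = n - 2\<close> (\<open>relative_maximal_iff\<close>). For the supports of size at least three to occur one needs a
  third constant, and the hypothesis \<open>n \<le> q\<^sup>s\<close> provides it. The code enters the proofs only through two facts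
  on the rational function field: divisors of degree zero are principal
  (\<open>ex_fract_with_divisor\<close>), and principal divisors have degree zero, of which one inequality suffices
  (\<open>sum_val_degree_le_0\<close>).

  The places themselves are treated from their definition by valuation rings. Existence of places over
  a given one is Chevalley's theorem (\<open>chevalley_extension\<close>), and the degree of a place is computed
  from representatives of a basis of its residue field (\<open>place_degree_eqI\<close>).
\<close>

section \<open>Valuation rings and places of a field\<close>

lemma ring_of_type_algebra_simps:
  "carrier (ring_of_type_algebra :: 'a::comm_ring_1 ring) = UNIV"
  "mult (ring_of_type_algebra :: 'a ring) = (*)"
  "one (ring_of_type_algebra :: 'a ring) = 1"
  "zero (ring_of_type_algebra :: 'a ring) = 0"
  "add (ring_of_type_algebra :: 'a ring) = (+)"
  by (auto simp: ring_of_type_algebra_def)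

lemma a_inv_type_algebra: "a_inv (ring_of_type_algebra :: 'a::comm_ring_1 ring) x = - x"
proof -
  interpret ring "ring_of_type_algebra :: 'a ring" by (rule ring_from_type_algebra)
  show ?thesis
    using minus_equality[of "- x" x] by (simp add: ring_of_type_algebra_simps)
qed

text \<open>
  Valuation rings are handled as plain sets closed under the operations of the type class; the
  record-based notion enters only through the equivalence below.
\<close>

definition subring_set :: "'a::comm_ring_1 set \<Rightarrow> bool" where
  "subring_set A \<longleftrightarrow> 1 \<in> A \<and> (\<forall>x\<in>A. \<forall>y\<in>A. x - y \<in> A \<and> x * y \<in> A)"

lemma subring_setD:
  assumes "subring_set A"
  shows "0 \<in> A" "1 \<in> A"
    "x \<in> A \<Longrightarrow> - x \<in> A"
    "x \<in> A \<Longrightarrow> y \<in> A \<Longrightarrow> x + y \<in> A"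
    "x \<in> A \<Longrightarrow> y \<in> A \<Longrightarrow> x - y \<in> A"
    "x \<in> A \<Longrightarrow> y \<in> A \<Longrightarrow> x * y \<in> A"
    "x \<in> A \<Longrightarrow> x ^ k \<in> A"
proof -
  show 1: "1 \<in> A" and d: "\<And>x y. x \<in> A \<Longrightarrow> y \<in> A \<Longrightarrow> x - y \<in> A"
    and m: "\<And>x y. x \<in> A \<Longrightarrow> y \<in> A \<Longrightarrow> x * y \<in> A"
    using assms by (auto simp: subring_set_def)
  show 0: "0 \<in> A" using d[OF 1 1] by simp
  show n: "- x \<in> A" if "x \<in> A" for x using d[OF 0 that] by simp
  show "x + y \<in> A" if "x \<in> A" "y \<in> A" for x y using d[OF that(1) n[OF that(2)]] by simp
  show "x ^ k \<in> A" if "x \<in> A" using that by (induction k) (auto intro: 1 m)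
qed

lemma subring_set_sum:
  assumes "subring_set A" "\<And>i. i \<in> S \<Longrightarrow> g i \<in> A"
  shows "sum g S \<in> A"
  using assms(2) by (induction S rule: infinite_finite_induct) (auto intro: subring_setD[OF assms(1)])

lemma subring_type_algebra_iff:
  "subring V ring_of_type_algebra \<longleftrightarrow> subring_set (V :: 'a::comm_ring_1 set)"
proof
  assume "subring V ring_of_type_algebra"
  from subringE[OF this] show "subring_set V"
    unfolding subring_set_def
    by (metis (no_types) a_inv_type_algebra ring_of_type_algebra_simps(2,3,5) add_uminus_conv_diff)
next
  assume V: "subring_set V"
  interpret ring "ring_of_type_algebra :: 'a ring" by (rule ring_from_type_algebra)
  show "subring V ring_of_type_algebra"
    by (rule subringI)
      (auto simp: ring_of_type_algebra_simps a_inv_type_algebra intro: subring_setD[OF V])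
qed

text \<open>
  Chevalley's extension theorem, for one prescribed non-unit \<open>\<pi>\<close>. A ring that is maximal among the
  rings containing \<open>A\<close> in which \<open>\<pi>\<close> stays a non-unit is a valuation ring: if neither \<open>z\<close> nor
  \<open>1/z\<close> belonged to it, adjoining either one would make \<open>\<pi>\<close> invertible, and the two resulting
  equations, taken of least degrees in \<open>z\<close> and in \<open>1/z\<close>, could be played against each other to lower
  the larger degree.
\<close>

theorem chevalley_extension:
  fixes A :: "'f::field set"
  assumes A: "subring_set A" and \<pi>A: "\<pi> \<in> A" and nonunit: "\<forall>b\<in>A. \<pi> * b \<noteq> 1"
  obtains V where "subring_set V" "A \<subseteq> V" "\<forall>z. z \<in> V \<or> inverse z \<in> V" "\<forall>b\<in>V. \<pi> * b \<noteq> 1"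
proof -
  define \<B> where "\<B> = {B. subring_set B \<and> A \<subseteq> B \<and> (\<forall>b\<in>B. \<pi> * b \<noteq> 1)}"
  have "\<exists>B\<in>\<B>. \<forall>D\<in>\<B>. B \<subseteq> D \<longrightarrow> D = B"
  proof (rule subset_Zorn)
    fix \<C> assume ch: "subset.chain \<B> \<C>"
    show "\<exists>U\<in>\<B>. \<forall>D\<in>\<C>. D \<subseteq> U"
    proof (cases "\<C> = {}")
      case True
      have "A \<in> \<B>" using assms by (auto simp: \<B>_def)
      then show ?thesis using True by auto
    next
      case False
      have sub: "\<C> \<subseteq> \<B>" using ch by (auto simp: subset.chain_def)
      have "subring_set (\<Union>\<C>)"
        unfolding subring_set_def
      proof (intro conjI ballI)
        show "1 \<in> \<Union>\<C>" using False sub by (auto simp: \<B>_def subring_set_def)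
        fix x y assume "x \<in> \<Union>\<C>" "y \<in> \<Union>\<C>"
        then obtain D E where DE: "D \<in> \<C>" "E \<in> \<C>" "x \<in> D" "y \<in> E" by blast
        then have "D \<subseteq> E \<or> E \<subseteq> D" using ch by (auto simp: subset.chain_def)
        then obtain Z where Z: "Z \<in> \<C>" "x \<in> Z" "y \<in> Z" using DE by blast
        then have "subring_set Z" using sub by (auto simp: \<B>_def)
        then show "x - y \<in> \<Union>\<C>" "x * y \<in> \<Union>\<C>" using Z by (auto simp: subring_set_def)
      qed
      then have "\<Union>\<C> \<in> \<B>" using False sub by (auto simp: \<B>_def)
      then show ?thesis by blast
    qed
  qed
  then obtain B where BB: "B \<in> \<B>" and maxB: "\<And>D. D \<in> \<B> \<Longrightarrow> B \<subseteq> D \<Longrightarrow> D = B" by blast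
  have B: "subring_set B" and AB: "A \<subseteq> B" and Bn: "\<And>b. b \<in> B \<Longrightarrow> \<pi> * b \<noteq> 1"
    using BB by (auto simp: \<B>_def)
  note Bc = subring_setD[OF B]
  have \<pi>B: "\<pi> \<in> B" using \<pi>A AB by auto
  have adjoin: "\<exists>p. (\<forall>i. coeff p i \<in> B) \<and> \<pi> * poly p z = 1" if "z \<notin> B" for z
  proof (rule ccontr)
    assume neg: "\<not> ?thesis"
    define D where "D = {poly p z | p. \<forall>i. coeff p i \<in> B}"
    have BD: "B \<subseteq> D"
    proof
      fix b assume "b \<in> B"
      then have "\<forall>i. coeff [:b:] i \<in> B" using Bc(1) by (auto simp: coeff_pCons split: nat.split)
      moreover have "b = poly [:b:] z" by simp
      ultimately show "b \<in> D" unfolding D_def by blast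
    qed
    have "\<forall>i. coeff [:0,1:] i \<in> B" using Bc(1,2) by (auto simp: coeff_pCons split: nat.split)
    moreover have "z = poly [:0,1:] z" by simp
    ultimately have zD: "z \<in> D" unfolding D_def by blast
    have "subring_set D"
      unfolding subring_set_def
    proof (intro conjI ballI)
      show "1 \<in> D" using BD Bc(2) by auto
      fix x y assume x: "x \<in> D" and y: "y \<in> D"
      obtain f where f: "x = poly f z" "\<And>i. coeff f i \<in> B" using x by (auto simp: D_def)
      obtain g where g: "y = poly g z" "\<And>i. coeff g i \<in> B" using y by (auto simp: D_def)
      have "\<forall>i. coeff (f - g) i \<in> B"
        unfolding coeff_diff using f(2) g(2) Bc(5) by blast
      then have "poly (f - g) z \<in> D" by (auto simp only: D_def)
      then show "x - y \<in> D" by (simp add: f g)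
      have "\<forall>i. coeff (f * g) i \<in> B"
        unfolding coeff_mult by (intro allI subring_set_sum[OF B] Bc(6) f(2) g(2))
      then have "poly (f * g) z \<in> D" by (auto simp only: D_def)
      then show "x * y \<in> D" by (simp add: f g)
    qed
    moreover have "\<forall>b\<in>D. \<pi> * b \<noteq> 1" using neg by (auto simp: D_def)
    ultimately have "D \<in> \<B>" using AB BD by (auto simp: \<B>_def)
    then show False using maxB BD zD that by blast
  qed
  have inv1: "inverse (1 - \<pi> * c) \<in> B" if c: "c \<in> B" for c
  proof (rule ccontr)
    assume "inverse (1 - \<pi> * c) \<notin> B"
    from adjoin[OF this] obtain p where p: "\<forall>i. coeff p i \<in> B" "\<pi> * poly p (inverse (1 - \<pi> * c)) = 1"
      by auto
    define u where "u = 1 - \<pi> * c"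
    have u0: "u \<noteq> 0" using Bn[OF c] by (auto simp: u_def)
    have uB: "u \<in> B" unfolding u_def by (intro Bc c \<pi>B)
    define k where "k = degree p"
    have "u ^ k = \<pi> * (poly p (inverse u) * u ^ k)"
      using p(2) by (simp add: u_def mult.assoc [symmetric])
    also have "poly p (inverse u) * u ^ k = (\<Sum>i\<le>k. coeff p i * u ^ (k - i))"
      using u0 unfolding poly_altdef k_def[symmetric] sum_distrib_right
      by (intro sum.cong) (auto simp: power_diff divide_inverse power_inverse)
    finally have 1: "u ^ k = \<pi> * (\<Sum>i\<le>k. coeff p i * u ^ (k - i))" .
    have "\<exists>c'\<in>B. u ^ j = 1 - \<pi> * c'" for j
    proof (induction j)
      case (Suc j)
      then obtain c' where "c' \<in> B" "u ^ j = 1 - \<pi> * c'" by auto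
      then have "u ^ Suc j = (1 - \<pi> * c) * (1 - \<pi> * c')" by (simp add: u_def)
      also have "\<dots> = 1 - \<pi> * (c + c' - \<pi> * c * c')" by (simp add: algebra_simps)
      finally have "u ^ Suc j = 1 - \<pi> * (c + c' - \<pi> * c * c')" .
      moreover have "c + c' - \<pi> * c * c' \<in> B" using c \<pi>B \<open>c' \<in> B\<close> by (auto intro!: Bc)
      ultimately show ?case by blast
    qed (use Bc(1) in auto)
    then obtain c' where c': "c' \<in> B" "u ^ k = 1 - \<pi> * c'" by blast
    have "\<pi> * ((\<Sum>i\<le>k. coeff p i * u ^ (k - i)) + c') = 1"
      using 1 c'(2) by (simp add: algebra_simps)
    moreover have "(\<Sum>i\<le>k. coeff p i * u ^ (k - i)) + c' \<in> B"
      using p(1) uB c'(1) by (intro Bc subring_set_sum[OF B]) auto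
    ultimately show False using Bn by blast
  qed
  define rel where "rel z p \<longleftrightarrow> (\<forall>i. coeff p i \<in> B) \<and> \<pi> * poly p z = 1" for z p
  have reduce: "\<exists>p'. rel z p' \<and> degree p' < degree p"
    if p: "rel z p" and q: "rel (inverse z) q" and le: "degree q \<le> degree p" and z0: "z \<noteq> 0" for z p q
  proof -
    define k l where "k = degree p" and "l = degree q"
    have l0: "0 < l"
    proof (rule ccontr)
      assume "\<not> 0 < l"
      then obtain b where "q = [:b:]" unfolding l_def by (auto elim: degree_eq_zeroE)
      moreover have "coeff q 0 \<in> B" using q by (auto simp: rel_def)
      ultimately show False using q Bn by (auto simp: rel_def)
    qed
    define w where "w = inverse (1 - \<pi> * coeff q 0)"
    have q0: "coeff q 0 \<in> B" using q by (auto simp: rel_def)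
    have wB: "w \<in> B" unfolding w_def by (rule inv1[OF q0])
    have w0: "1 - \<pi> * coeff q 0 \<noteq> 0" using Bn[OF q0] by auto
    have "1 = \<pi> * (\<Sum>i\<le>l. coeff q i * inverse z ^ i)"
      using q by (simp add: rel_def poly_altdef l_def)
    also have "(\<Sum>i\<le>l. coeff q i * inverse z ^ i)
               = coeff q 0 + (\<Sum>i=1..l. coeff q i * inverse z ^ i)"
      by (simp add: atMost_atLeast0 sum.atLeast_Suc_atMost)
    finally have "1 - \<pi> * coeff q 0 = \<pi> * (\<Sum>i=1..l. coeff q i * inverse z ^ i)"
      by (simp add: algebra_simps)
    then have w: "1 = w * \<pi> * (\<Sum>i=1..l. coeff q i * inverse z ^ i)"
      using w0 by (simp add: w_def field_simps)
    define r where "r = (\<Sum>i=1..l. monom (w * \<pi> * coeff p k * coeff q i) (k - i))"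
    have "z ^ k = z ^ k * (w * \<pi> * (\<Sum>i=1..l. coeff q i * inverse z ^ i))"
      using w by simp
    also have "\<dots> = (\<Sum>i=1..l. w * \<pi> * coeff q i * z ^ (k - i))"
      unfolding sum_distrib_left
      using le z0 by (intro sum.cong) (auto simp: k_def l_def power_diff divide_inverse power_inverse)
    finally have pr: "poly r z = coeff p k * z ^ k"
      by (simp add: r_def poly_sum poly_monom sum_distrib_left mult_ac)
    define p' where "p' = p - monom (coeff p k) k + r"
    have "poly p' z = poly p z" by (simp add: p'_def pr poly_monom)
    moreover have "\<forall>i. coeff p' i \<in> B"
      using p q wB \<pi>B unfolding p'_def r_def rel_def coeff_add coeff_diff coeff_sum coeff_monom
      by (intro allI Bc subring_set_sum[OF B]) (auto intro!: Bc subring_set_sum[OF B])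
    ultimately have "rel z p'" using p by (simp add: rel_def)
    moreover have "degree p' < k"
    proof -
      have k0: "0 < k" using l0 le by (simp add: k_def l_def)
      have "coeff p' j = 0" if "k - 1 < j" for j
      proof -
        have "coeff r j = 0" unfolding r_def coeff_sum coeff_monom
          using that k0 by (intro sum.neutral) auto
        moreover have "coeff (p - monom (coeff p k) k) j = 0"
          using that by (cases "j = k") (auto simp: k_def coeff_eq_0)
        ultimately show ?thesis by (simp add: p'_def)
      qed
      then have "degree p' \<le> k - 1" by (intro degree_le) auto
      then show ?thesis using k0 by simp
    qed
    ultimately show ?thesis by (auto simp: k_def)
  qed
  have "z \<in> B \<or> inverse z \<in> B" for z
  proof (rule ccontr)
    assume neg: "\<not> ?thesis"
    then have z0: "z \<noteq> 0" using Bc(1) by auto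
    define k where "k = (LEAST d. \<exists>p. rel z p \<and> degree p = d)"
    define l where "l = (LEAST d. \<exists>p. rel (inverse z) p \<and> degree p = d)"
    have "\<exists>d. \<exists>p. rel z p \<and> degree p = d" "\<exists>d. \<exists>p. rel (inverse z) p \<and> degree p = d"
      using adjoin[of z] adjoin[of "inverse z"] neg by (auto simp: rel_def)
    from LeastI_ex[OF this(1)] LeastI_ex[OF this(2)]
    obtain p q where p: "rel z p" "degree p = k" and q: "rel (inverse z) q" "degree q = l"
      unfolding k_def l_def by blast
    show False
    proof (cases "l \<le> k")
      case True
      then obtain p' where "rel z p'" "degree p' < k" using reduce[OF p(1) q(1)] p q z0 by auto
      then show False unfolding k_def using not_less_Least by blast
    next
      case False
      then obtain p' where "rel (inverse z) p'" "degree p' < l"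
        using reduce[OF q(1), of p] p q z0 by auto
      then show False unfolding l_def using not_less_Least by blast
    qed
  qed
  then show thesis using that[of B] B AB Bn by blast
qed

lemma place_of_valuation_ring:
  assumes V: "subring_set V" "\<forall>z. z \<in> V \<or> inverse z \<in> V" and C: "C \<subseteq> V" and w: "w \<noteq> 0" "w \<in> V" "inverse w \<notin> V" "w \<notin> C"
  defines "R \<equiv> {z \<in> V. z = 0 \<or> inverse z \<notin> V}"
  shows "place C R" "place_ring R = V" "w \<in> R"
proof -
  have "valuation_ring C V"
    unfolding valuation_ring_def subring_type_algebra_iff using assms by auto
  then show "place C R" unfolding place_def R_def by blast
  show "place_ring R = V" using V(2) subring_setD(1)[OF V(1)] by (auto simp: place_ring_def R_def) 
  show "w \<in> R" using w by (auto simp: R_def)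
qed

definition place_units :: "'f::field set \<Rightarrow> 'f set" where
  "place_units R = place_ring R - R"

locale place_of_field =
  fixes C R :: "'f::field set"
  assumes is_place: "place C R"
begin

abbreviation "\<O> \<equiv> place_ring R"
abbreviation "\<U> \<equiv> place_units R"

lemma place_ring_props:
  shows ring_\<O>: "subring_set \<O>" and consts_in: "C \<subseteq> \<O>" and \<O>_ne: "\<O> \<noteq> UNIV"
    and total: "z \<in> \<O> \<or> inverse z \<in> \<O>" and R_eq: "R = {z \<in> \<O>. z = 0 \<or> inverse z \<notin> \<O>}"
proof -
  obtain V where V: "valuation_ring C V" and R: "R = {z \<in> V. z = 0 \<or> inverse z \<notin> V}"
    using is_place by (auto simp: place_def)
  have s: "subring_set V" and tot: "\<And>z. z \<in> V \<or> inverse z \<in> V"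
    using V unfolding valuation_ring_def subring_type_algebra_iff by auto
  have "V = \<O>" using tot subring_setD(1)[OF s] by (auto simp: place_ring_def R) 
  then show "subring_set \<O>" "C \<subseteq> \<O>" "\<O> \<noteq> UNIV" "z \<in> \<O> \<or> inverse z \<in> \<O>"
    "R = {z \<in> \<O>. z = 0 \<or> inverse z \<notin> \<O>}"
    using V s tot R by (auto simp: valuation_ring_def)
qed

lemmas \<O>_closed = subring_setD[OF ring_\<O>]

lemma R_sub: "z \<in> R \<Longrightarrow> z \<in> \<O>" using R_eq by blast

lemma zero_R: "0 \<in> R" using R_eq \<O>_closed(1) by blast

lemma not_\<O>: "z \<notin> \<O> \<Longrightarrow> inverse z \<in> R" "z \<notin> \<O> \<Longrightarrow> z \<noteq> 0"
  by (auto simp: place_ring_def)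

lemma unit_iff: "z \<in> \<U> \<longleftrightarrow> z \<noteq> 0 \<and> z \<in> \<O> \<and> inverse z \<in> \<O>"
  using R_eq zero_R by (auto simp: place_units_def)

lemma R_iff: "z \<in> R \<longleftrightarrow> z = 0 \<or> z \<in> \<O> \<and> inverse z \<notin> \<O>"
  using R_eq zero_R by blast

lemma one_unit: "1 \<in> \<U>" using \<O>_closed(2) by (auto simp: unit_iff)

lemma units_mult: "u \<in> \<U> \<Longrightarrow> v \<in> \<U> \<Longrightarrow> u * v \<in> \<U>"
  by (auto simp: unit_iff intro: \<O>_closed)

lemma units_inverse: "u \<in> \<U> \<Longrightarrow> inverse u \<in> \<U>"
  by (auto simp: unit_iff)

lemma units_uminus: "u \<in> \<U> \<Longrightarrow> - u \<in> \<U>"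
  by (auto simp: unit_iff intro: \<O>_closed)

lemma units_power: "u \<in> \<U> \<Longrightarrow> u ^ k \<in> \<U>"
  by (induction k) (auto intro: units_mult one_unit)

lemma units_powi: "u \<in> \<U> \<Longrightarrow> u powi k \<in> \<U>"
  by (auto simp: power_int_def intro: units_power units_inverse)

lemma unit_nz: "u \<in> \<U> \<Longrightarrow> u \<noteq> 0" by (auto simp: unit_iff)

lemma unit_\<O>: "u \<in> \<U> \<Longrightarrow> u \<in> \<O>" by (auto simp: unit_iff)

lemma unit_not_R: "u \<in> \<U> \<Longrightarrow> u \<notin> R" by (auto simp: place_units_def)

lemma R_mult: "r \<in> R \<Longrightarrow> a \<in> \<O> \<Longrightarrow> r * a \<in> R"
proof (rule ccontr)
  assume r: "r \<in> R" and a: "a \<in> \<O>" and n: "r * a \<notin> R"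
  have ra: "r * a \<in> \<O>" using r a by (auto intro: \<O>_closed R_sub)
  have nz: "r \<noteq> 0" "a \<noteq> 0" using n zero_R by auto
  have "inverse (r * a) \<in> \<O>" using n ra R_iff by blast
  then have "inverse (r * a) * a \<in> \<O>" using a \<O>_closed(6) by blast
  then have "inverse r \<in> \<O>" using nz by (simp add: field_simps)
  then show False using r nz R_iff by blast
qed

lemma R_mult': "a \<in> \<O> \<Longrightarrow> r \<in> R \<Longrightarrow> a * r \<in> R"
  using R_mult[of r a] by (simp add: Groups.mult_ac)

lemma R_power: "r \<in> R \<Longrightarrow> 0 < k \<Longrightarrow> r ^ k \<in> R"
  by (cases k) (auto intro: R_mult \<O>_closed R_sub)

text \<open>
  Dividing by \<open>u\<close>, it suffices to treat \<open>1 + s\<close> with \<open>s\<close> in the place. This is the statement that the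
  non-units of a valuation ring form an ideal.
\<close>

lemma unit_plus_R: "u \<in> \<U> \<Longrightarrow> r \<in> R \<Longrightarrow> u + r \<in> \<U>"
proof -
  assume u: "u \<in> \<U>" and r: "r \<in> R"
  have s: "inverse u * r \<in> R" using u r by (auto simp: unit_iff intro: R_mult')
  define s where "s = inverse u * r"
  have sR: "s \<in> R" using s s_def by simp
  have "1 + s \<in> \<U>"
  proof (rule ccontr)
    assume n: "1 + s \<notin> \<U>"
    have "1 + s \<in> \<O>" using sR by (auto intro: \<O>_closed R_sub)
    then have 1: "1 + s \<in> R" using n by (auto simp: place_units_def)
    show False
    proof (cases "s = 0")
      case True then show False using n one_unit by simp
    next
      case False
      \<comment> \<open>One of the quotients of \<open>s\<close> and \<open>1 + s\<close> is integral, so \<open>1\<close> is a multiple of an element of \<open>R\<close>.\<close>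
      have n0: "1 + s \<noteq> 0"
      proof
        assume "1 + s = 0"
        then have "s = - 1" by (simp add: add_eq_0_iff)
        then have "s \<in> \<U>" using units_uminus[OF one_unit] by simp
        then show False using sR unit_not_R by blast
      qed
      have "(1 + s) / s \<in> \<O> \<or> s / (1 + s) \<in> \<O>" using total[of "(1+s)/s"] by (simp add: field_simps)
      then show False
      proof
        assume "(1 + s) / s \<in> \<O>"
        then have "(1 + s) / s - 1 \<in> \<O>" by (intro \<O>_closed)
        moreover have "(1 + s) / s - 1 = inverse s" using False by (simp add: field_simps)
        ultimately show False using sR False R_iff by auto
      next
        assume "s / (1 + s) \<in> \<O>"
        then have "1 - s / (1 + s) \<in> \<O>" by (intro \<O>_closed)
        moreover have "1 - s / (1 + s) = inverse (1 + s)" using n0 by (simp add: field_simps)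
        ultimately show False using 1 n0 R_iff by auto
      qed
    qed
  qed
  then have "u * (1 + s) \<in> \<U>" using u by (rule units_mult[rotated])
  moreover have "u * (1 + s) = u + r" using unit_nz[OF u] by (simp add: s_def field_simps)
  ultimately show ?thesis by simp
qed

lemma R_add: "r \<in> R \<Longrightarrow> s \<in> R \<Longrightarrow> r + s \<in> R"
proof (rule ccontr)
  assume r: "r \<in> R" and s: "s \<in> R" and n: "r + s \<notin> R"
  then have "r + s \<in> \<U>" by (auto simp: place_units_def intro: \<O>_closed R_sub)
  moreover have "- r \<in> R" using R_mult[OF r \<O>_closed(3)[OF \<O>_closed(2)]] by simp
  ultimately have "r + s + - r \<in> \<U>" by (rule unit_plus_R)
  then show False using s unit_not_R by simp
qed

lemma R_uminus: "r \<in> R \<Longrightarrow> - r \<in> R"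
  using R_mult[OF _ \<O>_closed(3)[OF \<O>_closed(2)], of r] by simp

lemma R_diff: "r \<in> R \<Longrightarrow> s \<in> R \<Longrightarrow> r - s \<in> R"
  using R_add[of r "- s"] R_uminus by simp

lemma R_sum: "(\<And>i. i \<in> S \<Longrightarrow> g i \<in> R) \<Longrightarrow> sum g S \<in> R"
  by (induction S rule: infinite_finite_induct) (auto intro: R_add zero_R)

lemma units_of_power: "u ^ k \<in> \<U> \<Longrightarrow> 0 < k \<Longrightarrow> u \<in> \<U>"
proof -
  assume u: "u ^ k \<in> \<U>" and k: "0 < k"
  have 1: "v \<notin> R" if "v ^ k \<in> \<U>" for v using that R_power[OF _ k] unit_not_R by blast
  have "inverse u ^ k \<in> \<U>" using units_inverse[OF u] by (simp add: power_inverse)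
  then have "inverse u \<notin> R" by (rule 1)
  then have "u \<in> \<O>" using not_\<O>(1) by blast
  then show ?thesis using 1[OF u] by (simp add: place_units_def)
qed

lemma const_unit: "c \<in> C \<Longrightarrow> inverse c \<in> C \<Longrightarrow> c \<noteq> 0 \<Longrightarrow> c \<in> \<U>"
  using consts_in by (auto simp: unit_iff)

end

text \<open>
  Requiring every nonzero element to be a unit times an integral power of \<open>t\<close> makes the place
  discrete with generator \<open>t\<close>.
\<close>

definition uniformizer :: "'f::field set \<Rightarrow> 'f \<Rightarrow> bool" where
  "uniformizer R t \<longleftrightarrow> t \<noteq> 0 \<and> t \<in> R \<and> (\<forall>z. z \<noteq> 0 \<longrightarrow> (\<exists>k. \<exists>u\<in>place_units R. z = t powi k * u))"

locale discrete_place = place_of_field +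
  fixes t
  assumes unif: "uniformizer R t"
begin

lemma t_nz: "t \<noteq> 0" and t_R: "t \<in> R" using unif by (auto simp: uniformizer_def)

lemma powi_\<O>: "t powi k \<in> \<O>" if "0 \<le> k"
  using that R_sub[OF t_R] \<O>_closed by (auto simp: power_int_def)

lemma powi_R: "t powi k \<in> R" if "0 < k"
  using that t_R by (auto simp: power_int_def intro: R_power)

lemma powi_unit_iff: "u \<in> \<U> \<Longrightarrow> t powi k * u \<in> \<O> \<longleftrightarrow> 0 \<le> k" "u \<in> \<U> \<Longrightarrow> t powi k * u \<in> R \<longleftrightarrow> 0 < k"
proof -
  assume u: "u \<in> \<U>"
  have neg: "t powi k * u \<notin> \<O>" if "k < 0"
  proof
    assume "t powi k * u \<in> \<O>"
    then have "t powi k * u * inverse u \<in> \<O>" using u by (auto simp: unit_iff intro: \<O>_closed)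
    then have "t powi k \<in> \<O>" using unit_nz[OF u] by (simp add: mult.assoc)
    moreover have "t powi k = inverse (t powi (- k))" by (simp add: power_int_minus)
    ultimately show False using powi_R[of "-k"] that t_nz R_iff by auto
  qed
  show "t powi k * u \<in> \<O> \<longleftrightarrow> 0 \<le> k"
    using neg powi_\<O> unit_\<O>[OF u] \<O>_closed(6) by (meson not_le)
  show "t powi k * u \<in> R \<longleftrightarrow> 0 < k"
    using neg R_sub powi_R unit_\<O>[OF u] R_mult unit_not_R[OF u] by (cases k "0::int" rule: linorder_cases) auto
qed

lemma val_unique:
  assumes "t powi k * u = t powi k' * u'" "u \<in> \<U>" "u' \<in> \<U>"
  shows "k = k'"
proof -
  have "t powi (k - k') * u = u'" "t powi (k' - k) * u' = u"
    using assms t_nz by (auto simp: power_int_diff field_simps)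
  then have "0 \<le> k - k'" "0 \<le> k' - k" using powi_unit_iff(1) assms(2,3) unit_\<O> by metis+
  then show ?thesis by simp
qed

lemma R_principal: "R = (\<lambda>w. t * w) ` \<O>"
proof
  show "(\<lambda>w. t * w) ` \<O> \<subseteq> R" using t_R R_mult by auto
  show "R \<subseteq> (\<lambda>w. t * w) ` \<O>"
  proof
    fix z assume z: "z \<in> R"
    show "z \<in> (\<lambda>w. t * w) ` \<O>"
    proof (cases "z = 0")
      case True then show ?thesis using \<O>_closed(1) by (auto intro!: image_eqI[of _ _ 0])
    next
      case False
      then obtain k u where ku: "u \<in> \<U>" "z = t powi k * u" using unif by (auto simp: uniformizer_def)
      then have "0 < k" using powi_unit_iff(2) z by blast
      then have "t powi (k - 1) * u \<in> \<O>" using powi_unit_iff(1)[OF ku(1), of "k - 1"] by simp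
      moreover have "z = t * (t powi (k - 1) * u)" using ku(2) t_nz by (simp add: power_int_diff)
      ultimately show ?thesis by blast
    qed
  qed
qed

text \<open>
  Two generators of the place differ by a unit, so the exponent does not depend on the generator;
  this is what makes the definite description in the definition of the valuation meaningful.
\<close>

lemma place_val_eqI:
  assumes "u \<in> \<U>" "z = t powi k * u"
  shows "place_val R z = k"
  unfolding place_val_def
proof (rule the_equality)
  show "\<exists>t u. R = (*) t ` \<O> \<and> u \<in> \<O> - R \<and> z = t powi k * u"
    using R_principal assms by (auto simp: place_units_def)
next
  fix k' assume "\<exists>t u. R = (*) t ` \<O> \<and> u \<in> \<O> - R \<and> z = t powi k' * u"
  then obtain s v where s: "R = (*) s ` \<O>" and v: "v \<in> \<U>" and z: "z = s powi k' * v"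
    by (auto simp: place_units_def)
  have "s \<in> R" using s \<O>_closed(2) by (metis image_eqI mult.right_neutral)
  then obtain a where a: "a \<in> \<O>" "s = t * a" using R_principal by blast
  obtain b where b: "b \<in> \<O>" "t = s * b" using s t_R by blast
  have "t * (a * b) = t * 1" using a b by (metis mult.assoc mult.right_neutral)
  then have ab: "a * b = 1" using t_nz by (metis mult_left_cancel)
  then have au: "a \<in> \<U>" using a(1) b(1)
    by (metis inverse_unique mult_zero_left unit_iff zero_neq_one)
  have "z = t powi k' * (a powi k' * v)" using z a(2) by (simp add: power_int_mult_distrib)
  moreover have "a powi k' * v \<in> \<U>" using au v units_mult units_powi by blast
  ultimately show "k' = k" using val_unique assms by metis
qed

lemma val_decomp:
  assumes "z \<noteq> 0"
  obtains u where "u \<in> \<U>" "z = t powi (place_val R z) * u"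
proof -
  obtain k u where ku: "u \<in> \<U>" "z = t powi k * u" using unif assms by (auto simp: uniformizer_def)
  show thesis by (rule that[OF ku(1)]) (simp add: place_val_eqI[OF ku] ku(2)[symmetric])
qed

lemma val_\<O>_iff: "z \<noteq> 0 \<Longrightarrow> z \<in> \<O> \<longleftrightarrow> 0 \<le> place_val R z"
  using val_decomp powi_unit_iff(1) by metis

lemma val_R_iff: "z \<noteq> 0 \<Longrightarrow> z \<in> R \<longleftrightarrow> 0 < place_val R z"
  using val_decomp powi_unit_iff(2) by metis

lemma val_unit: "u \<in> \<U> \<Longrightarrow> place_val R u = 0"
  by (rule place_val_eqI[of u]) auto

lemma val_unif: "place_val R t = 1"
  by (rule place_val_eqI[of 1]) (auto simp: one_unit)

lemma val_mult:
  assumes "x \<noteq> 0" "y \<noteq> 0"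
  shows "place_val R (x * y) = place_val R x + place_val R y"
proof -
  define i j where "i = place_val R x" and "j = place_val R y"
  obtain u v where u: "u \<in> \<U>" "x = t powi i * u" and v: "v \<in> \<U>" "y = t powi j * v"
    using val_decomp assms unfolding i_def j_def by metis
  then have "x * y = t powi (i + j) * (u * v)"
    using t_nz by (simp add: power_int_add Groups.mult_ac)
  then show ?thesis using place_val_eqI[OF units_mult[OF u(1) v(1)]] by (simp add: i_def j_def)
qed

lemma val_one: "place_val R 1 = 0" using val_unit[OF one_unit] .

lemma val_inverse: "x \<noteq> 0 \<Longrightarrow> place_val R (inverse x) = - place_val R x"
  using val_mult[of x "inverse x"] val_one by simp

lemma val_power: "x \<noteq> 0 \<Longrightarrow> place_val R (x ^ k) = int k * place_val R x"
  by (induction k) (auto simp: val_one val_mult algebra_simps)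

lemma val_powi: "x \<noteq> 0 \<Longrightarrow> place_val R (x powi k) = k * place_val R x"
  by (auto simp: power_int_def val_power val_inverse simp flip: power_inverse)

lemma val_prod: "(\<And>i. i \<in> S \<Longrightarrow> g i \<noteq> 0) \<Longrightarrow> place_val R (prod g S) = (\<Sum>i\<in>S. place_val R (g i))"
  by (induction S rule: infinite_finite_induct) (auto simp: val_one val_mult)

lemma val_ge_iff: "z \<noteq> 0 \<Longrightarrow> k \<le> place_val R z \<longleftrightarrow> z * t powi (- k) \<in> \<O>"
  using val_mult[of z "t powi (-k)"] t_nz by (subst val_\<O>_iff) (auto simp: val_powi val_unif)

lemma val_add_ge:
  assumes "x = 0 \<or> k \<le> place_val R x" "y = 0 \<or> k \<le> place_val R y" "x + y \<noteq> 0"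
  shows "k \<le> place_val R (x + y)"
proof -
  have "x * t powi (- k) \<in> \<O>" "y * t powi (- k) \<in> \<O>"
    using assms(1,2) val_ge_iff \<O>_closed(1) by (metis mult_zero_left)+
  then have "(x + y) * t powi (- k) \<in> \<O>" unfolding distrib_right by (rule \<O>_closed)
  then show ?thesis using val_ge_iff[OF assms(3)] by simp
qed

lemma val_add_eq:
  assumes "x \<noteq> 0" "y = 0 \<or> place_val R x < place_val R y"
  shows "x + y \<noteq> 0 \<and> place_val R (x + y) = place_val R x"
proof (cases "y = 0")
  case False
  then have lt: "place_val R x < place_val R y" using assms by auto
  have m: "place_val R (- y) = place_val R y" "place_val R (- x) = place_val R x"
    using val_mult[of "-1" y] val_mult[of "-1" x] val_unit[OF units_uminus[OF one_unit]] False assms(1) by auto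
  have nz: "x + y \<noteq> 0" using lt m by (metis add_eq_0_iff less_irrefl)
  have "place_val R x \<le> place_val R (x + y)" using val_add_ge[of x "place_val R x" y] lt nz by auto
  moreover have "\<not> place_val R x < place_val R (x + y)"
    using val_add_ge[of "x + y" "place_val R x + 1" "- y"] lt m nz assms(1) by auto
  ultimately show ?thesis using nz by auto
qed (use assms in auto)

end

section \<open>The degree of a place\<close>

lemma subfield_type_algebra_range:
  fixes \<phi> :: "'a::field \<Rightarrow> 'b::field"
  assumes hom: "\<phi> \<in> ring_hom ring_of_type_algebra ring_of_type_algebra"
    and K: "subfield K (ring_of_type_algebra :: 'a ring)"
  shows "subfield (\<phi> ` K) ring_of_type_algebra"
proof -
  interpret S: ring "ring_of_type_algebra :: 'a ring" by (rule ring_from_type_algebra)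
  interpret T: ring "ring_of_type_algebra :: 'b ring" by (rule ring_from_type_algebra)
  interpret ring_hom_ring "ring_of_type_algebra :: 'a ring" "ring_of_type_algebra :: 'b ring" \<phi>
    by (rule ring_hom_ringI2[OF S.ring_axioms T.ring_axioms hom])
  show ?thesis by (rule img_is_subfield(2)[OF K]) (simp add: ring_of_type_algebra_simps)
qed

text \<open>
  Elements of the valuation ring whose residue classes form a basis of the residue field over the
  constants, expressed without passing to the quotient ring.
\<close>

definition residue_basis :: "'f::field set \<Rightarrow> 'f set \<Rightarrow> nat \<Rightarrow> (nat \<Rightarrow> 'f) \<Rightarrow> bool" where
  "residue_basis C R d b \<longleftrightarrow>
     (\<forall>i<d. b i \<in> place_ring R) \<and>
     (\<forall>z\<in>place_ring R. \<exists>c. (\<forall>i<d. c i \<in> C) \<and> z - (\<Sum>i<d. c i * b i) \<in> R) \<and>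
     (\<forall>c. (\<forall>i<d. c i \<in> C) \<and> (\<Sum>i<d. c i * b i) \<in> R \<longrightarrow> (\<forall>i<d. c i = 0))"

lemma residue_basisI:
  assumes "\<And>i. i < d \<Longrightarrow> b i \<in> place_ring R"
    and "\<And>z. z \<in> place_ring R \<Longrightarrow> \<exists>c. (\<forall>i<d. c i \<in> C) \<and> z - (\<Sum>i<d. c i * b i) \<in> R"
    and "\<And>c. (\<forall>i<d. c i \<in> C) \<Longrightarrow> (\<Sum>i<d. c i * b i) \<in> R \<Longrightarrow> \<forall>i<d. c i = 0"
  shows "residue_basis C R d b"
  unfolding residue_basis_def using assms by blast

context place_of_field
begin

text \<open>
  Representatives of a basis of the residue field determine the degree: the spans of their initial
  segments form the flag of subspaces by which dimension is defined inductively.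
\<close>

lemma place_degree_eqI:
  assumes C: "subfield C ring_of_type_algebra"
    and basis: "residue_basis C R d b"
  shows "place_degree C R = d"
proof -
  have b: "\<And>i. i < d \<Longrightarrow> b i \<in> \<O>"
    and gen: "\<And>z. z \<in> \<O> \<Longrightarrow> \<exists>c. (\<forall>i<d. c i \<in> C) \<and> z - (\<Sum>i<d. c i * b i) \<in> R"
    and indep: "\<And>c. (\<forall>i<d. c i \<in> C) \<Longrightarrow> (\<Sum>i<d. c i * b i) \<in> R \<Longrightarrow> \<forall>i<d. c i = 0"
    using basis unfolding residue_basis_def by blast+
  define A where "A = (ring_of_type_algebra :: 'f ring)\<lparr>carrier := \<O>\<rparr>"
  interpret F: field "ring_of_type_algebra :: 'f ring" by (rule field_from_type_algebra)
  have A_simps: "carrier A = \<O>" "mult A = (*)" "one A = 1" "zero A = 0" "add A = (+)"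
    by (auto simp: A_def ring_of_type_algebra_def)
  interpret A: ring A
    unfolding A_def by (rule F.subring_is_ring) (simp add: subring_type_algebra_iff ring_\<O>)
  have inv_A: "a_inv A x = - x" if "x \<in> \<O>" for x
    using that by (intro A.minus_equality) (auto simp: A_simps intro: \<O>_closed)
  have addR: "additive_subgroup R A"
    by (intro additive_subgroup.intro A.add.subgroupI)
      (use R_sub R_add R_uminus zero_R in \<open>auto simp: A_simps inv_A a_inv_def[symmetric]\<close>)
  interpret I: ideal R A
    by (intro ideal.intro addR A.ring_axioms ideal_axioms.intro) (auto simp: A_simps R_mult R_mult')
  define q where "q = (\<lambda>z. R +>\<^bsub>A\<^esub> z)"
  interpret h: ring_hom_ring A "A Quot R" q unfolding q_def by (rule I.rcos_ring_hom_ring)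
  let ?K = "q ` C"
  have q_eq: "q x = q z \<longleftrightarrow> x - z \<in> R" for x z
  proof
    assume "q x = q z"
    moreover have "x \<in> q x" using zero_R by (auto simp: q_def a_r_coset_def' A_simps)
    ultimately obtain r where "r \<in> R" "x = r + z" by (auto simp: q_def a_r_coset_def' A_simps)
    then show "x - z \<in> R" by simp
  next
    assume *: "x - z \<in> R"
    have "\<exists>r'\<in>R. r + x = r' + z" if "r \<in> R" for r
      using R_add[OF that *] by (intro bexI[of _ "r + (x - z)"]) auto
    moreover have "\<exists>r'\<in>R. r + z = r' + x" if "r \<in> R" for r
      using R_diff[OF that *] by (intro bexI[of _ "r - (x - z)"]) auto
    ultimately show "q x = q z" unfolding q_def a_r_coset_def' A_simps by blast
  qed
  have q_one: "\<one>\<^bsub>A Quot R\<^esub> \<noteq> \<zero>\<^bsub>A Quot R\<^esub>"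
    using q_eq[of 1 0] unit_not_R[OF one_unit] h.hom_one h.hom_zero by (simp add: A_simps)
  have "field (A\<lparr>carrier := C\<rparr>)" using F.subfield_iff(2)[OF C] by (simp add: A_def)
  then have CA: "subfield C A" using consts_in by (intro A.subfield_iff(1)) (auto simp: A_simps)
  have K: "subfield ?K (A Quot R)" by (rule h.img_is_subfield(2)[OF CA q_one])
  define E where "E j = {\<Sum>i<j. c i * b i | c. \<forall>i<j. c i \<in> C}" for j
  have E_sub: "E j \<subseteq> \<O>" if "j \<le> d" for j
    using that b consts_in unfolding E_def
    by (auto intro!: subring_set_sum[OF ring_\<O>] \<O>_closed(6))
  have z: "0 \<in> C" using subringE(2)[OF subfieldE(1)[OF C]] by (simp add: ring_of_type_algebra_simps)
  have dimE: "h.S.dimension j ?K (q ` E j)" if "j \<le> d" for j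
    using that
  proof (induction j)
    case 0
    have "q ` E 0 = {\<zero>\<^bsub>A Quot R\<^esub>}" using h.hom_zero by (auto simp: E_def A_simps)
    then show ?case using h.S.dimension.zero_dim by simp
  next
    case (Suc j)
    then have j: "j < d" by simp
    have "q (b j) \<notin> q ` E j"
    proof
      assume "q (b j) \<in> q ` E j"
      then obtain c where c: "\<forall>i<j. c i \<in> C" "b j - (\<Sum>i<j. c i * b i) \<in> R"
        by (auto simp: E_def q_eq)
      define c' where "c' i = (if i < j then c i else if i = j then - 1 else 0)" for i
      have "- 1 \<in> C" using subringE(3,5)[OF subfieldE(1)[OF C]]
        by (metis ring_of_type_algebra_simps(3) a_inv_type_algebra)
      then have c'C: "\<forall>i<d. c' i \<in> C" using c(1) z by (auto simp: c'_def)
      have "(\<Sum>i<d. c' i * b i) = (\<Sum>i<Suc j. c' i * b i)"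
        using j by (intro sum.mono_neutral_right) (auto simp: c'_def)
      also have "\<dots> = - (b j - (\<Sum>i<j. c i * b i))" by (simp add: c'_def)
      finally have "(\<Sum>i<d. c' i * b i) \<in> R" using R_uminus[OF c(2)] by simp
      then have "c' j = 0" using indep[OF c'C] j by blast
      then show False by (simp add: c'_def)
    qed
    moreover have "q ` E (Suc j) = h.S.line_extension ?K (q (b j)) (q ` E j)"
    proof -
      have 1: "q (k * b j + v) = q k \<otimes>\<^bsub>A Quot R\<^esub> q (b j) \<oplus>\<^bsub>A Quot R\<^esub> q v"
        if "k \<in> C" "v \<in> E j" for k v
      proof -
        have "k \<in> \<O>" "v \<in> \<O>" "b j \<in> \<O>" "k * b j \<in> \<O>"
          using that consts_in E_sub[of j] b j by (auto intro!: \<O>_closed(6))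
        then show ?thesis using h.hom_add[of "k * b j" v] h.hom_mult[of k "b j"] by (simp add: A_simps)
      qed
      have 2: "E (Suc j) = {k * b j + v | k v. k \<in> C \<and> v \<in> E j}"
      proof (intro equalityI subsetI)
        fix x assume "x \<in> E (Suc j)"
        then show "x \<in> {k * b j + v | k v. k \<in> C \<and> v \<in> E j}"
          by (force simp: E_def Groups.add_ac)
      next
        fix x assume "x \<in> {k * b j + v | k v. k \<in> C \<and> v \<in> E j}"
        then obtain k c where kc: "x = k * b j + (\<Sum>i<j. c i * b i)" "k \<in> C" "\<forall>i<j. c i \<in> C"
          by (auto simp: E_def)
        have "x = (\<Sum>i<Suc j. (c(j := k)) i * b i)" by (simp add: kc(1) Groups.add_ac)
        moreover have "\<forall>i<Suc j. (c(j := k)) i \<in> C" using kc by (auto simp: less_Suc_eq)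
        ultimately show "x \<in> E (Suc j)" unfolding E_def by blast
      qed
      show ?thesis
      proof (intro equalityI subsetI)
        fix w assume "w \<in> q ` E (Suc j)"
        then show "w \<in> h.S.line_extension ?K (q (b j)) (q ` E j)"
          unfolding 2 h.S.line_extension_mem_iff using 1 by (auto intro!: bexI)
      next
        fix w assume "w \<in> h.S.line_extension ?K (q (b j)) (q ` E j)"
        then obtain k v where kv: "k \<in> C" "v \<in> E j"
            "w = q k \<otimes>\<^bsub>A Quot R\<^esub> q (b j) \<oplus>\<^bsub>A Quot R\<^esub> q v"
          unfolding h.S.line_extension_mem_iff by auto
        then have "w = q (k * b j + v)" using 1 by simp
        then show "w \<in> q ` E (Suc j)" unfolding 2 using kv by blast
      qed
    qed
    moreover have "q (b j) \<in> carrier (A Quot R)" using b[OF j] by (simp add: A_simps)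
    ultimately show ?case using Suc h.S.dimension.Suc_dim by simp
  qed
  have "carrier (A Quot R) = q ` \<O>" by (auto simp: FactRing_def A_RCOSETS_def' q_def A_simps)
  also have "\<dots> = q ` E d"
  proof
    show "q ` \<O> \<subseteq> q ` E d"
    proof
      fix w assume "w \<in> q ` \<O>"
      then obtain z where "z \<in> \<O>" "w = q z" by auto
      moreover from gen[OF this(1)] obtain c where "\<forall>i<d. c i \<in> C" "z - (\<Sum>i<d. c i * b i) \<in> R" by auto
      ultimately have "w = q (\<Sum>i<d. c i * b i)" "(\<Sum>i<d. c i * b i) \<in> E d"
        by (auto simp: q_eq E_def)
      then show "w \<in> q ` E d" by blast
    qed
    show "q ` E d \<subseteq> q ` \<O>" using E_sub by auto
  qed
  finally have "h.S.dimension d ?K (carrier (A Quot R))" using dimE[of d] by simp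
  then have "(h.S.dim over ?K) (carrier (A Quot R)) = d" by (rule h.S.dimI[OF K])
  then show ?thesis
    by (simp add: place_degree_def residue_field_def over_def A_def q_def)
qed

end

section \<open>Places of the rational function field\<close>

context discrete_place
begin

text \<open>
  Adjoining to the valuation ring of a discrete place any element outside it inverts the generator
  \<open>t\<close>, and hence yields the whole field.
\<close>

lemma place_ring_maximal:
  assumes R': "place C' R'" and sub: "\<O> \<subseteq> place_ring R'"
  shows "R' = R"
proof -
  interpret P': place_of_field C' R' by unfold_locales (rule R')
  have "place_ring R' = \<O>"
  proof (rule ccontr)
    assume "place_ring R' \<noteq> \<O>"
    then obtain z where z: "z \<in> place_ring R'" "z \<notin> \<O>" using sub by blast
    have z0: "z \<noteq> 0" using z(2) not_\<O>(2) by blast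
    define v where "v = place_val R z"
    obtain u where u: "u \<in> \<U>" "z = t powi v * u" using val_decomp[OF z0] unfolding v_def by blast
    have neg: "v < 0" using val_\<O>_iff[OF z0] z(2) by (simp add: v_def)
    define k where "k = - v - 1"
    have "z * (t powi k * inverse u) = t powi v * t powi k"
      using unit_nz[OF u(1)] by (simp add: u(2))
    also have "\<dots> = inverse t" using t_nz by (simp add: k_def flip: power_int_add)
    finally have "inverse t = z * (t powi k * inverse u)" ..
    moreover have "t powi k * inverse u \<in> place_ring R'"
      using powi_unit_iff(1)[OF units_inverse[OF u(1)], of k] neg sub by (auto simp: k_def)
    ultimately have it: "inverse t \<in> place_ring R'" using z(1) P'.\<O>_closed(6) by simp
    have tp: "t powi j \<in> place_ring R'" for j
      using it R_sub[OF t_R] sub P'.\<O>_closed(7) by (auto simp: power_int_def)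
    have "f \<in> place_ring R'" for f
    proof (cases "f = 0")
      case False
      obtain v where v: "v \<in> \<U>" "f = t powi (place_val R f) * v" using val_decomp[OF False] by blast
      have "v \<in> place_ring R'" using unit_\<O>[OF v(1)] sub by blast
      then show ?thesis using P'.\<O>_closed(6)[OF tp] by (subst v(2)) blast
    qed (simp add: P'.\<O>_closed(1))
    then show False using P'.\<O>_ne by auto
  qed
  then show ?thesis using R_eq P'.R_eq by simp
qed

end

lemma irreducible_poly_degree:
  fixes \<pi> :: "'a::field poly"
  assumes "Factorial_Ring.irreducible \<pi>"
  shows "0 < degree \<pi>" "\<pi> = f * g \<Longrightarrow> degree f = 0 \<or> degree g = 0"
proof -
  have 0: "\<pi> \<noteq> 0" "\<not> \<pi> dvd 1" using assms by (auto simp: Factorial_Ring.irreducible_def)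
  then show "0 < degree \<pi>" using is_unit_iff_degree[of \<pi>] by auto
  assume "\<pi> = f * g"
  then have "f dvd 1 \<or> g dvd 1" using assms by (auto simp: Factorial_Ring.irreducible_def)
  then show "degree f = 0 \<or> degree g = 0" by (auto simp: is_unit_poly_iff)
qed

lemma irreducible_polyI:
  fixes \<pi> :: "'a::field poly"
  assumes "0 < degree \<pi>" "\<And>f g. \<pi> = f * g \<Longrightarrow> degree f = 0 \<or> degree g = 0"
  shows "Factorial_Ring.irreducible \<pi>"
  unfolding Factorial_Ring.irreducible_def
proof (intro conjI allI impI)
  show "\<pi> \<noteq> 0" "\<not> \<pi> dvd 1" using assms(1) by (auto simp: is_unit_poly_iff)
  fix f g assume *: "\<pi> = f * g"
  then have "f \<noteq> 0" "g \<noteq> 0" using \<open>\<pi> \<noteq> 0\<close> by auto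
  then show "f dvd 1 \<or> g dvd 1" using assms(2)[OF *] by (auto simp: is_unit_iff_degree)
qed

text \<open>
  Bezout's identity by descent on the degree of \<open>b\<close>: replace \<open>b\<close> by its remainder modulo \<open>\<pi>\<close>, or, once
  its degree is below that of \<open>\<pi>\<close>, by the remainder of \<open>\<pi>\<close> modulo \<open>b\<close>.
\<close>

lemma irreducible_poly_inverse_mod:
  fixes \<pi> :: "'a::field poly"
  assumes irr: "Factorial_Ring.irreducible \<pi>" and "\<not> \<pi> dvd b"
  shows "\<exists>c. \<pi> dvd 1 - b * c"
  using assms(2)
proof (induction "degree b" arbitrary: b rule: less_induct)
  case less
  have \<pi>0: "\<pi> \<noteq> 0" using irr by auto
  have b0: "b \<noteq> 0" using less.prems by auto
  consider "degree b = 0" | "0 < degree b" "degree \<pi> \<le> degree b" | "0 < degree b" "degree b < degree \<pi>"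
    by linarith
  then show ?case
  proof cases
    case 1
    then obtain d where d: "b = [:d:]" by (auto elim: degree_eq_zeroE)
    then have "1 - b * [:inverse d:] = 0" using b0 by (simp add: one_pCons)
    then show ?thesis by (metis dvd_0_right)
  next
    case 2
    define r where "r = b mod \<pi>"
    have *: "\<not> \<pi> dvd r" using less.prems by (simp add: r_def dvd_mod_iff)
    then have "r \<noteq> 0" by auto
    then have "degree r < degree \<pi>" unfolding r_def using degree_mod_less[OF \<pi>0, of b] by auto
    then obtain c where c: "\<pi> dvd 1 - r * c" using less.hyps[of r] 2 * by auto
    have "1 - b * c = (1 - r * c) - \<pi> * (b div \<pi> * c)"
      unfolding r_def by (simp add: algebra_simps flip: minus_div_mult_eq_mod)
    then show ?thesis using c by (metis dvd_diff dvd_triv_left)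
  next
    case 3
    define r where "r = \<pi> mod b"
    have r0: "r \<noteq> 0"
    proof
      assume "r = 0"
      then obtain s where s: "\<pi> = b * s" unfolding r_def by (auto simp: mod_eq_0_iff_dvd)
      then have "s \<noteq> 0" using \<pi>0 by auto
      then have "degree \<pi> = degree b + degree s" unfolding s using b0 by (intro degree_mult_eq)
      then show False using irreducible_poly_degree(2)[OF irr s] 3 by auto
    qed
    then have dr: "degree r < degree b" unfolding r_def using degree_mod_less[OF b0, of \<pi>] by auto
    then have "\<not> \<pi> dvd r" using r0 3 by (meson dvd_imp_degree_le less_trans not_le)
    then obtain c where c: "\<pi> dvd 1 - r * c" using less.hyps[of r] dr by auto
    have e: "b * (\<pi> div b) = \<pi> - r" unfolding r_def by (simp add: minus_mod_eq_mult_div)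
    have "1 - b * (- (\<pi> div b) * c) = 1 + b * (\<pi> div b) * c" by (simp add: algebra_simps)
    then have "1 - b * (- (\<pi> div b) * c) = (1 - r * c) + \<pi> * c"
      unfolding e by (simp add: algebra_simps)
    then show ?thesis using c by (metis dvd_add dvd_triv_left)
  qed
qed

lemma irreducible_poly_decomp:
  fixes \<pi> :: "'a::field poly"
  assumes irr: "Factorial_Ring.irreducible \<pi>" and "f \<noteq> 0"
  shows "\<exists>k g. f = \<pi> ^ k * g \<and> \<not> \<pi> dvd g"
  using assms(2)
proof (induction "degree f" arbitrary: f rule: less_induct)
  case less
  show ?case
  proof (cases "\<pi> dvd f")
    case True
    then obtain g where g: "f = \<pi> * g" by auto
    then have "\<pi> \<noteq> 0" "g \<noteq> 0" using less.prems by auto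
    then have "degree f = degree \<pi> + degree g" unfolding g by (rule degree_mult_eq)
    then have "degree g < degree f" using irreducible_poly_degree(1)[OF irr] by simp
    then obtain k g' where "g = \<pi> ^ k * g'" "\<not> \<pi> dvd g'" using less.hyps[of g] less.prems g by auto
    then have "f = \<pi> ^ Suc k * g' \<and> \<not> \<pi> dvd g'" using g by (simp add: mult.assoc)
    then show ?thesis by blast
  next
    case False
    then show ?thesis by (intro exI[of _ 0] exI[of _ f]) auto
  qed
qed

lemma const_fract_simps [simp]:
  "const_fract 0 = 0" "const_fract 1 = 1"
  "const_fract (c + d) = const_fract c + const_fract d"
  "const_fract (c - d) = const_fract c - const_fract d"
  "const_fract (- c) = - const_fract c"
  "const_fract (c * d) = const_fract c * const_fract d"
  "const_fract c = 0 \<longleftrightarrow> c = 0"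
  by (auto simp: const_fract_def simp flip: one_pCons to_fract_add to_fract_diff to_fract_mult to_fract_uminus)

lemma const_fract_inverse: "const_fract (inverse c) = inverse (const_fract c)"
proof (cases "c = 0")
  case False
  then have "const_fract c * const_fract (inverse c) = 1" by (simp flip: const_fract_simps(6))
  then show ?thesis by (rule inverse_unique [symmetric])
qed auto

lemma subfield_rat_consts: "subfield rat_consts ring_of_type_algebra"
proof -
  interpret F: field "ring_of_type_algebra :: 'a ring" by (rule field_from_type_algebra)
  have "const_fract \<in> ring_hom (ring_of_type_algebra :: 'a ring) ring_of_type_algebra"
    by (auto simp: ring_hom_def ring_of_type_algebra_simps)
  from subfield_type_algebra_range[OF this F.carrier_is_subfield] show ?thesis
    by (simp add: rat_consts_def ring_of_type_algebra_simps)
qed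

lemma poly_fract_cases:
  fixes z :: "'a::field poly fract"
  obtains f g where "g \<noteq> 0" "z = to_fract f / to_fract g"
  by (cases z) (metis Fract_conv_to_fract)

definition fract_X :: "'k::field poly fract" where
  "fract_X = to_fract [:0, 1:]"

lemma to_fract_pCons: "to_fract (pCons c f) = const_fract c + fract_X * to_fract f"
  by (simp add: const_fract_def fract_X_def flip: to_fract_add to_fract_mult)

locale rat_place = place_of_field rat_consts R for R :: "'k::field poly fract set"
begin

lemma const_\<O>: "const_fract c \<in> \<O>"
  using consts_in by (auto simp: rat_consts_def)

lemma const_fract_unit: "c \<noteq> 0 \<Longrightarrow> const_fract c \<in> \<U>"
  using const_\<O>[of c] const_\<O>[of "inverse c"] by (simp add: unit_iff const_fract_inverse)

end

locale finite_rat_place = rat_place R for R :: "'k::field poly fract set" +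
  assumes X_in: "fract_X \<in> \<O>"
begin

lemma poly_\<O>: "to_fract f \<in> \<O>"
  by (induction f) (auto simp: to_fract_pCons intro: \<O>_closed const_\<O> X_in)

text \<open>
  The polynomials that lie in the place form a nonzero prime ideal of the polynomial ring, which is
  generated by an element of least degree.
\<close>

lemma ex_place_poly: "\<exists>\<pi>. Factorial_Ring.irreducible \<pi> \<and> (\<forall>f. to_fract f \<in> R \<longleftrightarrow> \<pi> dvd f)"
proof -
  have "\<exists>f. f \<noteq> 0 \<and> to_fract f \<in> R"
  proof (rule ccontr)
    assume neg: "\<not> ?thesis"
    have "z \<in> \<O>" for z
    proof -
      obtain f g where z: "g \<noteq> 0" "z = to_fract f / to_fract g" by (rule poly_fract_cases[of z])
      have "to_fract g \<in> \<U>" using neg z(1) poly_\<O> by (auto simp: place_units_def)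
      then show ?thesis using poly_\<O>[of f] by (auto simp: z(2) divide_inverse unit_iff intro!: \<O>_closed)
    qed
    then show False using \<O>_ne by auto
  qed
  then have "\<exists>d. \<exists>f. f \<noteq> 0 \<and> to_fract f \<in> R \<and> degree f = d" by auto
  from LeastI_ex[OF this] obtain \<pi> where \<pi>: "\<pi> \<noteq> 0" "to_fract \<pi> \<in> R"
    and deg: "degree \<pi> = (LEAST d. \<exists>f. f \<noteq> 0 \<and> to_fract f \<in> R \<and> degree f = d)" by auto
  have min: "degree \<pi> \<le> degree f" if "f \<noteq> 0" "to_fract f \<in> R" for f
    unfolding deg using that by (intro Least_le) auto
  have dvd: "to_fract f \<in> R \<longleftrightarrow> \<pi> dvd f" for f
  proof
    assume f: "to_fract f \<in> R"
    have "to_fract (f mod \<pi>) = to_fract f - to_fract \<pi> * to_fract (f div \<pi>)"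
      by (simp add: minus_mult_div_eq_mod flip: to_fract_mult to_fract_diff)
    then have "to_fract (f mod \<pi>) \<in> R" using f \<pi>(2) poly_\<O> by (auto intro: R_diff R_mult)
    then have "f mod \<pi> = 0" using min degree_mod_less[OF \<pi>(1), of f] by (meson not_le)
    then show "\<pi> dvd f" by auto
  next
    assume "\<pi> dvd f"
    then obtain g where "f = \<pi> * g" by (rule dvdE)
    then show "to_fract f \<in> R" using R_mult[OF \<pi>(2) poly_\<O>[of g]] by simp
  qed
  have "Factorial_Ring.irreducible \<pi>"
  proof (rule irreducible_polyI)
    show "0 < degree \<pi>"
    proof (rule ccontr)
      assume "\<not> 0 < degree \<pi>"
      then have "\<pi> dvd 1" using \<pi>(1) by (simp add: is_unit_iff_degree)
      then have "1 \<in> R" using dvd[of 1] by simp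
      then show False using unit_not_R[OF one_unit] by blast
    qed
    fix f g assume fg: "\<pi> = f * g"
    then have nz: "f \<noteq> 0" "g \<noteq> 0" using \<pi>(1) by auto
    then have d: "degree \<pi> = degree f + degree g" unfolding fg by (intro degree_mult_eq)
    have "to_fract f \<in> R \<or> to_fract g \<in> R"
    proof (rule ccontr)
      assume "\<not> ?thesis"
      then have "to_fract f * to_fract g \<in> \<U>"
        using poly_\<O> by (intro units_mult) (auto simp: place_units_def)
      then show False using \<pi>(2) unit_not_R by (simp add: fg)
    qed
    then show "degree f = 0 \<or> degree g = 0" using min nz d by fastforce
  qed
  then show ?thesis using dvd by blast
qed

definition place_poly :: "'k poly" where
  "place_poly = (SOME \<pi>. Factorial_Ring.irreducible \<pi> \<and> (\<forall>f. to_fract f \<in> R \<longleftrightarrow> \<pi> dvd f))"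

lemma place_poly: "Factorial_Ring.irreducible place_poly" "to_fract f \<in> R \<longleftrightarrow> place_poly dvd f"
proof -
  have *: "Factorial_Ring.irreducible place_poly \<and> (\<forall>f. to_fract f \<in> R \<longleftrightarrow> place_poly dvd f)"
    unfolding place_poly_def by (rule someI_ex[OF ex_place_poly])
  show "Factorial_Ring.irreducible place_poly" by (rule conjunct1[OF *])
  show "to_fract f \<in> R \<longleftrightarrow> place_poly dvd f" by (rule spec[OF conjunct2[OF *]])
qed

lemma poly_unit: "\<not> place_poly dvd f \<Longrightarrow> to_fract f \<in> \<U>"
  using poly_\<O> by (auto simp: place_units_def place_poly(2))

lemma place_poly_nz: "place_poly \<noteq> 0"
  using place_poly(1) not_irreducible_zero by metis

lemma fract_decomp:
  assumes "z \<noteq> 0"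
  obtains f g and k :: int where "\<not> place_poly dvd f" "\<not> place_poly dvd g"
    "z = to_fract place_poly powi k * (to_fract f / to_fract g)"
proof -
  obtain f g where z: "g \<noteq> 0" "z = to_fract f / to_fract g" by (rule poly_fract_cases[of z])
  have "f \<noteq> 0" using z assms by auto
  then obtain i f' where f: "f = place_poly ^ i * f'" "\<not> place_poly dvd f'"
    using irreducible_poly_decomp[OF place_poly(1)] by blast
  obtain j g' where g: "g = place_poly ^ j * g'" "\<not> place_poly dvd g'"
    using irreducible_poly_decomp[OF place_poly(1) z(1)] by blast
  have pw: "to_fract (place_poly ^ i) = to_fract place_poly ^ i" for i
    by (induction i) auto
  have "z = to_fract place_poly powi (int i - int j) * (to_fract f' / to_fract g')"
    using place_poly_nz by (simp add: z(2) f(1) g(1) pw power_int_diff)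
  then show thesis using that f(2) g(2) by blast
qed

lemma unif_place_poly: "uniformizer R (to_fract place_poly)"
  unfolding uniformizer_def
proof (intro conjI allI impI)
  show "to_fract place_poly \<noteq> 0" using place_poly_nz by simp
  show "to_fract place_poly \<in> R" by (simp add: place_poly(2))
  fix z :: "'k poly fract" assume "z \<noteq> 0"
  then obtain f g k where fg: "\<not> place_poly dvd f" "\<not> place_poly dvd g"
    "z = to_fract place_poly powi k * (to_fract f / to_fract g)" by (rule fract_decomp)
  have "to_fract f / to_fract g \<in> \<U>"
    using poly_unit[OF fg(1)] poly_unit[OF fg(2)] by (simp add: divide_inverse units_mult units_inverse)
  then show "\<exists>k. \<exists>u\<in>\<U>. z = to_fract place_poly powi k * u" by (intro exI bexI) (rule fg(3))
qed

sublocale discrete_place rat_consts R "to_fract place_poly"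
  by unfold_locales (rule unif_place_poly)

lemma \<O>_fract:
  assumes "z \<in> \<O>"
  obtains f g where "\<not> place_poly dvd g" "z = to_fract f / to_fract g"
proof (cases "z = 0")
  case True
  have "\<not> place_poly dvd 1" using place_poly(1) unfolding Factorial_Ring.irreducible_def by metis
  then show thesis using that[of 1 0] True by simp
next
  case False
  then obtain f g k where fg: "\<not> place_poly dvd f" "\<not> place_poly dvd g"
    "z = to_fract place_poly powi k * (to_fract f / to_fract g)" by (rule fract_decomp)
  have "to_fract f / to_fract g \<in> \<U>"
    using poly_unit[OF fg(1)] poly_unit[OF fg(2)] by (simp add: divide_inverse units_mult units_inverse)
  then have "0 \<le> k" using powi_unit_iff(1)[of "to_fract f / to_fract g" k] assms unfolding fg(3) by simp
  have pw: "to_fract (place_poly ^ i) = to_fract place_poly ^ i" for i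
    by (induction i) auto
  have "z = to_fract (place_poly ^ nat k * f) / to_fract g"
    using \<open>0 \<le> k\<close> fg(3) by (simp add: pw power_int_def)
  then show thesis using that fg(2) by blast
qed

lemma residue_basis_powers: "residue_basis rat_consts R (degree place_poly) (\<lambda>i. to_fract (monom 1 i))"
proof (rule residue_basisI)
  have lin: "(\<Sum>i<d. const_fract (coeff g i) * to_fract (monom 1 i)) = to_fract g"
    if "degree g < d" for g :: "'k poly" and d
  proof -
    have "to_fract (\<Sum>i\<in>S. monom (coeff g i) i) = (\<Sum>i\<in>S. const_fract (coeff g i) * to_fract (monom 1 i))"
      if "finite S" for S
      using that by (induction S) (auto simp: const_fract_def smult_monom simp flip: to_fract_mult)
    moreover have "(\<Sum>i<d. monom (coeff g i) i) = g"
    proof -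
      have "(\<Sum>i<d. monom (coeff g i) i) = (\<Sum>i\<le>degree g. monom (coeff g i) i)"
        using that by (intro sum.mono_neutral_right) (auto simp: coeff_eq_0)
      then show ?thesis by (simp add: poly_as_sum_of_monoms)
    qed
    ultimately show ?thesis by (metis finite_lessThan)
  qed
  show "to_fract (monom 1 i) \<in> \<O>" for i by (rule poly_\<O>)
  show "\<exists>c. (\<forall>i<degree place_poly. c i \<in> rat_consts) \<and>
      z - (\<Sum>i<degree place_poly. c i * to_fract (monom 1 i)) \<in> R" if z: "z \<in> \<O>" for z
  proof -
    obtain f g where fg: "\<not> place_poly dvd g" "z = to_fract f / to_fract g" using \<O>_fract[OF z] .
    obtain c where c: "place_poly dvd 1 - g * c"
      using irreducible_poly_inverse_mod[OF place_poly(1) fg(1)] by blast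
    define r where "r = (f * c) mod place_poly"
    have "f - g * r = f * (1 - g * c) + g * place_poly * ((f * c) div place_poly)"
      unfolding r_def by (simp add: algebra_simps flip: minus_mult_div_eq_mod)
    then have "place_poly dvd f - g * r" using c by simp
    then have "to_fract (f - g * r) \<in> R" by (simp only: place_poly(2))
    moreover have "inverse (to_fract g) \<in> \<O>" using poly_unit[OF fg(1)] by (simp add: unit_iff)
    ultimately have "to_fract (f - g * r) * inverse (to_fract g) \<in> R" by (rule R_mult)
    moreover have g0: "to_fract g \<noteq> 0" using fg(1) by auto
    moreover have "to_fract (f - g * r) * inverse (to_fract g) = z - to_fract r"
      using g0 by (simp add: fg(2) field_simps)
    moreover have "degree r < degree place_poly"
      using degree_mod_less[OF place_poly_nz, of "f * c"] irreducible_poly_degree(1)[OF place_poly(1)]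
      by (auto simp: r_def)
    ultimately have "z - (\<Sum>i<degree place_poly. const_fract (coeff r i) * to_fract (monom 1 i)) \<in> R"
      by (simp add: lin)
    then show ?thesis by (intro exI[of _ "\<lambda>i. const_fract (coeff r i)"]) (auto simp: rat_consts_def)
  qed
  show "\<forall>i<degree place_poly. c i = 0"
    if c: "\<forall>i<degree place_poly. c i \<in> rat_consts"
      and s: "(\<Sum>i<degree place_poly. c i * to_fract (monom 1 i)) \<in> R" for c
  proof -
    define d where "d = degree place_poly"
    have "\<forall>i. \<exists>b. i < d \<longrightarrow> c i = const_fract b" using c by (auto simp: rat_consts_def d_def)
    then obtain b where b: "\<And>i. i < d \<Longrightarrow> c i = const_fract (b i)" by metis
    define g where "g = (\<Sum>i<d. monom (b i) i)"
    have gi: "coeff g i = (if i < d then b i else 0)" for i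
      by (auto simp: g_def coeff_sum sum.delta if_distrib cong: if_cong)
    have d0: "0 < d" using irreducible_poly_degree(1)[OF place_poly(1)] by (simp add: d_def)
    have dg: "degree g < d"
    proof -
      have "degree g \<le> d - 1" by (rule degree_le) (auto simp: gi)
      then show ?thesis using d0 by simp
    qed
    have "to_fract g = (\<Sum>i<d. c i * to_fract (monom 1 i))"
      using lin[OF dg] b gi by (auto intro!: sum.cong)
    then have "to_fract g \<in> R" using s by (simp add: d_def)
    then have "place_poly dvd g" by (simp only: place_poly(2))
    then have "g = 0" using dg dvd_imp_degree_le unfolding d_def by (meson not_le)
    then have "b i = 0" if "i < d" for i using gi[of i] that by simp
    then show ?thesis using b by (simp add: d_def)
  qed
qed

lemma residue_degree: "place_degree rat_consts R = degree place_poly"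
  by (rule place_degree_eqI[OF subfield_rat_consts residue_basis_powers])

end

lemma fract_X_nz [simp]: "fract_X \<noteq> 0"
  by (simp add: fract_X_def)

locale infinite_rat_place = rat_place R for R :: "'k::field poly fract set" +
  assumes X_notin: "fract_X \<notin> \<O>"
begin

lemma inverse_X_R: "inverse fract_X \<in> R"
  by (rule not_\<O>(1)[OF X_notin])

text \<open>
  Divided by the power of \<open>x\<close> that belongs to its degree, a polynomial becomes a polynomial in \<open>1/x\<close>
  whose constant term is the leading coefficient.
\<close>

lemma poly_times_power_unit: "f \<noteq> 0 \<Longrightarrow> to_fract f * inverse fract_X ^ degree f \<in> \<U>"
proof (induction f)
  case (pCons c f)
  show ?case
  proof (cases "f = 0")
    case True
    then show ?thesis using pCons.prems by (simp add: to_fract_pCons const_fract_unit)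
  next
    case False
    have "to_fract (pCons c f) * inverse fract_X ^ degree (pCons c f)
        = (fract_X * inverse fract_X) * (to_fract f * inverse fract_X ^ degree f)
          + inverse fract_X ^ Suc (degree f) * const_fract c"
      by (simp only: to_fract_pCons degree_pCons_eq[OF False] power_Suc) (simp only: algebra_simps)
    then have "to_fract (pCons c f) * inverse fract_X ^ degree (pCons c f)
        = to_fract f * inverse fract_X ^ degree f + inverse fract_X ^ Suc (degree f) * const_fract c"
      by (simp only: right_inverse[OF fract_X_nz]) simp
    moreover have "inverse fract_X ^ Suc (degree f) * const_fract c \<in> R"
      using R_power[OF inverse_X_R, of "Suc (degree f)"] const_\<O> R_mult by blast
    ultimately show ?thesis using pCons.IH[OF False] unit_plus_R by simp
  qed
qed auto

lemma poly_eq_powi_unit: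
  assumes "f \<noteq> 0"
  shows "\<exists>u\<in>\<U>. to_fract f = inverse fract_X powi (- int (degree f)) * u"
proof -
  have *: "z = t powi (- int d) * (z * t ^ d)" if "t \<noteq> 0" for z t :: "'k poly fract" and d
    using that by (simp add: power_int_minus)
  have "to_fract f = inverse fract_X powi (- int (degree f)) * (to_fract f * inverse fract_X ^ degree f)"
    by (rule *) simp
  then show ?thesis using poly_times_power_unit[OF assms] by (rule bexI)
qed

lemma unif_inverse_X: "uniformizer R (inverse fract_X)"
  unfolding uniformizer_def
proof (intro conjI allI impI)
  show "inverse fract_X \<noteq> 0" by simp
  show "inverse fract_X \<in> R" by (rule inverse_X_R)
  fix z :: "'k poly fract" assume z0: "z \<noteq> 0"
  obtain f g where z: "g \<noteq> 0" "z = to_fract f / to_fract g" by (rule poly_fract_cases[of z])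
  have f0: "f \<noteq> 0" using z z0 by auto
  from poly_eq_powi_unit[OF f0] obtain u where
    u: "u \<in> \<U>" "to_fract f = inverse fract_X powi (- int (degree f)) * u" by auto
  from poly_eq_powi_unit[OF z(1)] obtain v where
    v: "v \<in> \<U>" "to_fract g = inverse fract_X powi (- int (degree g)) * v" by auto
  have "z = inverse fract_X powi (- int (degree f) - (- int (degree g))) * (u * inverse v)"
    using unit_nz[OF v(1)] unfolding z(2) u(2) v(2)
    by (subst power_int_diff) (auto simp: field_simps)
  moreover have "u * inverse v \<in> \<U>" using u(1) v(1) by (intro units_mult units_inverse)
  ultimately show "\<exists>k. \<exists>u\<in>\<U>. z = inverse fract_X powi k * u" by metis
qed

sublocale discrete_place rat_consts R "inverse fract_X"
  by unfold_locales (rule unif_inverse_X)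

lemma val_poly: "f \<noteq> 0 \<Longrightarrow> place_val R (to_fract f) = - int (degree f)"
  using poly_eq_powi_unit place_val_eqI by blast

lemma val_fract:
  "f \<noteq> 0 \<Longrightarrow> g \<noteq> 0 \<Longrightarrow> place_val R (to_fract f / to_fract g) = int (degree g) - int (degree f)"
  by (simp add: divide_inverse val_mult val_inverse val_poly)

lemma residue_basis_one: "residue_basis rat_consts R (Suc 0) (\<lambda>i. 1)"
proof (rule residue_basisI)
  show "1 \<in> \<O>" by (rule \<O>_closed)
  show "\<exists>c. (\<forall>i<Suc 0. c i \<in> rat_consts) \<and> z - (\<Sum>i<Suc 0. c i * 1) \<in> R" if z: "z \<in> \<O>" for z
  proof (cases "z \<in> R")
    case True
    then show ?thesis
      using subringE(2)[OF subfieldE(1)[OF subfield_rat_consts]]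
      by (intro exI[of _ "\<lambda>i. 0"]) (simp add: ring_of_type_algebra_simps)
  next
    case False
    obtain f g where fg: "g \<noteq> 0" "z = to_fract f / to_fract g" by (rule poly_fract_cases[of z])
    have z0: "z \<noteq> 0" using False zero_R by auto
    then have f0: "f \<noteq> 0" using fg by auto
    have "z \<in> \<U>" using z False by (simp add: place_units_def)
    from val_unit[OF this] have deg: "degree f = degree g" using val_fract[OF f0 fg(1)] fg(2) by simp
    define c where "c = lead_coeff f / lead_coeff g"
    have eq: "z - const_fract c = to_fract (f - smult c g) / to_fract g"
    proof -
      have "to_fract (f - smult c g) = to_fract f - const_fract c * to_fract g"
        by (simp add: const_fract_def flip: to_fract_mult)
      then show ?thesis using fg by (simp add: field_simps)
    qed
    have "z - const_fract c \<in> R"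
    proof (cases "f - smult c g = 0")
      case True
      then show ?thesis by (simp only: eq) (simp add: zero_R)
    next
      case False
      have le: "degree (f - smult c g) \<le> degree g" using deg by (intro degree_diff_le) auto
      moreover have "degree (f - smult c g) \<noteq> degree g"
      proof
        assume *: "degree (f - smult c g) = degree g"
        have "coeff (f - smult c g) (degree g) = 0" using fg(1) deg by (simp add: c_def)
        then show False using False * by (metis leading_coeff_0_iff)
      qed
      ultimately have "0 < place_val R (z - const_fract c)"
        using val_fract[OF False fg(1)] by (simp add: eq)
      moreover have "z - const_fract c \<noteq> 0" using False fg(1) unfolding eq
        by (simp del: to_fract_diff)
      ultimately show ?thesis using val_R_iff by blast
    qed
    then show ?thesis by (intro exI[of _ "\<lambda>i. const_fract c"]) (simp add: rat_consts_def)
  qed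
  show "\<forall>i<Suc 0. c i = 0" if c: "\<forall>i<Suc 0. c i \<in> rat_consts" and s: "(\<Sum>i<Suc 0. c i * 1) \<in> R" for c :: "nat \<Rightarrow> _"
  proof -
    obtain d where d: "c 0 = const_fract d" using c by (auto simp: rat_consts_def)
    have "d = 0"
    proof (rule ccontr)
      assume "d \<noteq> 0"
      from unit_not_R[OF const_fract_unit[OF this]] show False using s d by simp
    qed
    then show ?thesis using d by simp
  qed
qed

lemma residue_degree: "place_degree rat_consts R = Suc 0"
  by (rule place_degree_eqI[OF subfield_rat_consts residue_basis_one])

end

lemma rat_place_cases:
  assumes "place rat_consts R"
  obtains "finite_rat_place R" | "infinite_rat_place R"
proof -
  interpret rat_place R by unfold_locales (rule assms)
  show thesis
    using that
    by (cases "fract_X \<in> \<O>")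
      (auto simp: finite_rat_place_def infinite_rat_place_def finite_rat_place_axioms_def
        infinite_rat_place_axioms_def rat_place_axioms)
qed

lemma rat_place_discrete:
  assumes "place rat_consts R"
  obtains t where "discrete_place rat_consts R t"
  using assms
proof (cases rule: rat_place_cases)
  case 1
  then interpret finite_rat_place R .
  show thesis by (rule that[OF discrete_place_axioms])
next
  case 2
  then interpret infinite_rat_place R .
  show thesis by (rule that[OF discrete_place_axioms])
qed

lemma rat_place_val:
  assumes "place rat_consts R"
  shows rat_val_\<O>_iff: "z \<noteq> 0 \<Longrightarrow> z \<in> place_ring R \<longleftrightarrow> 0 \<le> place_val R z"
    and rat_val_add_ge: "k \<le> place_val R z \<Longrightarrow> k \<le> place_val R w \<Longrightarrow> z + w \<noteq> 0 \<Longrightarrow> k \<le> place_val R (z + w)"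
    and rat_val_add_eq: "z \<noteq> 0 \<Longrightarrow> place_val R z < place_val R w \<Longrightarrow>
           z + w \<noteq> 0 \<and> place_val R (z + w) = place_val R z"
    and rat_val_const_mult: "c \<noteq> 0 \<Longrightarrow> z \<noteq> 0 \<Longrightarrow> place_val R (const_fract c * z) = place_val R z"
proof -
  obtain t where "discrete_place rat_consts R t" using rat_place_discrete[OF assms] .
  then interpret discrete_place rat_consts R t .
  interpret rat_place R by unfold_locales
  show "z \<noteq> 0 \<Longrightarrow> z \<in> place_ring R \<longleftrightarrow> 0 \<le> place_val R z" by (rule val_\<O>_iff)
  show "k \<le> place_val R z \<Longrightarrow> k \<le> place_val R w \<Longrightarrow> z + w \<noteq> 0 \<Longrightarrow> k \<le> place_val R (z + w)"
    by (rule val_add_ge) auto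
  show "z \<noteq> 0 \<Longrightarrow> place_val R z < place_val R w \<Longrightarrow> z + w \<noteq> 0 \<and> place_val R (z + w) = place_val R z"
    by (rule val_add_eq) auto
  show "c \<noteq> 0 \<Longrightarrow> z \<noteq> 0 \<Longrightarrow> place_val R (const_fract c * z) = place_val R z"
    using val_unit[OF const_fract_unit] by (simp add: val_mult)
qed

lemma rat_place_residue_basis:
  assumes "place rat_consts R"
  shows "\<exists>d b. residue_basis rat_consts R d b"
  using assms by (cases rule: rat_place_cases)
    (blast intro: finite_rat_place.residue_basis_powers infinite_rat_place.residue_basis_one)+

lemma finite_not_infinite: "finite_rat_place R \<Longrightarrow> infinite_rat_place R \<Longrightarrow> False"
  using finite_rat_place.X_in infinite_rat_place.X_notin by blast

section \<open>Divisors of the rational function field\<close>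

lemma infinite_rat_place_unique:
  assumes "infinite_rat_place R" "infinite_rat_place R'"
  shows "R' = R"
proof -
  interpret R: infinite_rat_place R by (rule assms)
  interpret R': infinite_rat_place R' by (rule assms)
  have "z \<in> place_ring R'" if "z \<in> place_ring R" for z
  proof (cases "z = 0")
    case False
    obtain f g where z: "g \<noteq> 0" "z = to_fract f / to_fract g" by (rule poly_fract_cases[of z])
    then have "f \<noteq> 0" using False by auto
    from R.val_fract[OF this z(1)] R'.val_fract[OF this z(1)]
    show ?thesis using that R.val_\<O>_iff[OF False] R'.val_\<O>_iff[OF False] by (simp add: z(2))
  qed (simp add: R'.\<O>_closed(1))
  then show ?thesis using R.place_ring_maximal R'.is_place by blast
qed

text \<open>
  Irreducibility turns the divisibility of one place polynomial by the other into association, so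
  both places invert the same polynomials.
\<close>

lemma finite_rat_place_eqI:
  assumes "finite_rat_place R" "finite_rat_place R'" "to_fract (finite_rat_place.place_poly R) \<in> R'"
  shows "R' = R"
proof -
  interpret R: finite_rat_place R by (rule assms)
  interpret R': finite_rat_place R' by (rule assms)
  obtain g where g: "R.place_poly = R'.place_poly * g" using assms(3) by (auto simp: R'.place_poly(2))
  have "degree g = 0"
    using irreducible_poly_degree(2)[OF R.place_poly(1) g] irreducible_poly_degree(1)[OF R'.place_poly(1)]
    by auto
  then obtain c where c: "g = [:c:]" by (auto elim: degree_eq_zeroE)
  then have "c \<noteq> 0" using g R.place_poly_nz by auto
  then have "R'.place_poly = R.place_poly * [:inverse c:]" by (simp add: g c)
  then have dvd: "R.place_poly dvd R'.place_poly" by (rule dvdI)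
  have "z \<in> place_ring R'" if z: "z \<in> place_ring R" for z
  proof -
    obtain f g where fg: "\<not> R.place_poly dvd g" "z = to_fract f / to_fract g" using R.\<O>_fract[OF z] .
    have "\<not> R'.place_poly dvd g" using fg(1) dvd dvd_trans by blast
    from R'.units_inverse[OF R'.poly_unit[OF this]] show ?thesis
      using R'.\<O>_closed(6)[OF R'.poly_\<O>[of f] R'.unit_\<O>] by (simp add: fg(2) divide_inverse)
  qed
  then show ?thesis using R.place_ring_maximal R'.is_place by blast
qed

lemma ex_finite_rat_place:
  fixes f :: "'k::field poly"
  assumes "0 < degree f"
  shows "\<exists>R. finite_rat_place R \<and> to_fract f \<in> R"
proof -
  have 1: "subring_set (range (to_fract :: 'k poly \<Rightarrow> _))"
    unfolding subring_set_def
    by (auto simp flip: to_fract_diff to_fract_mult) (metis rangeI to_fract_1)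
  have 2: "\<forall>b\<in>range to_fract. to_fract f * b \<noteq> 1"
  proof
    fix b assume "b \<in> range (to_fract :: 'k poly \<Rightarrow> _)"
    then obtain g where g: "b = to_fract g" by auto
    have "f * g \<noteq> 1"
    proof
      assume "f * g = 1"
      then have "f dvd 1" by (metis dvd_triv_left)
      then show False using assms by (auto simp: is_unit_poly_iff)
    qed
    then show "to_fract f * b \<noteq> 1" by (simp add: g flip: to_fract_mult to_fract_1)
  qed
  obtain V where V: "subring_set V" "range to_fract \<subseteq> V" "\<forall>z. z \<in> V \<or> inverse z \<in> V"
    "\<forall>b\<in>V. to_fract f * b \<noteq> 1"
    using chevalley_extension[OF 1 rangeI 2] by blast
  define R where "R = {z \<in> V. z = 0 \<or> inverse z \<notin> V}"
  have f0: "f \<noteq> 0" using assms by auto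
  then have iv: "inverse (to_fract f) \<notin> V" using V(4) by auto
  have c: "rat_consts \<subseteq> V" using V(2) by (auto simp: rat_consts_def const_fract_def)
  have fc: "to_fract f \<notin> rat_consts" using assms by (auto simp: rat_consts_def const_fract_def)
  have tf: "to_fract f \<noteq> 0" "to_fract f \<in> V" using f0 V(2) by auto
  note R = place_of_valuation_ring[OF V(1,3) c tf iv fc, folded R_def]
  interpret rat_place R by unfold_locales (rule R(1))
  have "finite_rat_place R"
    by unfold_locales (use R(2) V(2) in \<open>auto simp: fract_X_def\<close>)
  then show ?thesis using R(3) by blast
qed

lemma ex_infinite_rat_place: "\<exists>R :: 'k::field poly fract set. infinite_rat_place R"
proof -
  define V :: "'k poly fract set"
    where "V = {z. \<exists>f g. g \<noteq> 0 \<and> degree f \<le> degree g \<and> z = to_fract f / to_fract g}"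
  have sub: "subring_set V"
    unfolding subring_set_def
  proof (intro conjI ballI)
    show "1 \<in> V" unfolding V_def by (intro CollectI exI[of _ 1]) auto
    fix x y assume "x \<in> V" "y \<in> V"
    then obtain f g f' g' where fg: "g \<noteq> 0" "degree f \<le> degree g" "x = to_fract f / to_fract g"
      and fg': "g' \<noteq> 0" "degree f' \<le> degree g'" "y = to_fract f' / to_fract g'"
      by (auto simp: V_def)
    have dgg: "degree (g * g') = degree g + degree g'" using fg(1) fg'(1) by (rule degree_mult_eq)
    have "degree (f * f') \<le> degree (g * g')"
      using degree_mult_le[of f f'] fg(2) fg'(2) dgg by linarith
    moreover have "x * y = to_fract (f * f') / to_fract (g * g')" by (simp add: fg fg')
    ultimately show "x * y \<in> V" unfolding V_def using fg(1) fg'(1) by (metis (mono_tags, lifting) mem_Collect_eq mult_eq_0_iff)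
    have "degree (f * g' - f' * g) \<le> degree (g * g')"
      using degree_mult_le[of f g'] degree_mult_le[of f' g] fg(2) fg'(2) dgg
      by (intro degree_diff_le) linarith+
    moreover have "x - y = to_fract (f * g' - f' * g) / to_fract (g * g')"
      using fg(1) fg'(1) by (simp add: fg(3) fg'(3) field_simps)
    ultimately show "x - y \<in> V" unfolding V_def using fg(1) fg'(1) by (metis (mono_tags, lifting) mem_Collect_eq mult_eq_0_iff)
  qed
  have tot: "\<forall>z. z \<in> V \<or> inverse z \<in> V"
  proof
    fix z :: "'k poly fract"
    obtain f g where z: "g \<noteq> 0" "z = to_fract f / to_fract g" by (rule poly_fract_cases[of z])
    show "z \<in> V \<or> inverse z \<in> V"
    proof (cases "degree f \<le> degree g")
      case True
      then show ?thesis using z unfolding V_def by blast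
    next
      case False
      then have "f \<noteq> 0" "degree g \<le> degree f" by auto
      moreover have "inverse z = to_fract g / to_fract f" by (simp add: z(2))
      ultimately show ?thesis unfolding V_def by blast
    qed
  qed
  have c: "rat_consts \<subseteq> V"
  proof
    fix z :: "'k poly fract" assume "z \<in> rat_consts"
    then obtain b where "z = to_fract [:b:] / to_fract 1" by (auto simp: rat_consts_def const_fract_def)
    then show "z \<in> V" unfolding V_def
      by (intro CollectI exI[of _ "[:b:]"] exI[of _ 1]) auto
  qed
  have X: "fract_X \<notin> V"
  proof
    assume "fract_X \<in> V"
    then obtain f g where fg: "g \<noteq> 0" "degree f \<le> degree g" "fract_X = to_fract f / to_fract (g :: 'k poly)"
      by (auto simp: V_def)
    then have "fract_X * to_fract g = to_fract f" by (simp add: field_simps)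
    then have "to_fract ([:0, 1:] * g) = to_fract f" by (simp only: to_fract_mult fract_X_def)
    then have "f = [:0, 1:] * g" by (simp only: to_fract_eq_iff)
    then have "degree f = Suc (degree g)" using fg(1) by simp
    then show False using fg(2) by simp
  qed
  have iX: "inverse fract_X \<in> V" using tot X by blast
  have iXc: "inverse fract_X \<notin> (rat_consts :: 'k poly fract set)"
  proof
    assume "inverse fract_X \<in> (rat_consts :: 'k poly fract set)"
    then obtain b where "inverse (fract_X :: 'k poly fract) = const_fract b" by (auto simp: rat_consts_def)
    then have "fract_X = const_fract (inverse b)" by (metis const_fract_inverse inverse_inverse_eq)
    then show False using c X by (auto simp: rat_consts_def)
  qed
  have iiX: "inverse (inverse fract_X) \<notin> V" using X by simp
  note pl = place_of_valuation_ring[OF sub tot c nonzero_imp_inverse_nonzero[OF fract_X_nz] iX iiX iXc]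
  define R where "R = {z \<in> V. z = 0 \<or> inverse z \<notin> V}"
  interpret rat_place R by unfold_locales (unfold R_def, rule pl(1))
  have "infinite_rat_place R"
    by unfold_locales (use X pl(2) in \<open>simp add: R_def\<close>)
  then show ?thesis by (rule exI)
qed

text \<open>
  In a fraction with denominator of least degree, a nonconstant denominator would be contained in
  some place; regularity there puts the numerator in the same place, and the generator of the
  place could be cancelled.
\<close>

lemma regular_at_finite_places_imp_poly:
  fixes z :: "'k::field poly fract"
  assumes reg: "\<And>R. finite_rat_place R \<Longrightarrow> z \<in> place_ring R"
  shows "\<exists>f. z = to_fract f"
proof -
  have "\<exists>d f g. g \<noteq> 0 \<and> z = to_fract f / to_fract g \<and> degree g = d" by (metis poly_fract_cases)
  from LeastI_ex[OF this] obtain f g where g0: "g \<noteq> 0" and z: "z = to_fract f / to_fract g"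
    and deg: "degree g = (LEAST d. \<exists>f g. g \<noteq> 0 \<and> z = to_fract f / to_fract g \<and> degree g = d)" by blast
  have min: "degree g \<le> degree g'" if "g' \<noteq> 0" "z = to_fract f' / to_fract g'" for f' g'
    unfolding deg using that by (intro Least_le) blast
  have "degree g = 0"
  proof (rule ccontr)
    assume "degree g \<noteq> 0"
    then obtain R where R: "finite_rat_place R" "to_fract g \<in> R" using ex_finite_rat_place[of g] by auto
    interpret finite_rat_place R by (rule R)
    have "to_fract g * z \<in> R" using R(2) reg[OF R(1)] by (rule R_mult)
    moreover have "to_fract g * z = to_fract f" using g0 by (simp add: z)
    ultimately have "place_poly dvd f" "place_poly dvd g" using R(2) place_poly(2) by auto
    then obtain f' g' where fg': "f = place_poly * f'" "g = place_poly * g'" by (auto elim!: dvdE)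
    have g'0: "g' \<noteq> 0" using fg' g0 by auto
    have "z = to_fract f' / to_fract g'" using place_poly_nz by (simp add: z fg')
    from min[OF g'0 this] have "degree g \<le> degree g'" .
    moreover have "degree g = degree place_poly + degree g'"
      unfolding fg'(2) using place_poly_nz g'0 by (rule degree_mult_eq)
    ultimately show False using irreducible_poly_degree(1)[OF place_poly(1)] by simp
  qed
  then obtain c where c: "g = [:c:]" by (auto elim: degree_eq_zeroE)
  then have "c \<noteq> 0" using g0 by auto
  then have "z = to_fract (smult (inverse c) f)"
    by (simp add: z c field_simps flip: to_fract_mult)
  then show ?thesis by blast
qed

definition place_product :: "'k::field poly fract set set \<Rightarrow> ('k poly fract set \<Rightarrow> int) \<Rightarrow> 'k poly fract" where
  "place_product S e = (\<Prod>R\<in>{R\<in>S. finite_rat_place R}. to_fract (finite_rat_place.place_poly R) powi e R)"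

lemma place_product_nz: "place_product S e \<noteq> 0"
  unfolding place_product_def
  by (cases "finite {R\<in>S. finite_rat_place R}") (auto simp: finite_rat_place.place_poly_nz)

lemma val_place_product_finite:
  assumes S: "finite S" and R: "finite_rat_place R"
  shows "place_val R (place_product S e) = (if R \<in> S then e R else 0)"
proof -
  interpret finite_rat_place R by (rule R)
  let ?S = "{R\<in>S. finite_rat_place R}"
  let ?p = "\<lambda>R'. to_fract (finite_rat_place.place_poly R')"
  have 1: "place_val R (?p R') = of_bool (R' = R)" if "finite_rat_place R'" for R'
  proof (cases "R' = R")
    case True
    then show ?thesis using val_unif by simp
  next
    case False
    then have "?p R' \<notin> R" using finite_rat_place_eqI[OF that R] by blast
    then have "?p R' \<in> \<U>" using poly_\<O> by (auto simp: place_units_def)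
    then show ?thesis using val_unit False by simp
  qed
  have "place_val R (place_product S e) = (\<Sum>R'\<in>?S. place_val R (?p R' powi e R'))"
    unfolding place_product_def
    by (rule val_prod) (auto simp: finite_rat_place.place_poly_nz)
  also have "\<dots> = (\<Sum>R'\<in>?S. e R' * of_bool (R' = R))"
    using 1 by (intro sum.cong) (auto simp: val_powi finite_rat_place.place_poly_nz)
  also have "\<dots> = (\<Sum>R'\<in>?S. if R' = R then e R' else 0)" by (intro sum.cong) auto
  also have "\<dots> = (if R \<in> S then e R else 0)" using S R by (subst sum.delta) auto
  finally show ?thesis .
qed

lemma val_place_product_infinite:
  assumes R: "infinite_rat_place R"
  shows "place_val R (place_product S e)
     = - (\<Sum>R'\<in>{R\<in>S. finite_rat_place R}. e R' * int (place_degree rat_consts R'))"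
proof -
  interpret infinite_rat_place R by (rule R)
  let ?S = "{R\<in>S. finite_rat_place R}"
  let ?p = "\<lambda>R'. finite_rat_place.place_poly R'"
  have "place_val R (place_product S e) = (\<Sum>R'\<in>?S. place_val R (to_fract (?p R') powi e R'))"
    unfolding place_product_def
    by (rule val_prod) (auto simp: finite_rat_place.place_poly_nz)
  also have "\<dots> = (\<Sum>R'\<in>?S. e R' * - int (place_degree rat_consts R'))"
    by (intro sum.cong)
      (auto simp: val_powi val_poly finite_rat_place.place_poly_nz finite_rat_place.residue_degree)
  finally show ?thesis by (simp add: sum_negf)
qed

lemma sum_places_split:
  fixes g :: "'k::field poly fract set \<Rightarrow> int"
  assumes S: "finite S" "\<And>R. R \<in> S \<Longrightarrow> place rat_consts R" and R: "infinite_rat_place R"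
  shows "(\<Sum>R'\<in>S. g R') = (\<Sum>R'\<in>{R\<in>S. finite_rat_place R}. g R') + (if R \<in> S then g R else 0)"
proof -
  have inf: "R' = R" if "R' \<in> S" "\<not> finite_rat_place R'" for R'
    using rat_place_cases[OF S(2)[OF that(1)]] that(2) infinite_rat_place_unique[OF R] by metis
  have nf: "\<not> finite_rat_place R" using R finite_not_infinite by metis
  have fin: "finite {R\<in>S. finite_rat_place R}" using S(1) by simp
  show ?thesis
  proof (cases "R \<in> S")
    case True
    then have "S = insert R {R\<in>S. finite_rat_place R}" using inf by blast
    moreover have "R \<notin> {R\<in>S. finite_rat_place R}" using nf by blast
    ultimately have "(\<Sum>R'\<in>S. g R') = g R + (\<Sum>R'\<in>{R\<in>S. finite_rat_place R}. g R')"
      using sum.insert[OF fin, of R g] by metis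
    then show ?thesis using True by simp
  next
    case False
    then have "S = {R\<in>S. finite_rat_place R}" using inf by blast
    then show ?thesis using False by simp
  qed
qed

text \<open>
  A divisor of degree zero supported on \<open>S\<close> is principal: a product of powers of irreducible
  polynomials realizes it at the finite places, and the degree condition then says that the order
  at infinity is the right one.
\<close>

theorem ex_fract_with_divisor:
  fixes S :: "'k::field poly fract set set"
  assumes S: "finite S" "\<And>R. R \<in> S \<Longrightarrow> place rat_consts R"
    and deg: "(\<Sum>R\<in>S. e R * int (place_degree rat_consts R)) = 0"
  shows "\<exists>f. f \<noteq> 0 \<and> (\<forall>R. place rat_consts R \<longrightarrow> place_val R f = (if R \<in> S then e R else 0))"
proof (intro exI conjI allI impI)
  show "place_product S e \<noteq> 0" by (rule place_product_nz)
  fix R :: "'k poly fract set" assume "place rat_consts R"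
  then show "place_val R (place_product S e) = (if R \<in> S then e R else 0)"
  proof (cases rule: rat_place_cases)
    case 1
    then show ?thesis by (rule val_place_product_finite[OF S(1)])
  next
    case 2
    then interpret infinite_rat_place R .
    show ?thesis
      using val_place_product_infinite[OF 2, of S e] deg residue_degree
        sum_places_split[OF S 2, of "\<lambda>R. e R * int (place_degree rat_consts R)"]
      by (auto split: if_splits)
  qed
qed

text \<open>
  The inequality half of the product formula. Clearing the finite part of \<open>S\<close> leaves a function without
  finite poles, that is a polynomial, and the order at infinity of a polynomial is not positive.
\<close>

theorem sum_val_degree_le_0:
  fixes S :: "'k::field poly fract set set"
  assumes S: "finite S" "\<And>R. R \<in> S \<Longrightarrow> place rat_consts R" and f: "f \<noteq> 0"
    and reg: "\<And>R. place rat_consts R \<Longrightarrow> R \<notin> S \<Longrightarrow> 0 \<le> place_val R f"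
  shows "(\<Sum>R\<in>S. place_val R f * int (place_degree rat_consts R)) \<le> 0"
proof -
  define g where "g = f * place_product S (\<lambda>R. - place_val R f)"
  have g0: "g \<noteq> 0" using f place_product_nz by (auto simp: g_def)
  have "g \<in> place_ring R" if R: "finite_rat_place R" for R
  proof -
    interpret finite_rat_place R by (rule R)
    have "place_val R g = place_val R f + (if R \<in> S then - place_val R f else 0)"
      unfolding g_def using f place_product_nz by (subst val_mult) (auto simp: val_place_product_finite[OF S(1) R])
    then show ?thesis using reg[OF is_place] val_\<O>_iff[OF g0] by auto
  qed
  from regular_at_finite_places_imp_poly[OF this] obtain a where a: "g = to_fract a" by blast
  obtain R :: "'k poly fract set" where R: "infinite_rat_place R" using ex_infinite_rat_place by blast
  interpret infinite_rat_place R by (rule R)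
  have "place_val R g \<le> 0" using val_poly[of a] g0 by (simp add: a)
  moreover have "place_val R g = place_val R f
      + (\<Sum>R'\<in>{R\<in>S. finite_rat_place R}. place_val R' f * int (place_degree rat_consts R'))"
    unfolding g_def using f place_product_nz
    by (subst val_mult) (auto simp: val_place_product_infinite[OF R] sum_negf)
  ultimately show ?thesis
    using sum_places_split[OF S R, of "\<lambda>R. place_val R f * int (place_degree rat_consts R)"]
      reg[OF is_place] residue_degree by (auto split: if_splits)
qed

section \<open>Linearized polynomials\<close>

lemma map_poly_add_hom:
  assumes "\<phi> 0 = 0" "\<And>x y. \<phi> (x + y) = \<phi> x + \<phi> y"
  shows "map_poly \<phi> (f + g) = map_poly \<phi> f + map_poly \<phi> g"
  by (rule poly_eqI) (simp add: coeff_map_poly assms)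

lemma poly_map_linearized_poly:
  fixes \<phi> :: "'a::field \<Rightarrow> 'b::field"
  assumes "\<phi> 0 = 0" "\<And>x y. \<phi> (x + y) = \<phi> x + \<phi> y"
  shows "poly (map_poly \<phi> (linearized_poly q m a)) z = (\<Sum>k\<le>m. \<phi> (a k) * z ^ (q ^ k))"
proof -
  have "map_poly \<phi> (\<Sum>k\<in>S. monom (a k) (q ^ k)) = (\<Sum>k\<in>S. monom (\<phi> (a k)) (q ^ k))" for S
    by (induction S rule: infinite_finite_induct)
      (simp_all add: map_poly_add_hom[of \<phi>, OF assms] map_poly_monom assms(1))
  then show ?thesis by (simp add: linearized_poly_def poly_sum poly_monom)
qed

lemma linear_power_sum_add:
  fixes z w :: "'b::field"
  assumes p: "Factorial_Ring.prime p" "CHAR('b) = p" and q: "q = p ^ e"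
  shows "(\<Sum>k\<le>m. c k * (z + w) ^ (q ^ k)) = (\<Sum>k\<le>m. c k * z ^ (q ^ k)) + (\<Sum>k\<le>m. c k * w ^ (q ^ k))"
proof -
  have "(z + w) ^ (q ^ k) = z ^ (q ^ k) + w ^ (q ^ k)" for k
    by (rule freshmans_dream') (auto simp: p q simp flip: power_mult)
  then show ?thesis by (simp add: algebra_simps sum.distrib)
qed

lemma CHAR_eq_prime_of_CARD:
  assumes p: "Factorial_Ring.prime p" and card: "CARD('k::{field,finite}) = p ^ d"
  shows "CHAR('k) = p"
proof -
  have "CHAR('k) dvd p ^ d" using CHAR_dvd_CARD[where 'a = 'k] card by simp
  moreover have "Factorial_Ring.prime CHAR('k)"
    by (rule prime_CHAR_semidom) (simp add: finite_imp_CHAR_pos)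
  ultimately have "CHAR('k) dvd p" using prime_dvd_power by blast
  then show ?thesis
    using p \<open>Factorial_Ring.prime CHAR('k)\<close> primes_dvd_imp_eq by blast
qed

lemma degree_linearized_poly:
  assumes q: "1 < q" and "a m \<noteq> 0"
  shows "degree (linearized_poly q m a) = q ^ m" "coeff (linearized_poly q m a) (q ^ m) = a m"
proof -
  have c: "coeff (linearized_poly q m a) i = (\<Sum>k\<le>m. if q ^ k = i then a k else 0)" for i
    by (simp add: linearized_poly_def coeff_sum)
  have "coeff (linearized_poly q m a) (q ^ m) = (\<Sum>k\<le>m. if k = m then a k else 0)"
    unfolding c using q by (intro sum.cong) auto
  then show 1: "coeff (linearized_poly q m a) (q ^ m) = a m" by simp
  have "coeff (linearized_poly q m a) i = 0" if "q ^ m < i" for i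
  proof -
    have "q ^ k \<noteq> i" if "k \<le> m" for k
      using \<open>q ^ m < i\<close> power_increasing[OF that, of q] q by auto
    then show ?thesis unfolding c by (intro sum.neutral) auto
  qed
  then have "degree (linearized_poly q m a) \<le> q ^ m" by (intro degree_le) auto
  moreover have "q ^ m \<le> degree (linearized_poly q m a)" using 1 assms(2) by (intro le_degree) simp
  ultimately show "degree (linearized_poly q m a) = q ^ m" by simp
qed

text \<open>
  In characteristic \<open>p\<close> the derivative of a linearized polynomial is the constant \<open>a 0\<close>, so all its
  roots in the algebraic closure are simple.
\<close>

lemma card_roots_linearized_poly:
  fixes a :: "nat \<Rightarrow> 'k::field"
  assumes p: "Factorial_Ring.prime p" "CHAR('k) = p" and e: "1 \<le> e" and q: "q = p ^ e"
    and am: "a m \<noteq> 0" and a0: "a 0 \<noteq> 0" and roots: "all_roots_in_base (linearized_poly q m a)"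
  shows "card {\<beta>. poly (linearized_poly q m a) \<beta> = 0} = q ^ m"
proof -
  let ?L = "linearized_poly q m a"
  define M where "M = map_poly to_ac ?L"
  have p1: "1 < p" using p(1) prime_gt_1_nat by blast
  then have q1: "1 < q" unfolding q using e one_less_power[of p e] by simp
  have dM: "degree M = q ^ m"
    unfolding M_def using degree_linearized_poly[of q a m] q1 am by (subst map_poly_degree_eq) auto
  then have M0: "M \<noteq> 0" using q1 by auto
  have qk: "of_nat (q ^ k) = (0::'k)" if "0 < k" for k
  proof -
    have "of_nat p = (0::'k)" using p(2) of_nat_CHAR by metis
    then show ?thesis using that e by (simp add: q)
  qed
  have "pderiv (monom (a k) (q ^ k)) = (if k = 0 then [:a 0:] else 0)" for k
    using qk[of k] by (auto simp: pderiv_monom monom_0 simp del: of_nat_power)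
  then have "pderiv (\<Sum>k\<in>S. monom (a k) (q ^ k)) = (\<Sum>k\<in>S. if k = 0 then [:a 0:] else 0)" for S
    by (induction S rule: infinite_finite_induct) (auto simp: pderiv_add)
  from this[of "{..m}"] have dL: "pderiv ?L = [:a 0:]"
    by (simp add: linearized_poly_def)
  have "pderiv M = map_poly to_ac (pderiv ?L)"
    by (rule poly_eqI) (simp add: M_def coeff_pderiv coeff_map_poly)
  then have dM': "pderiv M = [:to_ac (a 0):]" by (simp add: dL map_poly_pCons)
  obtain A where A: "size A = degree M" "M = smult (lead_coeff M) (\<Prod>x\<in>#A. [:-x, 1:])"
    using alg_closed_imp_factorization[OF M0] by blast
  have "count A x \<le> 1" for x
  proof (rule ccontr)
    assume "\<not> count A x \<le> 1"
    then have "{#x, x#} \<subseteq># A" by (auto simp: subseteq_mset_def)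
    then obtain B where "A = {#x, x#} + B" by (metis mset_subset_eq_exists_conv)
    define l where "l = (\<lambda>x :: 'k alg_closure. [:-x, 1:])"
    have "M = smult (lead_coeff M) (\<Prod>x\<in>#{#x, x#} + B. l x)"
      using A(2) \<open>A = {#x, x#} + B\<close> by (simp only: l_def)
    also have "(\<Prod>x\<in>#{#x, x#} + B. l x) = l x * (l x * (\<Prod>x\<in>#B. l x))" by simp
    finally have g: "M = smult (lead_coeff M) (l x * (l x * (\<Prod>x\<in>#B. l x)))" .
    have "poly (l x) x = 0" by (simp add: l_def)
    then have "poly (pderiv M) x = 0" by (subst g) (simp add: pderiv_smult pderiv_mult)
    then show False using a0 by (simp add: dM')
  qed
  then have "count A x = count (mset_set (set_mset A)) x" for x
    using count_greater_eq_one_iff[of A x] by (cases "x \<in># A") (auto simp: count_eq_zero_iff intro: le_antisym)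
  then have "A = mset_set (set_mset A)" by (rule multiset_eqI)
  then have "card (set_mset A) = q ^ m" using A(1) dM by (metis size_mset_set)
  moreover have "poly M z = 0 \<longleftrightarrow> z \<in># A" for z
  proof -
    have "poly M z = 0 \<longleftrightarrow> poly (\<Prod>x\<in>#A. [:-x, 1:]) z = 0"
      using M0 arg_cong[OF A(2), of "\<lambda>f. poly f z"] by simp
    then show ?thesis by (simp add: poly_prod_mset image_iff)
  qed
  then have "set_mset A = {z. poly M z = 0}" by auto
  moreover have "{z. poly M z = 0} = to_ac ` {\<beta>. poly ?L \<beta> = 0}"
  proof -
    have *: "poly M (to_ac \<beta>) = to_ac (poly ?L \<beta>)" for \<beta>
    proof -
      have "poly M (to_ac \<beta>) = (\<Sum>k\<le>m. to_ac (a k) * to_ac \<beta> ^ (q ^ k))"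
        unfolding M_def by (rule poly_map_linearized_poly) auto
      also have "\<dots> = to_ac (\<Sum>k\<le>m. a k * \<beta> ^ (q ^ k))" by (simp add: to_ac_sum)
      also have "(\<Sum>k\<le>m. a k * \<beta> ^ (q ^ k)) = poly ?L \<beta>"
        using poly_map_linearized_poly[of "\<lambda>x. x" q m a \<beta>] by simp
      finally show ?thesis .
    qed
    have "z \<in> range to_ac" if "poly M z = 0" for z
      using roots that by (auto simp: all_roots_in_base_def M_def)
    then show ?thesis using * by (force simp: image_iff)
  qed
  moreover have "card (to_ac ` {\<beta>. poly ?L \<beta> = 0}) = card {\<beta>. poly ?L \<beta> = 0}"
    by (rule card_image) (meson inj_on_subset inj_to_ac subset_UNIV)
  ultimately show ?thesis by simp
qed

text \<open>
  Newton interpolation over a subring: when the differences of the nodes are invertible in the ring,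
  divided differences stay in the ring, hence so do the coefficients.
\<close>

lemma coeffs_in_subring_of_values:
  fixes f :: "'f::field poly"
  assumes V: "subring_set V" and W: "finite W" "W \<subseteq> V" "degree f < card W"
    and diff: "\<And>x y. x \<in> W \<Longrightarrow> y \<in> W \<Longrightarrow> x \<noteq> y \<Longrightarrow> inverse (x - y) \<in> V"
    and vals: "\<And>x. x \<in> W \<Longrightarrow> poly f x \<in> V"
  shows "coeff f i \<in> V"
  using W diff vals
proof (induction "card W" arbitrary: W f i)
  case 0
  then show ?case by simp
next
  case (Suc d)
  note Vc = subring_setD[OF V]
  obtain w where w: "w \<in> W" using Suc.hyps(2) by fastforce
  define g where "g = synthetic_div f w"
  have f: "f = [:-w, 1:] * g + [:poly f w:]" unfolding g_def by (rule synthetic_div_correct' [symmetric])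
  have wV: "w \<in> V" "poly f w \<in> V" using w Suc.prems by auto
  have "coeff g j \<in> V" for j
  proof (cases "d = 0")
    case True
    then have "degree f = 0" using Suc by simp
    then have "g = 0" by (simp add: g_def synthetic_div_eq_0_iff)
    then show ?thesis using Vc(1) by simp
  next
    case False
    have card: "card (W - {w}) = d" using Suc.hyps(2) w Suc.prems(1) by simp
    show ?thesis
    proof (rule Suc.hyps(1)[of "W - {w}"])
      show "d = card (W - {w})" using card by simp
      show "finite (W - {w})" "W - {w} \<subseteq> V" using Suc.prems by auto
      show "degree g < card (W - {w})"
        using Suc.prems(3) Suc.hyps(2) card False by (simp add: g_def degree_synthetic_div)
      show "inverse (x - y) \<in> V" if "x \<in> W - {w}" "y \<in> W - {w}" "x \<noteq> y" for x y
        using Suc.prems(4) that by auto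
      show "poly g x \<in> V" if x: "x \<in> W - {w}" for x
      proof -
        have "poly f x = (x - w) * poly g x + poly f w" by (subst f) (simp add: algebra_simps)
        then have "poly g x = (poly f x - poly f w) * inverse (x - w)"
          using x by (simp add: field_simps)
        moreover have "inverse (x - w) \<in> V" using Suc.prems(4)[of x w] x w by auto
        moreover have "poly f x \<in> V" using Suc.prems(5) x by auto
        ultimately show ?thesis using wV Vc by simp
      qed
    qed
  qed
  moreover have "coeff f i = (case i of 0 \<Rightarrow> - w * coeff g 0 + poly f w | Suc j \<Rightarrow> - w * coeff g i + coeff g j)"
    by (subst f) (simp add: coeff_pCons split: nat.split)
  ultimately show ?case using wV Vc by (auto split: nat.split)
qed

section \<open>Inverse images of places\<close>

lemma ring_hom_type_algebraD:
  fixes \<phi> :: "'a::field \<Rightarrow> 'b::field"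
  assumes "\<phi> \<in> ring_hom ring_of_type_algebra ring_of_type_algebra"
  shows "\<phi> 1 = 1" "\<phi> (x + y) = \<phi> x + \<phi> y" "\<phi> (x * y) = \<phi> x * \<phi> y"
  using assms by (auto simp: ring_hom_def ring_of_type_algebra_simps)

locale field_embedding =
  fixes \<phi> :: "'a::field \<Rightarrow> 'b::field"
  assumes hom1: "\<phi> 1 = 1" and hom_add: "\<phi> (x + y) = \<phi> x + \<phi> y" and hom_mult: "\<phi> (x * y) = \<phi> x * \<phi> y"
begin

lemma hom_0: "\<phi> 0 = 0"
proof -
  have "\<phi> 0 + \<phi> 0 = \<phi> 0 + 0" using hom_add[of 0 0] by simp
  then show ?thesis by (rule add_left_imp_eq)
qed

lemma hom_uminus: "\<phi> (- x) = - \<phi> x"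
  using hom_add[of x "- x"] by (simp add: hom_0 eq_neg_iff_add_eq_0 Groups.add_ac)

lemma hom_diff: "\<phi> (x - y) = \<phi> x - \<phi> y"
  using hom_add[of x "- y"] by (simp add: hom_uminus)

lemma hom_inverse: "\<phi> (inverse x) = inverse (\<phi> x)"
proof (cases "x = 0")
  case False
  then have "\<phi> x * \<phi> (inverse x) = 1" by (simp flip: hom_mult add: hom1)
  then show ?thesis by (rule inverse_unique [symmetric])
qed (simp add: hom_0)

lemma hom_eq_0_iff: "\<phi> x = 0 \<longleftrightarrow> x = 0"
proof
  assume *: "\<phi> x = 0"
  show "x = 0"
  proof (rule ccontr)
    assume "x \<noteq> 0"
    then have "\<phi> x * \<phi> (inverse x) = 1" by (simp flip: hom_mult add: hom1)
    then show False using * by simp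
  qed
qed (simp add: hom_0)

lemma hom_power: "\<phi> (x ^ k) = \<phi> x ^ k"
  by (induction k) (auto simp: hom1 hom_mult)

lemma hom_powi: "\<phi> (x powi k) = \<phi> x powi k"
  by (auto simp: power_int_def hom_power hom_inverse)

lemma hom_sum: "\<phi> (sum g S) = (\<Sum>i\<in>S. \<phi> (g i))"
  by (induction S rule: infinite_finite_induct) (auto simp: hom_0 hom_add)

lemma hom_inj: "\<phi> x = \<phi> y \<longleftrightarrow> x = y"
  using hom_eq_0_iff[of "x - y"] by (simp add: hom_diff)

lemma in_ring_hom: "\<phi> \<in> ring_hom ring_of_type_algebra ring_of_type_algebra"
  by (auto simp: ring_hom_def ring_of_type_algebra_simps hom1 hom_add hom_mult)

lemma poly_map_add: "poly (map_poly \<phi> (f + g)) z = poly (map_poly \<phi> f) z + poly (map_poly \<phi> g) z"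
  by (simp add: map_poly_add_hom[of \<phi>, OF hom_0 hom_add])

lemma poly_map_mult: "poly (map_poly \<phi> (f * g)) z = poly (map_poly \<phi> f) z * poly (map_poly \<phi> g) z"
proof -
  have "map_poly \<phi> (f * g) = map_poly \<phi> f * map_poly \<phi> g"
    by (rule poly_eqI) (simp add: coeff_map_poly hom_0 coeff_mult hom_sum hom_mult)
  then show ?thesis by simp
qed

lemma poly_map_const: "poly (map_poly \<phi> [:c:]) z = \<phi> c"
  by (simp add: map_poly_pCons hom_0)

lemma poly_map_diff: "poly (map_poly \<phi> (f - g)) z = poly (map_poly \<phi> f) z - poly (map_poly \<phi> g) z"
proof -
  have "map_poly \<phi> (f - g) = map_poly \<phi> f - map_poly \<phi> g"
    by (rule poly_eqI) (simp add: coeff_map_poly hom_0 hom_diff)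
  then show ?thesis by simp
qed

lemma poly_map_altdef:
  assumes "degree f < n"
  shows "poly (map_poly \<phi> f) z = (\<Sum>j<n. \<phi> (coeff f j) * z ^ j)"
proof -
  have "degree (map_poly \<phi> f) \<le> degree f" by (rule map_poly_degree_leq)
  then have "poly (map_poly \<phi> f) z = (\<Sum>j<n. coeff (map_poly \<phi> f) j * z ^ j)"
    unfolding poly_altdef using assms by (intro sum.mono_neutral_left) (auto simp: coeff_eq_0)
  then show ?thesis by (simp add: coeff_map_poly hom_0)
qed

lemma place_vimage:
  assumes Q: "place C Q" and C': "\<phi> ` C' \<subseteq> C" and inv: "\<And>c. c \<in> C' \<Longrightarrow> inverse c \<in> C'"
    and w: "w \<noteq> 0" "\<phi> w \<in> Q"
  shows "place C' (\<phi> -` Q)" "place_ring (\<phi> -` Q) = \<phi> -` place_ring Q"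
proof -
  interpret Q: place_of_field C Q by unfold_locales (rule Q)
  let ?V = "\<phi> -` Q.\<O>"
  have V: "subring_set ?V"
    unfolding subring_set_def by (auto simp: hom1 hom_diff hom_mult intro: Q.\<O>_closed)
  have tot: "\<forall>z. z \<in> ?V \<or> inverse z \<in> ?V" using Q.total by (auto simp: hom_inverse)
  have sub: "C' \<subseteq> ?V" using C' Q.consts_in by auto
  have wV: "w \<in> ?V" using w Q.R_sub by auto
  have iw: "inverse w \<notin> ?V" using w Q.R_iff hom_eq_0_iff by (auto simp: hom_inverse)
  then have wC: "w \<notin> C'" using inv sub by blast
  have "{z \<in> ?V. z = 0 \<or> inverse z \<notin> ?V} = \<phi> -` Q"
    using Q.R_iff Q.\<O>_closed(1) by (auto simp: hom_inverse hom_eq_0_iff hom_0)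
  then show "place C' (\<phi> -` Q)" "place_ring (\<phi> -` Q) = ?V"
    using place_of_valuation_ring[OF V tot sub w(1) wV iw wC] by simp_all
qed

end

section \<open>Linearized function fields\<close>

locale linearized_ext = field_embedding \<iota>
  for \<iota> :: "'k::field poly fract \<Rightarrow> 'f::field" +
  fixes p e q m :: nat and a :: "nat \<Rightarrow> 'k" and h :: "'k poly fract" and y :: 'f
  assumes prime_p: "Factorial_Ring.prime p" and e_pos: "1 \<le> e" and q_eq: "q = p ^ e" and m_pos: "1 \<le> m"
    and char_k: "CHAR('k) = p" and h0: "h \<noteq> 0"
    and am: "a m \<noteq> 0" and a0: "a 0 \<noteq> 0"
    and roots: "all_roots_in_base (linearized_poly q m a)"
    and eqn: "poly (map_poly (\<iota> \<circ> const_fract) (linearized_poly q m a)) y = \<iota> h"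
    and gen: "generate_field ring_of_type_algebra (insert y (range \<iota>)) = UNIV"
begin

abbreviation "C \<equiv> ext_consts \<iota>"

definition N :: nat where "N = q ^ m"

lemma q_gt_1: "1 < q"
  using prime_gt_1_nat[OF prime_p] e_pos one_less_power[of p e] by (simp add: q_eq)

lemma N_gt_1: "1 < N"
  using q_gt_1 m_pos one_less_power[of q m] by (simp add: N_def)

lemma N_eq: "N = p ^ (e * m)"
  unfolding N_def by (simp add: q_eq power_mult)

definition \<kappa> :: "'k \<Rightarrow> 'f" where "\<kappa> c = \<iota> (const_fract c)"

lemma \<kappa>_simps [simp]: "\<kappa> 0 = 0" "\<kappa> (c + d) = \<kappa> c + \<kappa> d" "\<kappa> (c - d) = \<kappa> c - \<kappa> d" "\<kappa> c = 0 \<longleftrightarrow> c = 0"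
  by (simp_all add: \<kappa>_def hom_0 hom_add hom_diff hom_eq_0_iff)

lemma \<kappa>_C: "\<kappa> c \<in> C"
  by (auto simp: \<kappa>_def ext_consts_def rat_consts_def)

lemma C_eq: "C = range \<kappa>"
  by (auto simp: \<kappa>_def ext_consts_def rat_consts_def)

lemma \<kappa>_inverse: "\<kappa> (inverse c) = inverse (\<kappa> c)"
  by (simp add: \<kappa>_def const_fract_inverse hom_inverse)

lemma subfield_C: "subfield C ring_of_type_algebra"
  unfolding ext_consts_def by (rule subfield_type_algebra_range[OF in_ring_hom subfield_rat_consts])

lemma char_f: "CHAR('f) = p"
proof -
  have "of_nat k = (0::'f) \<longleftrightarrow> p dvd k" for k
  proof -
    have "of_nat k = \<kappa> (of_nat k)"
      by (induction k) (auto simp: \<kappa>_def hom1 hom_add hom_0)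
    then show ?thesis using char_k of_nat_eq_0_iff_char_dvd[where 'a = 'k] by simp
  qed
  then show ?thesis using of_nat_eq_0_iff_char_dvd[where 'a = 'f]
    by (metis dvd_antisym dvd_refl)
qed

definition Lf :: "'f \<Rightarrow> 'f" where "Lf z = (\<Sum>k\<le>m. \<kappa> (a k) * z ^ (q ^ k))"

lemma Lf_y: "Lf y = \<iota> h"
proof -
  have "poly (map_poly \<kappa> (linearized_poly q m a)) y = Lf y"
    unfolding Lf_def by (rule poly_map_linearized_poly) auto
  moreover have "\<kappa> = \<iota> \<circ> const_fract" by (auto simp: \<kappa>_def)
  ultimately show ?thesis using eqn by simp
qed

lemma Lf_add: "Lf (z + w) = Lf z + Lf w"
  unfolding Lf_def by (rule linear_power_sum_add[OF prime_p char_f q_eq])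

definition roots_L :: "'k set" where "roots_L = {\<beta>. poly (linearized_poly q m a) \<beta> = 0}"

lemma card_roots_L: "card roots_L = N"
  unfolding roots_L_def N_def by (rule card_roots_linearized_poly[OF prime_p char_k e_pos q_eq am a0 roots])

lemma Lf_root: "\<beta> \<in> roots_L \<Longrightarrow> Lf (\<kappa> \<beta>) = 0"
proof -
  assume "\<beta> \<in> roots_L"
  then have "(\<Sum>k\<le>m. a k * \<beta> ^ (q ^ k)) = 0"
    using poly_map_linearized_poly[of "\<lambda>x. x" q m a \<beta>] by (simp add: roots_L_def)
  then have "\<kappa> (\<Sum>k\<le>m. a k * \<beta> ^ (q ^ k)) = 0" by simp
  moreover have "\<kappa> (\<Sum>k\<in>S. a k * \<beta> ^ (q ^ k)) = (\<Sum>k\<in>S. \<kappa> (a k) * \<kappa> \<beta> ^ (q ^ k))" for S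
  proof -
    have mult: "\<kappa> (c * d) = \<kappa> c * \<kappa> d" for c d by (simp add: \<kappa>_def hom_mult)
    have "\<kappa> 1 = 1" by (simp add: \<kappa>_def hom1)
    then have pow: "\<kappa> (c ^ k) = \<kappa> c ^ k" for c k by (induction k) (auto simp: mult)
    show ?thesis by (induction S rule: infinite_finite_induct) (auto simp: mult pow)
  qed
  ultimately show ?thesis by (simp add: Lf_def)
qed

text \<open>
  Once a ramified place is available, \<open>M\<close> is the minimal polynomial of \<open>y\<close> over the rational function
  field. The point of evaluation is a parameter because the other roots \<open>y + \<beta>\<close> of \<open>M\<close> are needed as well.
\<close>

definition M :: "'k poly fract poly" where
  "M = map_poly const_fract (linearized_poly q m a) - [:h:]"

definition ev :: "'f \<Rightarrow> 'k poly fract poly \<Rightarrow> 'f" where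
  "ev z f = poly (map_poly \<iota> f) z"

lemma ev_simps: "ev z (f + g) = ev z f + ev z g" "ev z (f * g) = ev z f * ev z g"
  "ev z (f - g) = ev z f - ev z g" "ev z [:c:] = \<iota> c" "ev z 1 = 1" "ev z 0 = 0" "ev z [:0, 1:] = z"
  by (simp_all add: ev_def poly_map_add poly_map_mult poly_map_const poly_map_diff hom1 hom_0 map_poly_pCons)

lemma ev_M: "ev z M = Lf z - \<iota> h"
proof -
  have "map_poly \<iota> (map_poly const_fract (linearized_poly q m a)) = map_poly \<kappa> (linearized_poly q m a)"
    by (rule poly_eqI) (simp add: coeff_map_poly hom_0 \<kappa>_def)
  moreover have "poly (map_poly \<kappa> (linearized_poly q m a)) z = Lf z"
    unfolding Lf_def by (rule poly_map_linearized_poly) auto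
  ultimately show ?thesis by (simp add: M_def ev_simps(3,4)) (simp add: ev_def)
qed

lemma degree_M: "degree M = N"
proof -
  have "degree (map_poly const_fract (linearized_poly q m a)) = N"
    using degree_linearized_poly[of q a m, OF q_gt_1 am] am unfolding N_def by (subst map_poly_degree_eq) auto
  then show ?thesis unfolding M_def using N_gt_1
    by (subst diff_conv_add_uminus, subst degree_add_eq_left) auto
qed

lemma M_nz: "M \<noteq> 0"
  using degree_M N_gt_1 by (metis degree_0 not_less_zero)

text \<open>
  If \<open>y\<close> has a pole, the leading term dominates the linearized polynomial.
\<close>

lemma y_integral_relation:
  assumes Q: "place C Q" and y: "y \<notin> place_ring Q"
  shows "\<exists>u\<in>place_units Q. \<iota> h = y ^ N * u"
proof -
  interpret Q: place_of_field C Q by unfold_locales (rule Q)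
  have y0: "y \<noteq> 0" and iy: "inverse y \<in> Q" using Q.not_\<O>[OF y] by auto
  define r where "r = (\<Sum>k<m. \<kappa> (a k) * inverse y ^ (N - q ^ k))"
  have "\<kappa> (a k) * inverse y ^ (N - q ^ k) \<in> Q" if "k < m" for k
  proof -
    have "q ^ k < N" using that q_gt_1 by (simp add: N_def)
    then have "inverse y ^ (N - q ^ k) \<in> Q" using Q.R_power[OF iy, of "N - q ^ k"] by simp
    then show ?thesis using Q.consts_in \<kappa>_C[of "a k"] by (intro Q.R_mult') auto
  qed
  then have r: "r \<in> Q" unfolding r_def by (intro Q.R_sum) auto
  have "\<kappa> (a m) \<in> Q.\<U>"
    by (rule Q.const_unit) (use \<kappa>_C[of "a m"] \<kappa>_C[of "inverse (a m)"] am in \<open>auto simp: \<kappa>_inverse\<close>)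
  then have u: "\<kappa> (a m) + r \<in> Q.\<U>" using r by (rule Q.unit_plus_R)
  have "y ^ N * (\<kappa> (a k) * inverse y ^ (N - q ^ k)) = \<kappa> (a k) * y ^ (q ^ k)" if "k < m" for k
  proof -
    have "q ^ k \<le> N" using that q_gt_1 by (simp add: N_def)
    then have "y ^ N = y ^ (q ^ k) * y ^ (N - q ^ k)" by (simp flip: power_add)
    then show ?thesis using y0 by (simp add: power_inverse field_simps)
  qed
  then have "y ^ N * r = (\<Sum>k<m. \<kappa> (a k) * y ^ (q ^ k))"
    unfolding r_def sum_distrib_left by (intro sum.cong) auto
  then have "y ^ N * (\<kappa> (a m) + r) = Lf y"
    unfolding Lf_def N_def by (simp add: algebra_simps flip: lessThan_Suc_atMost)
  then show ?thesis using u Lf_y by metis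
qed

lemma \<iota>_consts: "\<iota> ` rat_consts \<subseteq> C"
  by (simp add: ext_consts_def)

lemma rat_consts_inverse: "c \<in> rat_consts \<Longrightarrow> inverse c \<in> (rat_consts :: 'k poly fract set)"
  by (auto simp: rat_consts_def simp flip: const_fract_inverse)

text \<open>
  The restriction of \<open>Q\<close> is again a place of the rational function field and contains \<open>P\<close>; since
  valuation rings of discrete places are maximal, it equals \<open>P\<close>.
\<close>

lemma lies_over_place_vimage:
  assumes Q: "place C Q" and P: "place rat_consts P" and over: "lies_over \<iota> Q P"
  shows "\<iota> -` Q = P" "\<iota> -` place_ring Q = place_ring P"
proof -
  obtain t where t: "discrete_place rat_consts P t" using rat_place_discrete[OF P] .
  interpret P: discrete_place rat_consts P t by (rule t)
  have "\<iota> t \<in> Q" using over P.t_R by (auto simp: lies_over_def)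
  note v = place_vimage[OF Q \<iota>_consts rat_consts_inverse P.t_nz this]
  obtain t' where t': "discrete_place rat_consts (\<iota> -` Q) t'" using rat_place_discrete[OF v(1)] .
  interpret P': discrete_place rat_consts "\<iota> -` Q" t' by (rule t')
  have "P \<subseteq> \<iota> -` Q" using over by (auto simp: lies_over_def)
  then have "place_ring (\<iota> -` Q) \<subseteq> place_ring P" by (auto simp: place_ring_def)
  from P'.place_ring_maximal[OF P this] show "\<iota> -` Q = P" by simp
  then show "\<iota> -` place_ring Q = place_ring P" using v(2) by simp
qed

lemma lies_over_units:
  assumes "place C Q" "place rat_consts P" "lies_over \<iota> Q P"
  shows "\<iota> u \<in> place_units Q \<longleftrightarrow> u \<in> place_units P"
  using lies_over_place_vimage[OF assms] by (auto simp: place_units_def)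

text \<open>
  Chevalley's theorem applies to the image of the valuation ring of \<open>P\<close> and a generator of \<open>P\<close>.
\<close>

lemma ex_place_over:
  assumes P: "place rat_consts P"
  shows "\<exists>Q. place C Q \<and> lies_over \<iota> Q P"
proof -
  obtain t where t: "discrete_place rat_consts P t" using rat_place_discrete[OF P] .
  interpret P: discrete_place rat_consts P t by (rule t)
  have A: "subring_set (\<iota> ` P.\<O>)"
    unfolding subring_set_def
    using hom1 P.\<O>_closed(2,5,6) by (auto simp flip: hom_diff hom_mult)
  have tA: "\<iota> t \<in> \<iota> ` P.\<O>" using P.t_R P.R_sub by blast
  have "\<forall>b\<in>\<iota> ` P.\<O>. \<iota> t * b \<noteq> 1"
  proof
    fix b assume "b \<in> \<iota> ` P.\<O>"
    then obtain c where c: "c \<in> P.\<O>" "b = \<iota> c" by auto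
    have "t * c \<noteq> 1" using P.R_mult[OF P.t_R c(1)] P.unit_not_R[OF P.one_unit] by auto
    then have "\<iota> (t * c) \<noteq> \<iota> 1" by (simp only: hom_inj not_False_eq_True)
    then show "\<iota> t * b \<noteq> 1" by (simp add: c hom_mult hom1)
  qed
  from chevalley_extension[OF A tA this] obtain V where V: "subring_set V" "\<iota> ` P.\<O> \<subseteq> V"
    "\<forall>z. z \<in> V \<or> inverse z \<in> V" "\<forall>b\<in>V. \<iota> t * b \<noteq> 1" by metis
  define Q where "Q = {z \<in> V. z = 0 \<or> inverse z \<notin> V}"
  have CV: "C \<subseteq> V" using V(2) P.consts_in by (auto simp: ext_consts_def)
  have t0: "\<iota> t \<noteq> 0" using P.t_nz hom_eq_0_iff by blast
  have tV: "\<iota> t \<in> V" using tA V(2) by blast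
  have itV: "inverse (\<iota> t) \<notin> V" using V(4) t0 by auto
  have tC: "\<iota> t \<notin> C"
  proof
    assume "\<iota> t \<in> C"
    then obtain c where "\<iota> t = \<kappa> c" by (auto simp: C_eq)
    then have "inverse (\<iota> t) \<in> C" by (simp add: \<kappa>_C flip: \<kappa>_inverse)
    then show False using itV CV by blast
  qed
  note Q = place_of_valuation_ring[OF V(1,3) CV t0 tV itV tC, folded Q_def]
  interpret Q: place_of_field C Q by unfold_locales (rule Q(1))
  have "\<iota> z \<in> Q" if "z \<in> P" for z
  proof -
    have "z \<in> (\<lambda>s. t * s) ` P.\<O>" using that P.R_principal by blast
    then obtain s where s: "s \<in> P.\<O>" "z = t * s" by auto
    have "\<iota> s \<in> Q.\<O>" using s(1) V(2) Q(2) by auto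
    then show ?thesis using Q.R_mult[OF Q(3)] by (simp add: s(2) hom_mult)
  qed
  then show ?thesis using Q(1) by (auto simp: lies_over_def)
qed

definition ramified :: "'k poly fract set \<Rightarrow> nat \<Rightarrow> bool" where
  "ramified P l \<longleftrightarrow> place rat_consts P \<and> place_val P h = - int l \<and> 0 < l \<and> \<not> p dvd l"

lemma coprime_N: "\<not> p dvd l \<Longrightarrow> coprime l N"
  using prime_imp_coprime[OF prime_p, of l] by (simp add: N_eq coprime_commute)

text \<open>
  The element \<open>w\<close> plays the role of a generator of \<open>Q\<close> with ramification index \<open>N\<close>. It is not yet called
  a uniformizer because that requires every element of the extension to be a power of \<open>w\<close> times a unit.
\<close>

definition adapted :: "'k poly fract set \<Rightarrow> nat \<Rightarrow> 'f set \<Rightarrow> 'f \<Rightarrow> bool" where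
  "adapted P l Q w \<longleftrightarrow> w \<noteq> 0 \<and> w \<in> Q \<and>
     (\<forall>f. f \<noteq> 0 \<longrightarrow> (\<exists>u\<in>place_units Q. \<iota> f = w powi (int N * place_val P f) * u)) \<and>
     (\<exists>u\<in>place_units Q. y = w powi (- int l) * u)"

text \<open>
  At a pole of \<open>h\<close> of order \<open>l\<close> prime to \<open>p\<close>, the equation gives \<open>y\<^sup>N \<sim> h \<sim> t\<^sup>-\<^sup>l\<close> up to units, where \<open>t\<close>
  generates \<open>P\<close>. With \<open>A N + B l = 1\<close>, the element \<open>w = t\<^sup>A y\<^sup>-\<^sup>B\<close> therefore satisfies \<open>w\<^sup>N \<sim> t\<close> and
  \<open>w\<^sup>-\<^sup>l \<sim> y\<close>.
\<close>

lemma ex_adapted: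
  assumes Q: "place C Q" and over: "lies_over \<iota> Q P" and ram: "ramified P l"
  shows "\<exists>w. adapted P l Q w"
proof -
  have P: "place rat_consts P" and vh: "place_val P h = - int l" and l: "0 < l" "\<not> p dvd l"
    using ram by (auto simp: ramified_def)
  obtain t where t: "discrete_place rat_consts P t" using rat_place_discrete[OF P] .
  interpret P: discrete_place rat_consts P t by (rule t)
  interpret Q: place_of_field C Q by unfold_locales (rule Q)
  note vim = lies_over_place_vimage[OF Q P over] and un = lies_over_units[OF Q P over]
  have t0: "\<iota> t \<noteq> 0" using P.t_nz by (simp add: hom_eq_0_iff)
  have tQ: "\<iota> t \<in> Q" using P.t_R vim(1) by auto
  obtain u2 where u2: "u2 \<in> P.\<U>" "h = t powi (- int l) * u2"
    using P.val_decomp[OF h0] vh by metis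
  have "y \<notin> Q.\<O>"
  proof
    assume "y \<in> Q.\<O>"
    then have "Lf y \<in> Q.\<O>"
      unfolding Lf_def using \<kappa>_C Q.consts_in
      by (intro subring_set_sum[OF Q.ring_\<O>] Q.\<O>_closed(6,7)) auto
    then have "h \<in> P.\<O>" using vim(2) Lf_y by auto
    then show False using P.val_\<O>_iff[OF h0] vh l by simp
  qed
  then obtain u1 where u1: "u1 \<in> Q.\<U>" "\<iota> h = y ^ N * u1" using y_integral_relation[OF Q] by blast
  have y0: "y \<noteq> 0" using \<open>y \<notin> Q.\<O>\<close> Q.\<O>_closed(1) by auto
  define v where "v = \<iota> u2 * inverse u1"
  have v: "v \<in> Q.\<U>" unfolding v_def using u2(1) un u1(1) by (intro Q.units_mult Q.units_inverse) auto
  have yN: "y powi int N = \<iota> t powi (- int l) * v"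
    using arg_cong[OF u2(2), of \<iota>] Q.unit_nz[OF u1(1)]
    by (simp add: u1(2) v_def hom_mult hom_powi field_simps)
  obtain A B where AB: "A * int N + B * int l = 1"
    using bezout_int[of "int N" "int l"] coprime_N[OF l(2)] by (metis coprime_commute coprime_imp_gcd_eq_1 coprime_int_iff)
  define w where "w = \<iota> t powi A * y powi (- B)"
  have w0: "w \<noteq> 0" using t0 y0 by (simp add: w_def)
  define v' where "v' = v powi (- B)"
  have v': "v' \<in> Q.\<U>" unfolding v'_def by (rule Q.units_powi[OF v])
  have "w powi int N = \<iota> t powi (A * int N) * (y powi int N) powi (- B)"
    by (simp only: w_def power_int_mult_distrib mult.commute[of "int N"] power_int_mult[symmetric])
  also have "(y powi int N) powi (- B) = \<iota> t powi (B * int l) * v'"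
    unfolding yN v'_def
    by (simp only: power_int_mult_distrib power_int_mult[symmetric] minus_mult_minus mult.commute[of "int l"])
  finally have "w powi int N = \<iota> t powi (A * int N + B * int l) * v'"
    using t0 by (simp add: power_int_add)
  then have wN: "w powi int N = \<iota> t * v'" by (simp add: AB)
  have wN': "w ^ N = \<iota> t * v'" using wN by (simp only: power_int_of_nat)
  have N0: "0 < N" using N_gt_1 by linarith
  have tv: "\<iota> t * v' \<in> Q" using tQ Q.unit_\<O>[OF v'] by (rule Q.R_mult)
  have wQ: "w \<in> Q"
  proof (rule ccontr)
    assume n: "w \<notin> Q"
    show False
    proof (cases "w \<in> Q.\<O>")
      case True
      then have "w \<in> Q.\<U>" using n by (simp add: place_units_def)
      from Q.units_power[OF this, of N] show False using tv Q.unit_not_R wN' by metis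
    next
      case False
      have "inverse w ^ N \<in> Q" by (rule Q.R_power[OF Q.not_\<O>(1)[OF False] N0])
      from Q.R_mult[OF this Q.R_sub[OF tv]] have "1 \<in> Q" using w0 by (simp add: wN'[symmetric] power_inverse)
      then show False using Q.unit_not_R[OF Q.one_unit] by blast
    qed
  qed
  have monomial: "\<exists>u\<in>Q.\<U>. \<iota> f = w powi (int N * place_val P f) * u" if f0: "f \<noteq> 0" for f
  proof -
    define k where "k = place_val P f"
    obtain u where u: "u \<in> P.\<U>" "f = t powi k * u" using P.val_decomp[OF f0] unfolding k_def by metis
    have "\<iota> t = w powi int N * inverse v'" using wN Q.unit_nz[OF v'] by simp
    then have "\<iota> f = (w powi int N * inverse v') powi k * \<iota> u"
      by (simp add: arg_cong[OF u(2), of \<iota>] hom_mult hom_powi)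
    then have "\<iota> f = w powi (int N * k) * (inverse v' powi k * \<iota> u)"
      by (simp add: power_int_mult_distrib power_int_mult mult.assoc)
    moreover have "inverse v' powi k * \<iota> u \<in> Q.\<U>"
      using v' u(1) un by (intro Q.units_mult Q.units_powi Q.units_inverse) auto
    ultimately show ?thesis unfolding k_def by blast
  qed
  have "(y * w powi int l) powi int N = y powi int N * (w powi int N) powi int l"
    by (simp only: power_int_mult_distrib mult.commute[of "int N"] power_int_mult[symmetric])
  also have "\<dots> = (\<iota> t powi (- int l) * \<iota> t powi int l) * (v * v' powi int l)"
    unfolding wN yN by (simp only: power_int_mult_distrib Groups.mult_ac)
  also have "\<iota> t powi (- int l) * \<iota> t powi int l = 1" using t0 by (simp add: power_int_minus)
  finally have "(y * w powi int l) powi int N = v * v' powi int l" by (simp only: mult_1)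
  then have "(y * w powi int l) ^ N = v * v' powi int l" by (simp only: power_int_of_nat)
  moreover have "v * v' powi int l \<in> Q.\<U>" by (intro Q.units_mult Q.units_powi v v')
  ultimately have "y * w powi int l \<in> Q.\<U>" using Q.units_of_power N0 by metis
  moreover have "y = w powi (- int l) * (y * w powi int l)" using w0 by (simp add: power_int_minus)
  ultimately have "\<exists>u\<in>Q.\<U>. y = w powi (- int l) * u" by blast
  then have "adapted P l Q w" unfolding adapted_def using w0 wQ monomial by blast
  then show ?thesis by blast
qed

text \<open>
  The order of \<open>f y\<^sup>j\<close> at the place over \<open>P\<close>.
\<close>

definition ord_at :: "'k poly fract set \<Rightarrow> nat \<Rightarrow> nat \<Rightarrow> 'k poly fract \<Rightarrow> int" where
  "ord_at P l j f = int N * place_val P f - int j * int l"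

lemma ord_at_inj:
  assumes "\<not> p dvd l" "i < N" "j < N" "ord_at P l i f = ord_at P l j g"
  shows "i = j"
proof -
  have "(int i - int j) * int l = int N * (place_val P f - place_val P g)"
    using assms(4) by (simp add: ord_at_def algebra_simps)
  then have "int N dvd (int i - int j) * int l" by simp
  moreover have "coprime (int N) (int l)" using coprime_N[OF assms(1)] by (simp add: coprime_commute)
  ultimately have "int N dvd int i - int j" using coprime_dvd_mult_left_iff by blast
  then have "[int i = int j] (mod int N)" by (simp add: cong_iff_dvd_diff)
  then have "[i = j] (mod N)" by (simp add: cong_int_iff)
  then show ?thesis using assms(2,3) by (simp add: cong_less_modulus_unique_nat)
qed

definition min_ord :: "'k poly fract set \<Rightarrow> nat \<Rightarrow> 'k poly fract poly \<Rightarrow> int" where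
  "min_ord P l f = Min ((\<lambda>j. ord_at P l j (coeff f j)) ` {j. j < N \<and> coeff f j \<noteq> 0})"

text \<open>
  The orders of the monomials \<open>f y\<^sup>j\<close> with \<open>j < N\<close> are incongruent modulo \<open>N\<close>, so a unique one is
  minimal; after division by the corresponding power of \<open>w\<close> the other monomials lie in \<open>Q\<close>.
\<close>

lemma ev_ramified:
  assumes Q: "place C Q" and ram: "ramified P l"
    and ad: "adapted P l Q w" and f: "f \<noteq> 0" "degree f < N"
  shows "\<exists>u\<in>place_units Q. ev y f = w powi min_ord P l f * u"
proof -
  have w: "w \<noteq> 0" "w \<in> Q" "\<And>f. f \<noteq> 0 \<Longrightarrow> \<exists>u\<in>place_units Q. \<iota> f = w powi (int N * place_val P f) * u"
    "\<exists>u\<in>place_units Q. y = w powi (- int l) * u"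
    using ad unfolding adapted_def by blast+
  interpret Q: place_of_field C Q by unfold_locales (rule Q)
  let ?S = "{j. j < N \<and> coeff f j \<noteq> 0}"
  let ?o = "\<lambda>j. ord_at P l j (coeff f j)"
  have monomial: "\<exists>u\<in>Q.\<U>. \<iota> c * y ^ j = w powi ord_at P l j c * u" if "c \<noteq> 0" for c j
  proof -
    obtain u where u: "u \<in> Q.\<U>" "\<iota> c = w powi (int N * place_val P c) * u" using w(3)[OF \<open>c \<noteq> 0\<close>] by blast
    obtain v where v: "v \<in> Q.\<U>" "y = w powi (- int l) * v" using w(4) by blast
    have "y ^ j = (w powi (- int l)) powi int j * v ^ j"
      unfolding v(2) by (simp add: power_mult_distrib)
    also have "(w powi (- int l)) powi int j = w powi (- (int j * int l))"
      by (simp only: power_int_mult[symmetric] mult_minus_left mult.commute[of "int l"])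
    finally have "\<iota> c * y ^ j = w powi (int N * place_val P c) * w powi (- (int j * int l)) * (u * v ^ j)"
      by (simp add: u(2))
    also have "w powi (int N * place_val P c) * w powi (- (int j * int l)) = w powi ord_at P l j c"
      using power_int_add[of w "int N * place_val P c" "- (int j * int l)"] w(1) by (simp add: ord_at_def)
    finally show ?thesis using Q.units_mult[OF u(1) Q.units_power[OF v(1)]] by blast
  qed
  have fin: "finite (?o ` ?S)" by simp
  have "coeff f (degree f) \<noteq> 0" using f(1) by simp
  then have ne: "?o ` ?S \<noteq> {}" using f(2) by blast
  from Min_in[OF fin ne] obtain i where i: "i \<in> ?S" "min_ord P l f = ?o i" by (auto simp: min_ord_def)
  define k where "k = ?o i"
  have lt: "k < ?o j" if "j \<in> ?S" "j \<noteq> i" for j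
  proof -
    have "k \<le> ?o j" unfolding k_def i(2)[symmetric] min_ord_def using that fin by (intro Min_le) auto
    moreover have "k \<noteq> ?o j"
      using ord_at_inj[of l i j P "coeff f i" "coeff f j"] that i(1) ram by (auto simp: k_def ramified_def)
    ultimately show ?thesis by simp
  qed
  obtain u where u: "u \<in> Q.\<U>" "\<iota> (coeff f i) * y ^ i = w powi k * u"
    using monomial[of "coeff f i" i] i(1) unfolding k_def by blast
  define r where "r = (\<Sum>j\<in>?S - {i}. w powi (- k) * (\<iota> (coeff f j) * y ^ j))"
  have "w powi (- k) * (\<iota> (coeff f j) * y ^ j) \<in> Q" if j: "j \<in> ?S - {i}" for j
  proof -
    obtain v where v: "v \<in> Q.\<U>" "\<iota> (coeff f j) * y ^ j = w powi ?o j * v" using monomial[of "coeff f j" j] j by blast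
    have "0 < ?o j - k" using lt j by simp
    then have "w powi (?o j - k) \<in> Q" using Q.R_power[OF w(2), of "nat (?o j - k)"] by (simp add: power_int_def)
    then have "w powi (?o j - k) * v \<in> Q" using Q.unit_\<O>[OF v(1)] by (rule Q.R_mult)
    moreover have "w powi (- k) * (w powi ?o j * v) = w powi (?o j - k) * v"
      using w(1) by (simp add: power_int_diff power_int_minus field_simps)
    ultimately show ?thesis by (simp only: v(2))
  qed
  then have "r \<in> Q" unfolding r_def by (rule Q.R_sum)
  then have ur: "u + r \<in> Q.\<U>" by (rule Q.unit_plus_R[OF u(1)])
  have "ev y f = (\<Sum>j<N. \<iota> (coeff f j) * y ^ j)" unfolding ev_def by (rule poly_map_altdef[OF f(2)])
  also have "\<dots> = (\<Sum>j\<in>?S. \<iota> (coeff f j) * y ^ j)" by (intro sum.mono_neutral_right) (auto simp: hom_0)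
  also have "\<dots> = \<iota> (coeff f i) * y ^ i + (\<Sum>j\<in>?S - {i}. \<iota> (coeff f j) * y ^ j)"
    using i(1) by (intro sum.remove) auto
  also have "(\<Sum>j\<in>?S - {i}. \<iota> (coeff f j) * y ^ j) = w powi k * r"
    unfolding r_def sum_distrib_left using w(1) by (intro sum.cong) (auto simp: power_int_minus)
  finally have "ev y f = w powi k * (u + r)" by (simp only: u(2) distrib_left)
  then show ?thesis using ur i(2) by (auto simp: k_def)
qed

end

text \<open>
  One ramified place suffices to make the powers \<open>1, y, \<dots>, y\<^sup>N\<^sup>-\<^sup>1\<close> linearly independent, hence to make
  the defining polynomial irreducible and the extension of degree \<open>N\<close>.
\<close>

locale ramified_ext = linearized_ext +
  fixes Q\<^sub>0 :: "'b set" and P\<^sub>0 :: "'a poly fract set" and l\<^sub>0 :: nat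
  assumes Q\<^sub>0: "place C Q\<^sub>0" "lies_over \<iota> Q\<^sub>0 P\<^sub>0" and P\<^sub>0: "ramified P\<^sub>0 l\<^sub>0"
begin

lemma ev_y_nz:
  assumes "f \<noteq> 0" "degree f < N"
  shows "ev y f \<noteq> 0"
proof -
  interpret Q: place_of_field C Q\<^sub>0 by unfold_locales (rule Q\<^sub>0)
  obtain w where w: "adapted P\<^sub>0 l\<^sub>0 Q\<^sub>0 w" using ex_adapted[OF Q\<^sub>0 P\<^sub>0] by blast
  obtain u where "u \<in> Q.\<U>" "ev y f = w powi min_ord P\<^sub>0 l\<^sub>0 f * u"
    using ev_ramified[OF Q\<^sub>0(1) P\<^sub>0 w assms] by blast
  moreover have "w \<noteq> 0" using w by (simp add: adapted_def)
  ultimately show ?thesis using Q.unit_nz by auto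
qed

lemma ev_y_M: "ev y M = 0"
  by (simp add: ev_M Lf_y)

lemma ev_y_mod: "ev y (f mod M) = ev y f"
proof -
  have "ev y f = ev y (M * (f div M) + f mod M)" by simp
  then show ?thesis by (simp only: ev_simps ev_y_M) simp
qed

lemma degree_mod_M: "degree (f mod M) < N"
  using degree_mod_less[OF M_nz, of f] N_gt_1 by (auto simp: degree_M)

lemma ev_y_eq_0_iff: "ev y f = 0 \<longleftrightarrow> M dvd f"
proof
  assume "ev y f = 0"
  then have "f mod M = 0" using ev_y_nz[of "f mod M"] degree_mod_M ev_y_mod by metis
  then show "M dvd f" by auto
next
  assume "M dvd f"
  then obtain g where "f = M * g" by (rule dvdE)
  then show "ev y f = 0" by (simp add: ev_simps ev_y_M)
qed

text \<open>
  A factor vanishing at \<open>y\<close> cannot have degree below \<open>N\<close>.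
\<close>

lemma irreducible_M: "Factorial_Ring.irreducible M"
proof (rule irreducible_polyI)
  show "0 < degree M" using N_gt_1 by (simp add: degree_M)
  fix f g assume fg: "M = f * g"
  then have nz: "f \<noteq> 0" "g \<noteq> 0" using M_nz by auto
  then have deg: "degree f + degree g = N" using degree_mult_eq[OF nz] degree_M fg by simp
  have "ev y f * ev y g = 0" using ev_y_M unfolding fg by (simp add: ev_simps)
  then have "\<not> degree f < N \<or> \<not> degree g < N" using ev_y_nz nz by auto
  then show "degree f = 0 \<or> degree g = 0" using deg by auto
qed

lemma ev_y_inverse:
  assumes "ev y f \<noteq> 0"
  shows "\<exists>g. ev y g = inverse (ev y f)"
proof -
  have "\<not> M dvd f" using assms ev_y_eq_0_iff by blast
  then obtain c where "M dvd 1 - f * c" using irreducible_poly_inverse_mod[OF irreducible_M] by blast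
  then have "ev y (1 - f * c) = 0" using ev_y_eq_0_iff by blast
  then have "ev y f * ev y c = 1" by (simp add: ev_simps)
  then have "inverse (ev y f) = ev y c" by (rule inverse_unique)
  then show ?thesis by metis
qed

lemma range_ev_y: "range (ev y) = UNIV"
proof -
  interpret F: field "ring_of_type_algebra :: 'b ring" by (rule field_from_type_algebra)
  have inv: "inv\<^bsub>ring_of_type_algebra\<^esub> z = inverse z" if "z \<noteq> 0" for z :: 'b
    using that by (intro F.inv_char) (auto simp: ring_of_type_algebra_simps)
  have "z \<in> range (ev y)" if "z \<in> generate_field ring_of_type_algebra (insert y (range \<iota>))" for z
    using that
  proof (induction rule: generate_field.induct)
    case one
    then show ?case using ev_simps(5)[of y] by (metis ring_of_type_algebra_simps(3) rangeI)
  next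
    case (incl z)
    then show ?case using ev_simps(4,7)[of y] by (metis imageE insertE rangeI)
  next
    case (a_inv z)
    then obtain f where "z = ev y f" by auto
    then have "\<ominus>\<^bsub>ring_of_type_algebra\<^esub> z = ev y (0 - f)"
      by (simp only: a_inv_type_algebra ev_simps) simp
    then show ?case by simp
  next
    case (m_inv z)
    then have "z \<noteq> 0" by (simp add: ring_of_type_algebra_simps)
    moreover obtain f where "z = ev y f" using m_inv by auto
    ultimately show ?case using ev_y_inverse inv by (metis rangeI)
  next
    case (eng_add z w)
    then show ?case using ev_simps(1)[of y] by (auto simp: ring_of_type_algebra_simps) (metis rangeI)
  next
    case (eng_mult z w)
    then show ?case using ev_simps(2)[of y] by (auto simp: ring_of_type_algebra_simps) (metis rangeI)
  qed
  then show ?thesis using gen by blast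
qed

lemma ev_y_cases:
  obtains f where "degree f < N" "ev y f = z"
proof -
  obtain f where "z = ev y f" using range_ev_y by (metis UNIV_I imageE)
  then show thesis using that[of "f mod M"] degree_mod_M ev_y_mod by metis
qed

lemma discrete_ramified:
  assumes Q: "place C Q" "lies_over \<iota> Q P" and P: "ramified P l"
  obtains w where "discrete_place C Q w"
    "\<And>f. f \<noteq> 0 \<Longrightarrow> degree f < N \<Longrightarrow> place_val Q (ev y f) = min_ord P l f"
proof -
  interpret Q: place_of_field C Q by unfold_locales (rule Q)
  obtain w where w: "adapted P l Q w" using ex_adapted[OF Q P] by blast
  note evr = ev_ramified[OF Q(1) P w]
  have "\<exists>k. \<exists>u\<in>Q.\<U>. z = w powi k * u" if "z \<noteq> 0" for z
  proof -
    obtain f where f: "degree f < N" "ev y f = z" by (rule ev_y_cases)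
    then have "f \<noteq> 0" using that ev_simps(6) by metis
    from evr[OF this f(1)] show ?thesis using f(2) by metis
  qed
  then have "uniformizer Q w" unfolding uniformizer_def using w by (simp add: adapted_def)
  then interpret Q: discrete_place C Q w by unfold_locales
  have "place_val Q (ev y f) = min_ord P l f" if "f \<noteq> 0" "degree f < N" for f
    using evr[OF that] Q.place_val_eqI by metis
  then show thesis using that Q.discrete_place_axioms by blast
qed

lemma min_ord_ge_iff:
  assumes "f \<noteq> 0" "degree f < N"
  shows "k \<le> min_ord P l f \<longleftrightarrow> (\<forall>j<N. coeff f j \<noteq> 0 \<longrightarrow> k \<le> ord_at P l j (coeff f j))"
proof -
  have "coeff f (degree f) \<noteq> 0" using assms(1) by simp
  then have "{j. j < N \<and> coeff f j \<noteq> 0} \<noteq> {}" using assms(2) by blast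
  then show ?thesis unfolding min_ord_def by (subst Min_ge_iff) auto
qed

lemma ramified_regular_iff:
  assumes Q: "place C Q" "lies_over \<iota> Q P" and P: "ramified P l" and f: "degree f < N"
  shows "ev y f \<in> place_ring Q \<longleftrightarrow> (\<forall>j<N. coeff f j \<noteq> 0 \<longrightarrow> 0 \<le> ord_at P l j (coeff f j))"
proof (cases "f = 0")
  case True
  then show ?thesis by (simp add: ev_simps place_ring_def)
next
  case False
  obtain w where w: "discrete_place C Q w"
    "\<And>f. f \<noteq> 0 \<Longrightarrow> degree f < N \<Longrightarrow> place_val Q (ev y f) = min_ord P l f"
    using discrete_ramified[OF Q P] by blast
  interpret Q: discrete_place C Q w by (rule w)
  show ?thesis
    using Q.val_\<O>_iff[OF ev_y_nz[OF False f]] w(2)[OF False f] min_ord_ge_iff[OF False f] by simp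
qed

lemma ramified_place_unique:
  assumes Q: "place C Q" "lies_over \<iota> Q P" and Q': "place C Q'" "lies_over \<iota> Q' P" and P: "ramified P l"
  shows "Q = Q'"
proof -
  interpret Q: place_of_field C Q by unfold_locales (rule Q)
  interpret Q': place_of_field C Q' by unfold_locales (rule Q')
  have "z \<in> Q.\<O> \<longleftrightarrow> z \<in> Q'.\<O>" for z
  proof -
    obtain f where f: "degree f < N" "ev y f = z" by (rule ev_y_cases)
    show ?thesis using ramified_regular_iff[OF Q P f(1)] ramified_regular_iff[OF Q' P f(1)] f(2) by simp
  qed
  then show ?thesis using Q.R_eq Q'.R_eq by simp
qed

text \<open>
  The residue field does not grow at a ramified place: the summands \<open>f y\<^sup>j\<close> with \<open>0 < j\<close> of a regular
  function have nonzero, hence positive order.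
\<close>

lemma ramified_place_degree:
  assumes Q: "place C Q" "lies_over \<iota> Q P" and ram: "ramified P l"
  shows "place_degree C Q = place_degree rat_consts P"
proof -
  have P: "place rat_consts P" using ram by (simp add: ramified_def)
  obtain w where w: "discrete_place C Q w"
    "\<And>f. f \<noteq> 0 \<Longrightarrow> degree f < N \<Longrightarrow> place_val Q (ev y f) = min_ord P l f"
    using discrete_ramified[OF Q ram] by blast
  interpret Q: discrete_place C Q w by (rule w)
  interpret P: rat_place P by unfold_locales (rule P)
  note vim = lies_over_place_vimage[OF Q(1) P Q(2)]
  obtain d b where b: "residue_basis rat_consts P d b" using rat_place_residue_basis[OF P] by blast
  have "residue_basis C Q d (\<lambda>i. \<iota> (b i))"
  proof (rule residue_basisI)
    show "\<iota> (b i) \<in> Q.\<O>" if "i < d" for i using b that vim(2) unfolding residue_basis_def by blast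
  next
    fix z assume z: "z \<in> Q.\<O>"
    obtain f where f: "degree f < N" "ev y f = z" by (rule ev_y_cases)
    have o: "0 \<le> ord_at P l j (coeff f j)" if "j < N" "coeff f j \<noteq> 0" for j
      using ramified_regular_iff[OF Q ram f(1)] z f(2) that by blast
    have N0: "0 < N" using N_gt_1 by simp
    have f0: "coeff f 0 \<in> P.\<O>"
    proof (cases "coeff f 0 = 0")
      case True
      then show ?thesis using P.\<O>_closed(1) by simp
    next
      case False
      have "0 \<le> place_val P (coeff f 0)"
        using o[OF N0 False] N0 by (simp add: ord_at_def zero_le_mult_iff)
      then show ?thesis using rat_val_\<O>_iff[OF P False] by blast
    qed
    obtain c where c: "\<forall>i<d. c i \<in> rat_consts" "coeff f 0 - (\<Sum>i<d. c i * b i) \<in> P"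
      using b f0 unfolding residue_basis_def by blast
    have 1: "\<iota> (coeff f 0) - (\<Sum>i<d. \<iota> (c i) * \<iota> (b i)) \<in> Q"
      using c(2) vim(1) by (auto simp: hom_diff hom_sum hom_mult)
    define g where "g = f - [:coeff f 0:]"
    have dg: "degree g < N"
      unfolding g_def using f(1) N0 by (intro degree_diff_less) auto
    have gj: "coeff g j = (if j = 0 then 0 else coeff f j)" for j
      by (cases j) (auto simp: g_def)
    have "ev y g \<in> Q"
    proof (cases "g = 0")
      case True
      then show ?thesis by (simp add: ev_simps Q.zero_R)
    next
      case False
      have "1 \<le> ord_at P l j (coeff g j)" if "j < N" "coeff g j \<noteq> 0" for j
      proof -
        have j: "0 < j" "coeff f j \<noteq> 0" using that gj[of j] by (auto split: if_splits)
        then have "0 \<le> ord_at P l j (coeff g j)" using o[OF that(1)] gj[of j] by simp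
        moreover have "ord_at P l j (coeff g j) \<noteq> ord_at P l 0 1"
          using ord_at_inj[of l j 0 P "coeff g j" 1] ram j that(1) N0 by (auto simp: ramified_def)
        moreover have "ord_at P l 0 1 = 0"
          using rat_place_discrete[OF P] discrete_place.val_one by (metis ord_at_def mult_zero_right mult_zero_left diff_zero of_nat_0)
        ultimately show ?thesis by linarith
      qed
      then have "1 \<le> min_ord P l g" using min_ord_ge_iff[OF False dg] by blast
      then show ?thesis using Q.val_R_iff[OF ev_y_nz[OF False dg]] w(2)[OF False dg] by simp
    qed
    then have "ev y f - \<iota> (coeff f 0) \<in> Q" by (simp add: g_def ev_simps)
    from Q.R_add[OF this 1] have "z - (\<Sum>i<d. \<iota> (c i) * \<iota> (b i)) \<in> Q" by (simp add: f(2))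
    moreover have "\<forall>i<d. \<iota> (c i) \<in> C" using c(1) by (auto simp: ext_consts_def)
    ultimately show "\<exists>c. (\<forall>i<d. c i \<in> C) \<and> z - (\<Sum>i<d. c i * \<iota> (b i)) \<in> Q"
      by (intro exI[of _ "\<lambda>i. \<iota> (c i)"] conjI)
  next
    fix c assume c: "\<forall>i<d. c i \<in> C" and s: "(\<Sum>i<d. c i * \<iota> (b i)) \<in> Q"
    have "\<forall>i. \<exists>c'. i < d \<longrightarrow> c' \<in> rat_consts \<and> c i = \<iota> c'" using c by (auto simp: ext_consts_def)
    then obtain c' where c': "\<And>i. i < d \<Longrightarrow> c' i \<in> rat_consts \<and> c i = \<iota> (c' i)" by metis
    have "(\<Sum>i<d. c i * \<iota> (b i)) = \<iota> (\<Sum>i<d. c' i * b i)"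
      unfolding hom_sum hom_mult using c' by (intro sum.cong) auto
    then have "(\<Sum>i<d. c' i * b i) \<in> P" using s vim(1) by auto
    then have "\<forall>i<d. c' i = 0" using b c' unfolding residue_basis_def by blast
    then show "\<forall>i<d. c i = 0" using c' hom_0 by simp
  qed
  then show ?thesis
    using Q.place_degree_eqI[OF subfield_C] P.place_degree_eqI[OF subfield_rat_consts b] by simp
qed

lemma y_regular:
  assumes Q: "place C Q" and h: "\<iota> h \<in> place_ring Q"
  shows "y \<in> place_ring Q"
proof (rule ccontr)
  assume n: "y \<notin> place_ring Q"
  interpret Q: place_of_field C Q by unfold_locales (rule Q)
  obtain u where u: "u \<in> Q.\<U>" "\<iota> h = y ^ N * u" using y_integral_relation[OF Q n] by blast
  have "y ^ N = \<iota> h * inverse u" using u Q.unit_nz by (simp add: mult.assoc)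
  then have "y ^ N \<in> Q.\<O>" using h u(1) by (simp add: Q.unit_iff Q.\<O>_closed(6))
  moreover have "inverse y ^ N \<in> Q" using Q.R_power[OF Q.not_\<O>(1)[OF n], of N] N_gt_1 by simp
  ultimately have "inverse y ^ N * y ^ N \<in> Q" using Q.R_mult by blast
  moreover have "inverse y ^ N * y ^ N = 1" using Q.not_\<O>(2)[OF n] by (simp add: power_inverse)
  ultimately show False using Q.unit_not_R[OF Q.one_unit] by simp
qed

text \<open>
  If the valuation ring contained the whole rational function field, it would contain \<open>y\<close>, which is
  integral over that field, and so everything.
\<close>

lemma place_restricts:
  assumes Q: "place C Q"
  shows "place rat_consts (\<iota> -` Q)" "lies_over \<iota> Q (\<iota> -` Q)"
proof -
  interpret Q: place_of_field C Q by unfold_locales (rule Q)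
  show "lies_over \<iota> Q (\<iota> -` Q)" by (auto simp: lies_over_def)
  have "\<exists>t. \<iota> t \<notin> Q.\<O>"
  proof (rule ccontr)
    assume "\<not> ?thesis"
    then have all: "\<iota> t \<in> Q.\<O>" for t by blast
    have "z \<in> Q.\<O>" for z
    proof -
      obtain f where f: "degree f < N" "ev y f = z" by (rule ev_y_cases)
      have "ev y f = (\<Sum>j<N. \<iota> (coeff f j) * y ^ j)" unfolding ev_def by (rule poly_map_altdef[OF f(1)])
      also have "\<dots> \<in> Q.\<O>"
        by (intro subring_set_sum[OF Q.ring_\<O>] Q.\<O>_closed(6,7) all y_regular[OF Q])
      finally show ?thesis by (simp add: f(2))
    qed
    then show False using Q.\<O>_ne by auto
  qed
  then obtain t where t: "\<iota> t \<notin> Q.\<O>" by blast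
  have "inverse t \<noteq> 0" using Q.not_\<O>(2)[OF t] hom_0 by auto
  moreover have "\<iota> (inverse t) \<in> Q" using Q.not_\<O>(1)[OF t] by (simp add: hom_inverse)
  ultimately show "place rat_consts (\<iota> -` Q)"
    using place_vimage(1)[OF Q \<iota>_consts rat_consts_inverse] by blast
qed

lemma ev_translate_M:
  assumes "\<beta> \<in> roots_L"
  shows "ev (y + \<kappa> \<beta>) M = 0"
  by (simp add: ev_M Lf_add Lf_y Lf_root[OF assms])

text \<open>
  The automorphism \<open>y \<mapsto> y + \<beta>\<close> over the rational function field, for a root \<open>\<beta>\<close> of the linearized polynomial.
  A polynomial expression in \<open>y\<close> is chosen for each element; the value is independent of the choice
  because \<open>y + \<beta>\<close> satisfies the same equation as \<open>y\<close>.
\<close>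

definition translate :: "'a \<Rightarrow> 'b \<Rightarrow> 'b" where
  "translate \<beta> z = ev (y + \<kappa> \<beta>) (SOME f. ev y f = z)"

lemma translate_ev:
  assumes \<beta>: "\<beta> \<in> roots_L"
  shows "translate \<beta> (ev y f) = ev (y + \<kappa> \<beta>) f"
proof -
  define g where "g = (SOME g. ev y g = ev y f)"
  have "ev y g = ev y f" unfolding g_def by (rule someI) simp
  then have "ev y (g - f) = 0" by (simp add: ev_simps)
  then obtain r where r: "g - f = M * r" using ev_y_eq_0_iff by (auto elim: dvdE)
  have "ev (y + \<kappa> \<beta>) (g - f) = 0" unfolding r by (simp add: ev_simps ev_translate_M[OF \<beta>])
  then show ?thesis by (simp add: translate_def ev_simps flip: g_def)
qed

lemma translate_\<iota>: "\<beta> \<in> roots_L \<Longrightarrow> translate \<beta> (\<iota> c) = \<iota> c"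
  using translate_ev[of \<beta> "[:c:]"] by (simp add: ev_simps)

lemma translate_embedding:
  assumes \<beta>: "\<beta> \<in> roots_L"
  shows "field_embedding (translate \<beta>)"
proof
  show "translate \<beta> 1 = 1" using translate_ev[OF \<beta>, of 1] by (simp add: ev_simps)
  fix z w
  obtain f where f: "degree f < N" "ev y f = z" by (rule ev_y_cases)
  obtain g where g: "degree g < N" "ev y g = w" by (rule ev_y_cases)
  show "translate \<beta> (z + w) = translate \<beta> z + translate \<beta> w"
    using translate_ev[OF \<beta>, of "f + g"] translate_ev[OF \<beta>, of f] translate_ev[OF \<beta>, of g]
    by (simp add: ev_simps f g)
  show "translate \<beta> (z * w) = translate \<beta> z * translate \<beta> w"
    using translate_ev[OF \<beta>, of "f * g"] translate_ev[OF \<beta>, of f] translate_ev[OF \<beta>, of g]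
    by (simp add: ev_simps f g)
qed

text \<open>
  Away from the poles of \<open>h\<close> the powers of \<open>y\<close> form an integral basis. A function \<open>f(y)\<close> that is
  regular at every place over \<open>P\<close> is regular at all translates of one place \<open>Q\<close>, which means that the
  \<open>N\<close> values \<open>f(y + \<beta>)\<close> are regular at \<open>Q\<close>; the nodes \<open>y + \<beta>\<close> differ by constants, so interpolation recovers
  the coefficients within the valuation ring.
\<close>

lemma coeffs_regular:
  assumes P: "place rat_consts P" and h: "h \<in> place_ring P" and f: "degree f < N"
    and reg: "\<And>Q. place C Q \<Longrightarrow> lies_over \<iota> Q P \<Longrightarrow> ev y f \<in> place_ring Q"
  shows "coeff f j \<in> place_ring P"
proof -
  obtain Q where Q: "place C Q" "lies_over \<iota> Q P" using ex_place_over[OF P] by blast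
  interpret Q: place_of_field C Q by unfold_locales (rule Q)
  note vim = lies_over_place_vimage[OF Q(1) P Q(2)]
  have yQ: "y \<in> Q.\<O>" using y_regular[OF Q(1)] h vim(2) by blast
  obtain t where t: "discrete_place rat_consts P t" using rat_place_discrete[OF P] .
  interpret P: discrete_place rat_consts P t by (rule t)
  have vals: "ev (y + \<kappa> \<beta>) f \<in> Q.\<O>" if \<beta>: "\<beta> \<in> roots_L" for \<beta>
  proof -
    interpret s: field_embedding "translate \<beta>" by (rule translate_embedding[OF \<beta>])
    have cC: "translate \<beta> ` C \<subseteq> C" using translate_\<iota>[OF \<beta>] by (auto simp: ext_consts_def)
    have Cinv: "inverse c \<in> C" if "c \<in> C" for c using that \<kappa>_inverse by (auto simp: C_eq simp flip: \<kappa>_inverse)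
    have t0: "\<iota> t \<noteq> 0" using P.t_nz hom_eq_0_iff by blast
    have tQ: "translate \<beta> (\<iota> t) \<in> Q" using P.t_R vim(1) translate_\<iota>[OF \<beta>] by auto
    note v = s.place_vimage[OF Q(1) cC Cinv t0 tQ]
    have "lies_over \<iota> (translate \<beta> -` Q) P"
      using vim(1) translate_\<iota>[OF \<beta>] by (auto simp: lies_over_def)
    from reg[OF v(1) this] have "translate \<beta> (ev y f) \<in> Q.\<O>" by (simp add: v(2))
    then show ?thesis by (simp add: translate_ev[OF \<beta>])
  qed
  have "coeff (map_poly \<iota> f) j \<in> Q.\<O>"
  proof (rule coeffs_in_subring_of_values[OF Q.ring_\<O>])
    let ?W = "(\<lambda>\<beta>. y + \<kappa> \<beta>) ` roots_L"
    have card: "card ?W = N" unfolding card_roots_L[symmetric]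
    proof (rule card_image, rule inj_onI)
      fix \<beta> \<beta>' assume "y + \<kappa> \<beta> = y + \<kappa> \<beta>'"
      then have "\<kappa> (\<beta> - \<beta>') = 0" by simp
      then have "\<beta> - \<beta>' = 0" by (simp only: \<kappa>_simps(4))
      then show "\<beta> = \<beta>'" by simp
    qed
    then show "finite ?W" using N_gt_1 by (metis card.infinite not_one_less_zero)
    show "?W \<subseteq> Q.\<O>" using yQ Q.consts_in \<kappa>_C by (auto intro!: Q.\<O>_closed(4))
    show "degree (map_poly \<iota> f) < card ?W"
      using le_less_trans[OF map_poly_degree_leq f] card by simp
    show "inverse (x - z) \<in> Q.\<O>" if xz: "x \<in> ?W" "z \<in> ?W" for x z
    proof -
      obtain \<beta> \<beta>' where "x = y + \<kappa> \<beta>" "z = y + \<kappa> \<beta>'" using xz by auto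
      then have "inverse (x - z) = \<kappa> (inverse (\<beta> - \<beta>'))" by (simp add: \<kappa>_inverse)
      then show ?thesis using \<kappa>_C Q.consts_in by auto
    qed
    show "poly (map_poly \<iota> f) x \<in> Q.\<O>" if "x \<in> ?W" for x
      using that vals by (auto simp: ev_def)
  qed
  then show ?thesis using vim(2) by (auto simp: coeff_map_poly hom_0)
qed

end

section \<open>The semigroup at ramified places\<close>

locale ramified_tuple = linearized_ext +
  fixes P :: "nat \<Rightarrow> 'a poly fract set" and lam :: "nat \<Rightarrow> nat" and r n :: nat and Q :: "nat \<Rightarrow> 'b set"
  assumes ram: "\<And>k. k \<in> {1..r} \<Longrightarrow> ramified (P k) (lam k)"
    and inj_P: "inj_on P {1..r}"
    and nonpole: "\<And>R. place rat_consts R \<Longrightarrow> R \<notin> P ` {1..r} \<Longrightarrow> h \<in> place_ring R"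
    and n_ge: "2 \<le> n" and n_le: "n \<le> r"
    and Q: "\<And>k. k \<in> {1..n} \<Longrightarrow> place C (Q k)" "\<And>k. k \<in> {1..n} \<Longrightarrow> lies_over \<iota> (Q k) (P k)"
begin

lemma P_place: "k \<in> {1..r} \<Longrightarrow> place rat_consts (P k)"
  using ram by (auto simp: ramified_def)

abbreviation pole_at :: "nat \<Rightarrow> nat \<Rightarrow> 'a poly fract \<Rightarrow> int" where
  "pole_at k t f \<equiv> - ord_at (P k) (lam k) t f"

lemma in_r: "k \<in> {1..n} \<Longrightarrow> k \<in> {1..r}"
  using n_le by auto

sublocale ramified_ext \<iota> p e q m a h y "Q 1" "P 1" "lam 1"
  using Q[of 1] ram[of 1] n_ge n_le by unfold_locales auto

lemma vimage_Q: "k \<in> {1..n} \<Longrightarrow> \<iota> -` Q k = P k"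
  using lies_over_place_vimage(1) Q P_place in_r by blast

text \<open>
  The monomials \<open>f y\<^sup>t\<close> that are regular outside \<open>Q 1, \<dots>, Q n\<close>.
\<close>

definition admissible :: "nat \<Rightarrow> 'a poly fract \<Rightarrow> bool" where
  "admissible t f \<longleftrightarrow> t < N \<and> f \<noteq> 0 \<and>
     (\<forall>R. place rat_consts R \<and> R \<notin> P ` {1..r} \<longrightarrow> 0 \<le> place_val R f) \<and>
     (\<forall>k\<in>{n+1..r}. 0 \<le> ord_at (P k) (lam k) t f)"

text \<open>
  A function is regular outside \<open>Q 1, \<dots>, Q n\<close> exactly when each of its monomials \<open>f y\<^sup>t\<close> is: at ramified
  places because the orders of the monomials are distinct, elsewhere because the powers of \<open>y\<close> form
  an integral basis.
\<close>

lemma regular_outside_iff: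
  assumes f: "degree f < N"
  shows "ev y f \<in> regular_outside C (Q ` {1..n}) \<longleftrightarrow> (\<forall>t<N. coeff f t \<noteq> 0 \<longrightarrow> admissible t (coeff f t))"
proof
  assume reg: "ev y f \<in> regular_outside C (Q ` {1..n})"
  have reg': "ev y f \<in> place_ring R" if "place C R" "R \<notin> Q ` {1..n}" for R
    using reg that by (simp add: regular_outside_def)
  have over: "R \<notin> Q ` {1..n}" if "place C R" "place rat_consts R'" "lies_over \<iota> R R'" "R' \<notin> P ` {1..n}" for R R'
  proof
    assume "R \<in> Q ` {1..n}"
    then obtain k where "k \<in> {1..n}" "R = Q k" by blast
    then have "\<iota> -` R = P k" using vimage_Q by simp
    then show False using lies_over_place_vimage(1)[OF that(1-3)] that(4) \<open>k \<in> {1..n}\<close> by blast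
  qed
  show "\<forall>t<N. coeff f t \<noteq> 0 \<longrightarrow> admissible t (coeff f t)"
  proof (intro allI impI)
    fix t assume t: "t < N" "coeff f t \<noteq> 0"
    have 1: "0 \<le> place_val R (coeff f t)" if R: "place rat_consts R" "R \<notin> P ` {1..r}" for R
    proof -
      have R': "R \<notin> P ` {1..n}" using R(2) in_r by blast
      have "coeff f t \<in> place_ring R"
        by (rule coeffs_regular[OF R(1) nonpole[OF R] f]) (metis reg' over R(1) R')
      then show ?thesis using rat_val_\<O>_iff[OF R(1) t(2)] by blast
    qed
    have 2: "0 \<le> ord_at (P k) (lam k) t (coeff f t)" if k: "k \<in> {n+1..r}" for k
    proof -
      have kr: "k \<in> {1..r}" using k by auto
      obtain R where R: "place C R" "lies_over \<iota> R (P k)" using ex_place_over[OF P_place[OF kr]] by blast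
      have "P k \<notin> P ` {1..n}"
      proof
        assume "P k \<in> P ` {1..n}"
        then obtain j where "j \<in> {1..n}" "P k = P j" by blast
        then have "k = j" using inj_onD[OF inj_P _ kr in_r] by metis
        then show False using k \<open>j \<in> {1..n}\<close> by simp
      qed
      from reg'[OF R(1) over[OF R(1) P_place[OF kr] R(2) this]]
      show ?thesis using ramified_regular_iff[OF R ram[OF kr] f] t by blast
    qed
    show "admissible t (coeff f t)" unfolding admissible_def using t 1 2 by blast
  qed
next
  assume adm: "\<forall>t<N. coeff f t \<noteq> 0 \<longrightarrow> admissible t (coeff f t)"
  have "ev y f \<in> place_ring R" if R: "place C R" "R \<notin> Q ` {1..n}" for R
  proof -
    note res = place_restricts[OF R(1)]
    interpret R: place_of_field C R by unfold_locales (rule R)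
    show ?thesis
    proof (cases "\<iota> -` R \<in> P ` {1..r}")
      case True
      then obtain k where k: "k \<in> {1..r}" "\<iota> -` R = P k" by blast
      then have over: "lies_over \<iota> R (P k)" using res(2) by simp
      have "k \<notin> {1..n}"
        using ramified_place_unique[OF R(1) over Q(1)[of k] Q(2)[of k] ram[OF k(1)]] R(2) by blast
      then have "k \<in> {n+1..r}" using k(1) by auto
      then show ?thesis
        using ramified_regular_iff[OF R(1) over ram[OF k(1)] f] adm unfolding admissible_def by blast
    next
      case False
      note vim = lies_over_place_vimage(2)[OF R(1) res]
      have yR: "y \<in> R.\<O>" using y_regular[OF R(1)] nonpole[OF res(1) False] vim by blast
      have c: "\<iota> (coeff f j) \<in> R.\<O>" if "j < N" for j
      proof (cases "coeff f j = 0")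
        case True
        then show ?thesis using R.\<O>_closed(1) by (simp add: hom_0)
      next
        case nz: False
        have "0 \<le> place_val (\<iota> -` R) (coeff f j)"
          using adm that nz res(1) False unfolding admissible_def by blast
        then have "coeff f j \<in> place_ring (\<iota> -` R)" using rat_val_\<O>_iff[OF res(1) nz] by blast
        then show ?thesis using vim by blast
      qed
      have "ev y f = (\<Sum>j<N. \<iota> (coeff f j) * y ^ j)" unfolding ev_def by (rule poly_map_altdef[OF f])
      also have "\<dots> \<in> R.\<O>"
        using c yR by (intro subring_set_sum[OF R.ring_\<O>] R.\<O>_closed(6,7)) auto
      finally show ?thesis .
    qed
  qed
  then show "ev y f \<in> regular_outside C (Q ` {1..n})" by (simp add: regular_outside_def)
qed

lemma place_val_Q:
  assumes "k \<in> {1..n}" "f \<noteq> 0" "degree f < N"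
  shows "place_val (Q k) (ev y f) = min_ord (P k) (lam k) f"
  using discrete_ramified[OF Q(1) Q(2) ram[OF in_r]] assms by metis

abbreviation "\<H> \<equiv> gen_weierstrass_semigroup C n Q"

lemma ord_at_cong_inj:
  assumes k: "k \<in> {1..n}" and t: "t < N" "t' < N"
    and eq: "int t * int (lam k) - int N * v = int t' * int (lam k) - int N * v'"
  shows "t = t'"
proof -
  have l: "\<not> p dvd lam k" using ram[OF in_r[OF k]] by (simp add: ramified_def)
  have "(int t - int t') * int (lam k) = int N * (v - v')" using eq by (simp add: algebra_simps)
  then have "int N dvd (int t - int t') * int (lam k)" by simp
  moreover have "coprime (int N) (int (lam k))" using coprime_N[OF l] by (simp add: coprime_commute)
  ultimately have "int N dvd int t - int t'" using coprime_dvd_mult_left_iff by blast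
  then have "[int t = int t'] (mod int N)" by (simp add: cong_iff_dvd_diff)
  then have "[t = t'] (mod N)" by (simp add: cong_int_iff)
  then show ?thesis using t by (simp add: cong_less_modulus_unique_nat)
qed

text \<open>
  The congruence class of \<open>\<beta> j\<close> modulo \<open>N\<close> decides which monomial of a function attains the pole order at
  \<open>Q j\<close>. That monomial is itself regular outside the tuple, which reduces all questions about the
  semigroup to monomials.
\<close>

lemma semigroup_component:
  assumes \<beta>: "\<beta> \<in> \<H>" and j: "j \<in> {1..n}"
  shows "\<exists>t f. admissible t f \<and> \<beta> j = pole_at j t f \<and>
           (\<forall>i\<in>{1..n}. pole_at i t f \<le> \<beta> i)"
proof -
  obtain z where z: "\<beta> = (\<lambda>i\<in>{1..n}. - place_val (Q i) z)" "z \<in> regular_outside C (Q ` {1..n})" "z \<noteq> 0"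
    using \<beta> by (auto simp: gen_weierstrass_semigroup_def)
  obtain f where f: "degree f < N" "ev y f = z" by (rule ev_y_cases)
  have f0: "f \<noteq> 0" using f(2) z(3) ev_simps(6) by metis
  let ?S = "{t. t < N \<and> coeff f t \<noteq> 0}"
  have val: "\<beta> i = - min_ord (P i) (lam i) f" if "i \<in> {1..n}" for i
    using place_val_Q[OF that f0 f(1)] that by (simp add: z(1) f(2))
  have "coeff f (degree f) \<noteq> 0" using f0 by simp
  then have ne: "?S \<noteq> {}" using f(1) by blast
  have "min_ord (P j) (lam j) f \<in> (\<lambda>t. ord_at (P j) (lam j) t (coeff f t)) ` ?S"
    unfolding min_ord_def using ne by (intro Min_in) auto
  then obtain t where t: "t < N" "coeff f t \<noteq> 0" "min_ord (P j) (lam j) f = ord_at (P j) (lam j) t (coeff f t)"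
    by blast
  have "admissible t (coeff f t)" using regular_outside_iff[OF f(1)] z(2) f(2) t by blast
  moreover have "pole_at i t (coeff f t) \<le> \<beta> i" if "i \<in> {1..n}" for i
    using val[OF that] min_ord_ge_iff[OF f0 f(1), of "min_ord (P i) (lam i) f" "P i" "lam i"] t(1,2) by auto
  ultimately show ?thesis using val[OF j] t(3) by metis
qed

lemma monomial_in_semigroup:
  assumes "admissible t f"
  shows "(\<lambda>k\<in>{1..n}. pole_at k t f) \<in> \<H>"
proof -
  have t: "t < N" and f: "f \<noteq> 0" using assms by (auto simp: admissible_def)
  define g where "g = monom f t"
  have g0: "g \<noteq> 0" using f by (simp add: g_def monom_eq_0_iff)
  have dg: "degree g < N" using t f by (simp add: g_def degree_monom_eq)
  have S: "{j. j < N \<and> coeff g j \<noteq> 0} = {t}" using t f by (auto simp: g_def)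
  have "ev y g \<in> regular_outside C (Q ` {1..n})"
    unfolding regular_outside_iff[OF dg] using assms by (auto simp: g_def)
  moreover have "place_val (Q k) (ev y g) = ord_at (P k) (lam k) t f" if "k \<in> {1..n}" for k
    unfolding place_val_Q[OF that g0 dg] min_ord_def S by (simp add: g_def)
  then have "(\<lambda>k\<in>{1..n}. pole_at k t f) = (\<lambda>k\<in>{1..n}. - place_val (Q k) (ev y g))"
    by (intro restrict_ext) simp
  ultimately show ?thesis
    unfolding gen_weierstrass_semigroup_def using ev_y_nz[OF g0 dg] by blast
qed

end

section \<open>Maximal elements\<close>

text \<open>
  The assumption on constants, automatic over a field with more than two elements, is what allows
  linear combinations of monomials with prescribed supports when \<open>n > 2\<close>.
\<close>

locale rational_ramified_tuple = ramified_tuple +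
  assumes deg1: "\<And>k. k \<in> {1..n} \<Longrightarrow> place_degree rat_consts (P k) = 1"
    and two_consts: "n = 2 \<or> (\<exists>c d :: 'a. c \<noteq> 0 \<and> d \<noteq> 0 \<and> c \<noteq> d)"
begin

text \<open>
  The total order that a monomial with exponent \<open>t\<close> is forced to have at \<open>P (n+1), \<dots>, P r\<close>: there \<open>f y\<^sup>t\<close>
  is regular exactly when \<open>f\<close> vanishes to order at least \<open>t lam k / N\<close>, rounded up.
\<close>

definition offset :: "nat \<Rightarrow> int" where
  "offset t = (\<Sum>k\<in>{n+1..r}. \<lceil>real (t * lam k) / real N\<rceil> * int (place_degree rat_consts (P k)))"

lemma ord_at_ge_0_iff: "0 \<le> ord_at R l t f \<longleftrightarrow> \<lceil>real (t * l) / real N\<rceil> \<le> place_val R f"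
proof -
  have N0: "0 < real N" using N_gt_1 by simp
  have "0 \<le> ord_at R l t f \<longleftrightarrow> int (t * l) \<le> place_val R f * int N"
    by (simp add: ord_at_def mult.commute)
  also have "\<dots> \<longleftrightarrow> real_of_int (int (t * l)) \<le> real_of_int (place_val R f * int N)"
    by (simp only: of_int_le_iff)
  also have "\<dots> \<longleftrightarrow> real (t * l) / real N \<le> real_of_int (place_val R f)"
    using N0 by (simp add: pos_divide_le_eq)
  finally show ?thesis by (simp only: ceiling_le_iff)
qed

lemma sum_split_n: "(\<Sum>k=1..r. g k) = (\<Sum>k=1..n. g k) + (\<Sum>k\<in>{n+1..r}. g k)" for g :: "nat \<Rightarrow> int"
proof -
  have "{1..r} = {1..n} \<union> {n+1..r}" using n_le by auto
  then show ?thesis by (simp only:) (intro sum.union_disjoint; auto)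
qed

text \<open>
  This and the next lemma are Riemann-Roch on the projective line for the functions \<open>f\<close> of admissible
  monomials: a principal divisor has degree zero, and every divisor of degree zero is principal.
\<close>

lemma admissible_sum_le:
  assumes "admissible t f"
  shows "(\<Sum>k=1..n. place_val (P k) f) \<le> - offset t"
proof -
  have f: "f \<noteq> 0" "\<And>R. place rat_consts R \<Longrightarrow> R \<notin> P ` {1..r} \<Longrightarrow> 0 \<le> place_val R f"
    "\<And>k. k \<in> {n+1..r} \<Longrightarrow> 0 \<le> ord_at (P k) (lam k) t f"
    using assms by (auto simp: admissible_def)
  have "(\<Sum>R\<in>P ` {1..r}. place_val R f * int (place_degree rat_consts R)) \<le> 0"
    by (rule sum_val_degree_le_0) (use f P_place in auto)
  then have "(\<Sum>k=1..r. place_val (P k) f * int (place_degree rat_consts (P k))) \<le> 0"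
    by (subst (asm) sum.reindex[OF inj_P]) simp
  moreover have "(\<Sum>k=1..n. place_val (P k) f * int (place_degree rat_consts (P k))) = (\<Sum>k=1..n. place_val (P k) f)"
    using deg1 by (intro sum.cong) auto
  moreover have "offset t \<le> (\<Sum>k\<in>{n+1..r}. place_val (P k) f * int (place_degree rat_consts (P k)))"
    unfolding offset_def
    using f(3) by (intro sum_mono mult_right_mono) (auto simp: ord_at_ge_0_iff)
  ultimately show ?thesis
    using sum_split_n[of "\<lambda>k. place_val (P k) f * int (place_degree rat_consts (P k))"] by simp
qed

lemma ex_admissible:
  assumes t: "t < N" and v: "(\<Sum>k=1..n. v k) = - offset t"
  shows "\<exists>f. admissible t f \<and> (\<forall>k\<in>{1..n}. place_val (P k) f = v k)"
proof -
  define e where "e k = (if k \<le> n then v k else \<lceil>real (t * lam k) / real N\<rceil>)" for k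
  define E where "E R = e (the_inv_into {1..r} P R)" for R
  have E: "E (P k) = e k" if "k \<in> {1..r}" for k
    using the_inv_into_f_f[OF inj_P that] by (simp add: E_def)
  have "(\<Sum>R\<in>P ` {1..r}. E R * int (place_degree rat_consts R))
      = (\<Sum>k=1..r. e k * int (place_degree rat_consts (P k)))"
    by (subst sum.reindex[OF inj_P]) (auto simp: E intro!: sum.cong)
  also have "\<dots> = (\<Sum>k=1..n. v k) + offset t"
    unfolding sum_split_n offset_def using deg1 by (intro arg_cong2[of _ _ _ _ "(+)"] sum.cong) (auto simp: e_def)
  finally have "(\<Sum>R\<in>P ` {1..r}. E R * int (place_degree rat_consts R)) = 0" using v by simp
  moreover have "place rat_consts R" if "R \<in> P ` {1..r}" for R using that P_place by blast
  ultimately obtain f where f: "f \<noteq> 0"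
    "\<And>R. place rat_consts R \<Longrightarrow> place_val R f = (if R \<in> P ` {1..r} then E R else 0)"
    using ex_fract_with_divisor[of "P ` {1..r}" E] by blast
  have val: "place_val (P k) f = e k" if "k \<in> {1..r}" for k
    using f(2)[OF P_place[OF that]] E[OF that] that by auto
  have "admissible t f"
    unfolding admissible_def using t f val by (auto simp: ord_at_ge_0_iff e_def)
  moreover have "\<forall>k\<in>{1..n}. place_val (P k) f = v k" using val in_r by (auto simp: e_def)
  ultimately show ?thesis by blast
qed

text \<open>
  A monomial \<open>f y\<^sup>t\<close> has pole orders \<open>\<alpha>\<close> at the tuple exactly when \<open>f\<close> has order \<open>v k\<close> at each \<open>P k\<close>.
\<close>

definition profile :: "nat \<Rightarrow> (nat \<Rightarrow> int) \<Rightarrow> (nat \<Rightarrow> int) \<Rightarrow> bool" where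
  "profile t v \<alpha> \<longleftrightarrow> t < N \<and> (\<forall>k\<in>{1..n}. \<alpha> k = int t * int (lam k) - int N * v k)"

lemma nabla_on_profileE:
  assumes \<alpha>: "profile t v \<alpha>" and J: "J \<subseteq> {1..n}" and j: "j \<in> J" and ne: "nabla_on n \<H> J \<alpha> \<noteq> {}"
  shows "\<exists>v'. (\<Sum>k=1..n. v' k) \<le> - offset t \<and> v' j = v j \<and>
     (\<forall>i\<in>{1..n}. v i \<le> v' i) \<and> (\<forall>i\<in>{1..n}-J. v i < v' i)"
proof -
  obtain \<beta> where \<beta>: "\<beta> \<in> \<H>" "\<forall>j\<in>J. \<beta> j = \<alpha> j" "\<forall>i\<in>{1..n}-J. \<beta> i < \<alpha> i"
    using ne by (auto simp: nabla_on_def)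
  have jn: "j \<in> {1..n}" using j J by blast
  obtain t' f where f: "admissible t' f" "\<beta> j = pole_at j t' f"
    "\<forall>i\<in>{1..n}. pole_at i t' f \<le> \<beta> i"
    using semigroup_component[OF \<beta>(1) jn] by blast
  have "int t * int (lam j) - int N * v j = int t' * int (lam j) - int N * place_val (P j) f"
    using f(2) \<beta>(2) j \<alpha> jn by (auto simp: profile_def ord_at_def)
  then have t: "t = t'" using ord_at_cong_inj[OF jn] \<alpha> f(1) by (auto simp: profile_def admissible_def)
  have N0: "0 < int N" using N_gt_1 by simp
  have "v j = place_val (P j) f"
    using f(2) \<beta>(2) j \<alpha> jn N0 by (auto simp: profile_def ord_at_def t)
  moreover have "v i \<le> place_val (P i) f" if "i \<in> {1..n}" for i
  proof -
    have "pole_at i t' f \<le> \<alpha> i" using f(3) \<beta>(2,3) that by (cases "i \<in> J") force+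
    then have "int N * v i \<le> int N * place_val (P i) f" using \<alpha> that by (auto simp: profile_def ord_at_def t)
    then show ?thesis using N0 by simp
  qed
  moreover have "v i < place_val (P i) f" if "i \<in> {1..n} - J" for i
  proof -
    have "pole_at i t' f < \<alpha> i" using f(3) \<beta>(3) that by force
    then have "int N * v i < int N * place_val (P i) f" using \<alpha> that by (auto simp: profile_def ord_at_def t)
    then show ?thesis using N0 by simp
  qed
  ultimately show ?thesis using admissible_sum_le[OF f(1)] t
    by (intro exI[of _ "\<lambda>k. place_val (P k) f"]) auto
qed

lemma nabla_on_profileI:
  assumes \<alpha>: "profile t v \<alpha>" and J: "J \<subseteq> {1..n}" and f: "admissible t f"
    and eq: "\<And>j. j \<in> J \<Longrightarrow> place_val (P j) f = v j"
    and less: "\<And>i. i \<in> {1..n} - J \<Longrightarrow> v i < place_val (P i) f"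
  shows "nabla_on n \<H> J \<alpha> \<noteq> {}"
proof -
  have N0: "0 < int N" using N_gt_1 by simp
  have "(\<lambda>k\<in>{1..n}. pole_at k t f) \<in> nabla_on n \<H> J \<alpha>"
    unfolding nabla_on_def
    using monomial_in_semigroup[OF f] \<alpha> J eq less N0
    by (auto simp: profile_def ord_at_def mult_less_cancel_left_pos)
  then show ?thesis by blast
qed

lemma profile_in_semigroup:
  assumes \<alpha>: "profile t v \<alpha>" and ext: "\<alpha> \<in> {1..n} \<rightarrow>\<^sub>E UNIV" and f: "admissible t f"
    and eq: "\<And>j. j \<in> {1..n} \<Longrightarrow> place_val (P j) f = v j"
  shows "\<alpha> \<in> \<H>"
proof -
  have "\<alpha> = (\<lambda>k\<in>{1..n}. pole_at k t f)"
    using \<alpha> eq ext by (auto simp: profile_def ord_at_def fun_eq_iff PiE_def extensional_def)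
  then show ?thesis using monomial_in_semigroup[OF f] by simp
qed

lemma sum_upd: "i \<in> {1..n} \<Longrightarrow> (\<Sum>k=1..n. (v(i := v i + d)) k) = (\<Sum>k=1..n. v k) + d" for v :: "nat \<Rightarrow> int"
proof -
  assume "i \<in> {1..n}"
  moreover have "(\<Sum>k=1..n. (v(i := v i + d)) k) = (\<Sum>k=1..n. v k + (if k = i then d else 0))"
    by (intro sum.cong) auto
  ultimately show ?thesis by (simp add: sum.distrib)
qed

lemma sum_add_off:
  fixes v :: "nat \<Rightarrow> int"
  assumes "J \<subseteq> {1..n}"
  shows "(\<Sum>k=1..n. if k \<in> J then v k else v k + 1) = (\<Sum>k=1..n. v k) + (int n - int (card J))"
proof -
  have "(\<Sum>k=1..n. if k \<in> J then v k else v k + 1) = (\<Sum>k=1..n. v k + (if k \<in> {1..n} - J then 1 else 0))"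
    by (intro sum.cong) auto
  also have "\<dots> = (\<Sum>k=1..n. v k) + int (card ({1..n} - J))"
    by (simp add: sum.distrib flip: sum.inter_filter) (simp add: Collect_conj_eq Int_commute set_diff_eq)
  also have "int (card ({1..n} - J)) = int n - int (card J)"
    using assms card_mono[OF _ assms] finite_subset[OF assms] by (simp add: card_Diff_subset of_nat_diff)
  finally show ?thesis .
qed

text \<open>
  An absolute maximal element is attained by a monomial at all indices at once, since otherwise the
  monomial that attains it at the first index is a forbidden witness. If the degree available to \<open>f\<close>
  were positive, \<open>f\<close> could be replaced by a function with the same orders that vanishes further at one
  index. Conversely, in degree zero the orders of \<open>f\<close> cannot increase anywhere without decreasing
  elsewhere.
\<close>

lemma absolute_maximal_iff:
  assumes ext: "\<alpha> \<in> {1..n} \<rightarrow>\<^sub>E UNIV"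
  shows "\<alpha> \<in> absolute_maximal_elements n \<H> \<longleftrightarrow> (\<exists>t v. profile t v \<alpha> \<and> (\<Sum>k=1..n. v k) = - offset t)"
proof -
  have abs: "\<alpha> \<in> absolute_maximal_elements n \<H> \<longleftrightarrow>
      \<alpha> \<in> \<H> \<and> (\<forall>J. J \<subset> {1..n} \<and> J \<noteq> {} \<longrightarrow> nabla_on n \<H> J \<alpha> = {})"
  proof
    assume a: "\<alpha> \<in> absolute_maximal_elements n \<H>"
    have "nabla_on n \<H> J \<alpha> = {}" if J: "J \<subset> {1..n}" "J \<noteq> {}" for J
    proof (cases "2 \<le> card J")
      case True
      then show ?thesis using a J by (simp add: absolute_maximal_elements_def)
    next
      case False
      have "finite J" using J(1) finite_subset[of J "{1..n}"] by auto
      then have "card J = 1" using False J(2) by (metis One_nat_def card_0_eq less_2_cases not_le)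
      then obtain j where "J = {j}" by (auto simp: card_1_singleton_iff)
      then show ?thesis using a J(1) by (auto simp: absolute_maximal_elements_def maximal_elements_def nabla_def)
    qed
    then show "\<alpha> \<in> \<H> \<and> (\<forall>J. J \<subset> {1..n} \<and> J \<noteq> {} \<longrightarrow> nabla_on n \<H> J \<alpha> = {})"
      using a by (simp add: absolute_maximal_elements_def maximal_elements_def)
  next
    assume a: "\<alpha> \<in> \<H> \<and> (\<forall>J. J \<subset> {1..n} \<and> J \<noteq> {} \<longrightarrow> nabla_on n \<H> J \<alpha> = {})"
    have "nabla_on n \<H> {i} \<alpha> = {}" if i: "i \<in> {1..n}" for i
    proof -
      have "card {i} < card {1..n}" using n_ge by simp
      then have "{i} \<noteq> {1..n}" by (metis less_irrefl)
      then have "{i} \<subset> {1..n}" using i by blast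
      then show ?thesis using a by (metis insert_not_empty)
    qed
    then have "nabla n \<H> \<alpha> = {}" by (simp add: nabla_def)
    moreover have "nabla_on n \<H> J \<alpha> = {}" if J: "J \<subset> {1..n}" "2 \<le> card J" for J
    proof -
      have "J \<noteq> {}" using J(2) by auto
      then show ?thesis using a J(1) by metis
    qed
    ultimately show "\<alpha> \<in> absolute_maximal_elements n \<H>"
      using a by (simp add: absolute_maximal_elements_def maximal_elements_def)
  qed
  show ?thesis
  proof
    assume "\<alpha> \<in> absolute_maximal_elements n \<H>"
    then have \<alpha>H: "\<alpha> \<in> \<H>" and empty: "\<And>J. J \<subset> {1..n} \<Longrightarrow> J \<noteq> {} \<Longrightarrow> nabla_on n \<H> J \<alpha> = {}"
      using abs by auto
    have one: "1 \<in> {1..n}" using n_ge by simp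
    obtain t f where f: "admissible t f" "\<alpha> 1 = pole_at 1 t f"
      "\<forall>i\<in>{1..n}. pole_at i t f \<le> \<alpha> i"
      using semigroup_component[OF \<alpha>H one] by blast
    define J where "J = {k\<in>{1..n}. \<alpha> k = pole_at k t f}"
    have "(\<lambda>k\<in>{1..n}. pole_at k t f) \<in> nabla_on n \<H> J \<alpha>"
      unfolding nabla_on_def using monomial_in_semigroup[OF f(1)] f(3) by (force simp: J_def)
    moreover have "J \<noteq> {}" using f(2) one by (auto simp: J_def)
    ultimately have "\<not> J \<subset> {1..n}" using empty[of J] by blast
    then have "J = {1..n}" by (auto simp: J_def)
    then have "\<alpha> k = pole_at k t f" if "k \<in> {1..n}" for k using that unfolding J_def by blast
    then have prof: "profile t (\<lambda>k. place_val (P k) f) \<alpha>"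
      using f(1) by (simp add: profile_def admissible_def ord_at_def)
    define v where "v = (\<lambda>k. place_val (P k) f)"
    define d where "d = - offset t - (\<Sum>k=1..n. v k)"
    have "d = 0"
    proof (rule ccontr)
      assume "d \<noteq> 0"
      then have d: "0 < d" using admissible_sum_le[OF f(1)] by (simp add: d_def v_def)
      have t: "t < N" using f(1) by (simp add: admissible_def)
      have "(\<Sum>k=1..n. (v(1 := v 1 + d)) k) = - offset t" unfolding sum_upd[OF one] by (simp add: d_def)
      then obtain g where g: "admissible t g" "\<forall>k\<in>{1..n}. place_val (P k) g = (v(1 := v 1 + d)) k"
        using ex_admissible[OF t] by blast
      have "nabla_on n \<H> ({1..n} - {1}) \<alpha> \<noteq> {}"
        by (rule nabla_on_profileI[OF prof[folded v_def] _ g(1)]) (use g(2) d in auto)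
      moreover have "2 \<in> {1..n} - {1}" using n_ge by simp
      moreover have "{1..n} - {1} \<subset> {1..n}" using one by blast
      ultimately show False using empty[of "{1..n} - {1}"] by blast
    qed
    then show "\<exists>t v. profile t v \<alpha> \<and> (\<Sum>k=1..n. v k) = - offset t"
      using prof unfolding d_def v_def by (intro exI[of _ t] exI[of _ "\<lambda>k. place_val (P k) f"]) simp
  next
    assume "\<exists>t v. profile t v \<alpha> \<and> (\<Sum>k=1..n. v k) = - offset t"
    then obtain t v where prof: "profile t v \<alpha>" and v: "(\<Sum>k=1..n. v k) = - offset t" by blast
    have t: "t < N" using prof by (simp add: profile_def)
    obtain f where f: "admissible t f" "\<forall>k\<in>{1..n}. place_val (P k) f = v k"
      using ex_admissible[OF t v] by blast
    have "\<alpha> \<in> \<H>" using profile_in_semigroup[OF prof ext f(1)] f(2) by blast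
    moreover have "nabla_on n \<H> J \<alpha> = {}" if J: "J \<subset> {1..n}" "J \<noteq> {}" for J
    proof (rule ccontr)
      assume ne: "nabla_on n \<H> J \<alpha> \<noteq> {}"
      obtain j where j: "j \<in> J" using J(2) by blast
      have "J \<subseteq> {1..n}" using J(1) by blast
      from nabla_on_profileE[OF prof this j ne] obtain v' where v': "(\<Sum>k=1..n. v' k) \<le> - offset t"
        "\<forall>i\<in>{1..n}. v i \<le> v' i" "\<forall>i\<in>{1..n}-J. v i < v' i" by blast
      have "(\<Sum>k=1..n. v k) < (\<Sum>k=1..n. v' k)"
        using v'(2,3) J(1) by (intro sum_strict_mono_ex1) auto
      then show False using v v'(1) by simp
    qed
    ultimately show "\<alpha> \<in> absolute_maximal_elements n \<H>" using abs by blast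
  qed
qed

lemma admissible_add:
  assumes f: "admissible t f" and g: "admissible t g" and nz: "f + const_fract c * g \<noteq> 0"
  shows "admissible t (f + const_fract c * g)"
proof (cases "c = 0")
  case True
  then show ?thesis using f by simp
next
  case c: False
  have ge: "k \<le> place_val R (f + const_fract c * g)"
    if R: "place rat_consts R" and "k \<le> place_val R f" "k \<le> place_val R g" for R k
  proof -
    have "g \<noteq> 0" using g by (simp add: admissible_def)
    then show ?thesis using rat_val_add_ge[OF R that(2) _ nz] rat_val_const_mult[OF R c] that(3) by simp
  qed
  show ?thesis
    unfolding admissible_def
  proof (intro conjI allI impI ballI)
    show "t < N" using f by (simp add: admissible_def)
    show "f + const_fract c * g \<noteq> 0" by (rule nz)
    show "0 \<le> place_val R (f + const_fract c * g)" if "place rat_consts R \<and> R \<notin> P ` {1..r}" for R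
      using that f g by (intro ge) (auto simp: admissible_def)
    show "0 \<le> ord_at (P k) (lam k) t (f + const_fract c * g)" if k: "k \<in> {n+1..r}" for k
    proof -
      have "place rat_consts (P k)" using k by (intro P_place) auto
      then show ?thesis using f g k unfolding ord_at_ge_0_iff
        by (intro ge) (auto simp: admissible_def ord_at_ge_0_iff)
    qed
  qed
qed

text \<open>
  When the degree is \<open>n - 2\<close>, every pair of indices supports a monomial of the prescribed orders. Larger
  supports arise by adding constant multiples; at the common index \<open>i\<close> of any two
  distinct nonzero constants at most one cancels the leading terms.
\<close>

lemma ex_admissible_support:
  assumes t: "t < N" and v: "(\<Sum>k=1..n. v k) = - offset t - (int n - 2)"
    and ab: "i \<in> {1..n}" "b \<in> {1..n}" "i \<noteq> b" and D: "D \<subseteq> {1..n} - {i, b}"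
  shows "\<exists>f. admissible t f \<and> (\<forall>k\<in>insert i (insert b D). place_val (P k) f = v k) \<and>
           (\<forall>k\<in>{1..n} - insert i (insert b D). v k < place_val (P k) f)"
proof -
  have pair: "\<exists>f. admissible t f \<and> place_val (P i) f = v i \<and> place_val (P d) f = v d \<and>
      (\<forall>k\<in>{1..n} - {i, d}. v k < place_val (P k) f)" if d: "d \<in> {1..n}" "d \<noteq> i" for d
  proof -
    have "card {i, d} = 2" using d by simp
    then have "(\<Sum>k=1..n. if k \<in> {i, d} then v k else v k + 1) = - offset t"
      using sum_add_off[of "{i, d}" v] ab d v by simp
    from ex_admissible[OF t this] obtain f where f: "admissible t f"
      "\<And>k. k \<in> {1..n} \<Longrightarrow> place_val (P k) f = (if k \<in> {i, d} then v k else v k + 1)" by blast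
    show ?thesis using f(1) f(2)[OF ab(1)] f(2)[OF d(1)] f(2) by (intro exI[of _ f]) simp
  qed
  have "finite D" using D finite_subset by blast
  then show ?thesis using D
  proof (induction D rule: finite_induct)
    case empty
    then show ?case using pair[of b] ab by auto
  next
    case (insert d D)
    then obtain f where f: "admissible t f" "\<forall>k\<in>insert i (insert b D). place_val (P k) f = v k"
      "\<forall>k\<in>{1..n} - insert i (insert b D). v k < place_val (P k) f" by auto
    have d: "d \<in> {1..n}" "d \<noteq> i" "d \<noteq> b" "d \<notin> D" using insert by auto
    obtain g where g: "admissible t g" "place_val (P i) g = v i" "place_val (P d) g = v d"
      "\<forall>k\<in>{1..n} - {i, d}. v k < place_val (P k) g" using pair[OF d(1,2)] by blast
    have f0: "f \<noteq> 0" and g0: "g \<noteq> 0" using f(1) g(1) by (auto simp: admissible_def)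
    have "card {i, b, d} \<le> card {1..n}" using ab d by (intro card_mono) auto
    then have "n \<noteq> 2" using ab d by auto
    then obtain c1 c2 :: 'a where c12: "c1 \<noteq> 0" "c2 \<noteq> 0" "c1 \<noteq> c2" using two_consts by auto
    define F where "F c = f + const_fract c * g" for c
    have vg: "place_val (P k) (const_fract c * g) = place_val (P k) g" "const_fract c * g \<noteq> 0"
      if c: "c \<noteq> 0" and k: "k \<in> {1..n}" for c k
      using c g0 rat_val_const_mult[OF P_place[OF in_r[OF k]] c g0] by auto
    have Fd: "F c \<noteq> 0" "place_val (P d) (F c) = v d" if c: "c \<noteq> 0" for c
    proof -
      have "v d < place_val (P d) f" using f(3) d by auto
      then have "const_fract c * g + f \<noteq> 0 \<and> place_val (P d) (const_fract c * g + f) = v d"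
        using rat_val_add_eq[OF P_place[OF in_r[OF d(1)]], of "const_fract c * g" f] vg[OF c d(1)] g(3) by simp
      then show "F c \<noteq> 0" "place_val (P d) (F c) = v d" by (simp_all add: F_def add.commute)
    qed
    have Fk: "place_val (P k) (F c) = v k" if c: "c \<noteq> 0" and k: "k \<in> insert b D" for c k
    proof -
      have kn: "k \<in> {1..n}" "k \<noteq> i" "k \<noteq> d" using k insert.prems ab d insert.hyps by auto
      have "place_val (P k) f = v k" "v k < place_val (P k) g" using f(2) g(4) k kn by auto
      then show ?thesis
        using rat_val_add_eq[OF P_place[OF in_r[OF kn(1)]] f0, of "const_fract c * g"] vg(1)[OF c kn(1)]
        by (simp add: F_def)
    qed
    have Fo: "v k < place_val (P k) (F c)" if c: "c \<noteq> 0" and k: "k \<in> {1..n} - insert i (insert b (insert d D))" for c k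
    proof -
      have kn: "k \<in> {1..n}" using k by blast
      have "v k < place_val (P k) f" "v k < place_val (P k) g" using f(3) g(4) k by auto
      then have "v k + 1 \<le> place_val (P k) (F c)"
        using rat_val_add_ge[OF P_place[OF in_r[OF kn]], of "v k + 1" f "const_fract c * g"]
          vg(1)[OF c kn] Fd(1)[OF c] by (simp add: F_def)
      then show ?thesis by simp
    qed
    have "\<exists>c. c \<noteq> 0 \<and> place_val (P i) (F c) = v i"
    proof (rule ccontr)
      assume neg: "\<not> ?thesis"
      note Pi = P_place[OF in_r[OF ab(1)]]
      have gt: "v i + 1 \<le> place_val (P i) (F c)" if c: "c \<noteq> 0" for c
      proof -
        have "v i \<le> place_val (P i) (F c)"
          using rat_val_add_ge[OF Pi, of "v i" f "const_fract c * g"] vg(1)[OF c ab(1)] f(2) g(2) Fd(1)[OF c]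
          by (simp add: F_def)
        then show ?thesis using neg c by force
      qed
      have e: "F c1 + const_fract (- 1) * F c2 = const_fract (c1 - c2) * g" by (simp add: F_def algebra_simps)
      have c: "c1 - c2 \<noteq> 0" using c12 by simp
      have "place_val (P i) (const_fract (- 1) * F c2) = place_val (P i) (F c2)"
        by (rule rat_val_const_mult[OF Pi _ Fd(1)[OF c12(2)]]) simp
      then have "v i + 1 \<le> place_val (P i) (F c1 + const_fract (- 1) * F c2)"
        using gt[OF c12(1)] gt[OF c12(2)] vg(2)[OF c ab(1)] unfolding e[symmetric]
        by (intro rat_val_add_ge[OF Pi]) auto
      then show False using vg(1)[OF c ab(1)] g(2) unfolding e by simp
    qed
    then obtain c where c: "c \<noteq> 0" "place_val (P i) (F c) = v i" by blast
    have "admissible t (F c)" using admissible_add[OF f(1) g(1)] Fd(1)[OF c(1)] by (simp add: F_def)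
    moreover have "\<forall>k\<in>insert i (insert b (insert d D)). place_val (P k) (F c) = v k"
      using c Fd(2) Fk by auto
    ultimately show ?case using Fo[OF c(1)] by blast
  qed
qed

text \<open>
  Witnesses supported on two indices force all congruences to share one exponent \<open>t\<close> and require
  degree at least \<open>n - 2\<close>; a degree of \<open>n - 1\<close> or more would allow a function supported on a single index,
  contrary to maximality.
\<close>

lemma relative_maximal_iff:
  assumes ext: "\<alpha> \<in> {1..n} \<rightarrow>\<^sub>E UNIV"
  shows "\<alpha> \<in> relative_maximal_elements n \<H> \<longleftrightarrow>
    (\<exists>t v. profile t v \<alpha> \<and> (\<Sum>k=1..n. v k) = - offset t - (int n - 2))"
proof
  assume rel: "\<alpha> \<in> relative_maximal_elements n \<H>"
  then have \<alpha>H: "\<alpha> \<in> \<H>" and sing: "\<And>i. i \<in> {1..n} \<Longrightarrow> nabla_on n \<H> {i} \<alpha> = {}"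
    and full: "\<And>J. J \<subset> {1..n} \<Longrightarrow> 2 \<le> card J \<Longrightarrow> nabla_on n \<H> J \<alpha> \<noteq> {}"
    by (auto simp: relative_maximal_elements_def maximal_elements_def nabla_def)
  have one: "1 \<in> {1..n}" using n_ge by simp
  have N0: "0 < int N" using N_gt_1 by simp
  have pair: "\<exists>t f. admissible t f \<and> \<alpha> 1 = pole_at 1 t f \<and> \<alpha> k = pole_at k t f \<and>
      (\<forall>i\<in>{1..n} - {1, k}. pole_at i t f < \<alpha> i)" if k: "k \<in> {1..n}" "k \<noteq> 1" for k
  proof -
    have "\<exists>\<beta>\<in>\<H>. \<beta> 1 = \<alpha> 1 \<and> \<beta> k = \<alpha> k \<and> (\<forall>i\<in>{1..n} - {1, k}. \<beta> i < \<alpha> i)"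
    proof (cases "{1, k} = {1..n}")
      case True
      then show ?thesis using \<alpha>H by (intro bexI[of _ \<alpha>]) auto
    next
      case False
      then have "{1, k} \<subset> {1..n}" using k one by blast
      moreover have "2 \<le> card {1, k}" using k by simp
      ultimately show ?thesis using full[of "{1, k}"] by (auto simp: nabla_on_def)
    qed
    then obtain \<beta> where \<beta>: "\<beta> \<in> \<H>" "\<beta> 1 = \<alpha> 1" "\<beta> k = \<alpha> k" "\<forall>i\<in>{1..n} - {1, k}. \<beta> i < \<alpha> i" by blast
    obtain t f where f: "admissible t f" "\<beta> 1 = pole_at 1 t f"
      "\<forall>i\<in>{1..n}. pole_at i t f \<le> \<beta> i"
      using semigroup_component[OF \<beta>(1) one] by blast
    have less: "pole_at i t f < \<alpha> i" if "i \<in> {1..n} - {1, k}" for i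
      using f(3) \<beta>(4) that by force
    have "\<alpha> k = pole_at k t f"
    proof (rule ccontr)
      assume "\<alpha> k \<noteq> pole_at k t f"
      then have "pole_at k t f < \<alpha> k" using f(3) k(1) \<beta>(3) by force
      then have "pole_at i t f < \<alpha> i" if "i \<in> {1..n} - {1}" for i
        using less[of i] that by (cases "i = k") auto
      then have "(\<lambda>i\<in>{1..n}. pole_at i t f) \<in> nabla_on n \<H> {1} \<alpha>"
        unfolding nabla_on_def using monomial_in_semigroup[OF f(1)] f(2) \<beta>(2) one by auto
      then show False using sing[OF one] by blast
    qed
    then show ?thesis using f(1,2) \<beta>(2) less by metis
  qed
  have two: "2 \<in> {1..n}" "2 \<noteq> (1::nat)" using n_ge by auto
  obtain t f where f: "admissible t f" "\<alpha> 1 = pole_at 1 t f" "\<alpha> 2 = pole_at 2 t f"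
    "\<forall>i\<in>{1..n} - {1, 2}. pole_at i t f < \<alpha> i" using pair[OF two] by blast
  have t: "t < N" using f(1) by (simp add: admissible_def)
  have "\<exists>w. \<alpha> k = int t * int (lam k) - int N * w" if k: "k \<in> {1..n}" for k
  proof (cases "k = 1")
    case True
    then show ?thesis using f(2) by (auto simp: ord_at_def)
  next
    case False
    obtain t' g where g: "admissible t' g" "\<alpha> 1 = pole_at 1 t' g" "\<alpha> k = pole_at k t' g"
      using pair[OF k False] by blast
    have "int t * int (lam 1) - int N * place_val (P 1) f = int t' * int (lam 1) - int N * place_val (P 1) g"
      using f(2) g(2) by (simp add: ord_at_def)
    then have "t = t'" using ord_at_cong_inj[OF one t] g(1) by (auto simp: admissible_def)
    then show ?thesis using g(3) by (auto simp: ord_at_def)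
  qed
  then obtain v where v: "\<And>k. k \<in> {1..n} \<Longrightarrow> \<alpha> k = int t * int (lam k) - int N * v k" by metis
  have prof: "profile t v \<alpha>" using v t by (simp add: profile_def)
  have v12: "v k = place_val (P k) f" if "k \<in> {1, 2}" for k
    using that v[OF one] v[OF two(1)] f(2,3) N0 by (auto simp: ord_at_def)
  have vi: "v i + 1 \<le> place_val (P i) f" if i: "i \<in> {1..n} - {1, 2}" for i
  proof -
    have "pole_at i t f < \<alpha> i" using f(4) i by blast
    then have "int N * v i < int N * place_val (P i) f" using v[of i] i by (simp add: ord_at_def)
    then show ?thesis using N0 by simp
  qed
  have "(\<Sum>k=1..n. v k) + (int n - 2) = (\<Sum>k=1..n. if k \<in> {1, 2} then v k else v k + 1)"
    using sum_add_off[of "{1, 2}" v] one two by simp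
  also have "\<dots> \<le> (\<Sum>k=1..n. place_val (P k) f)"
    using v12 vi by (intro sum_mono) auto
  finally have ge: "(\<Sum>k=1..n. v k) + (int n - 2) \<le> - offset t" using admissible_sum_le[OF f(1)] by simp
  define d where "d = - offset t - (\<Sum>k=1..n. v k) - (int n - 1)"
  have "d < 0"
  proof (rule ccontr)
    assume d: "\<not> d < 0"
    define w where "w k = (if k \<in> {1} then v k else v k + 1)" for k
    have "(\<Sum>k=1..n. w k) = (\<Sum>k=1..n. v k) + (int n - 1)"
      unfolding w_def using sum_add_off[of "{1}" v] one by simp
    then have "(\<Sum>k=1..n. (w(2 := w 2 + d)) k) = - offset t"
      unfolding sum_upd[OF two(1)] by (simp add: d_def)
    from ex_admissible[OF t this] obtain g where g: "admissible t g"
      "\<forall>k\<in>{1..n}. place_val (P k) g = (w(2 := w 2 + d)) k" by blast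
    have "nabla_on n \<H> {1} \<alpha> \<noteq> {}"
      by (rule nabla_on_profileI[OF prof _ g(1)]) (use g(2) d one in \<open>auto simp: w_def\<close>)
    then show False using sing[OF one] by blast
  qed
  then have "(\<Sum>k=1..n. v k) = - offset t - (int n - 2)" using ge by (simp add: d_def)
  then show "\<exists>t v. profile t v \<alpha> \<and> (\<Sum>k=1..n. v k) = - offset t - (int n - 2)" using prof by blast
next
  assume "\<exists>t v. profile t v \<alpha> \<and> (\<Sum>k=1..n. v k) = - offset t - (int n - 2)"
  then obtain t v where prof: "profile t v \<alpha>" and v: "(\<Sum>k=1..n. v k) = - offset t - (int n - 2)" by blast
  have t: "t < N" using prof by (simp add: profile_def)
  have supp: "\<exists>f. admissible t f \<and> (\<forall>k\<in>J. place_val (P k) f = v k) \<and> (\<forall>k\<in>{1..n} - J. v k < place_val (P k) f)"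
    if J: "J \<subseteq> {1..n}" "2 \<le> card J" for J
  proof -
    obtain a where a: "a \<in> J" using J(2) by fastforce
    have "finite J" using J(1) finite_subset by blast
    then have "card (J - {a}) \<noteq> 0" using J(2) a by simp
    then obtain b where b: "b \<in> J - {a}" by (metis card.empty ex_in_conv)
    have J': "J = insert a (insert b (J - {a, b}))" using a b by auto
    show ?thesis
      using ex_admissible_support[OF t v, of a b "J - {a, b}"] a b J(1) unfolding J'[symmetric] by blast
  qed
  have "2 \<le> card {1..n}" using n_ge by simp
  then obtain f where f: "admissible t f" "\<forall>k\<in>{1..n}. place_val (P k) f = v k" using supp[of "{1..n}"] by blast
  have "\<alpha> \<in> \<H>" using profile_in_semigroup[OF prof ext f(1)] f(2) by blast
  moreover have "nabla_on n \<H> {i} \<alpha> = {}" if i: "i \<in> {1..n}" for i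
  proof (rule ccontr)
    assume ne: "nabla_on n \<H> {i} \<alpha> \<noteq> {}"
    have "{i} \<subseteq> {1..n}" using i by blast
    from nabla_on_profileE[OF prof this _ ne, of i] obtain v' where v': "(\<Sum>k=1..n. v' k) \<le> - offset t"
      "v' i = v i" "\<forall>k\<in>{1..n}-{i}. v k < v' k" by blast
    have "(\<Sum>k=1..n. v k) + (int n - 1) = (\<Sum>k=1..n. if k \<in> {i} then v k else v k + 1)"
      using sum_add_off[of "{i}" v] i by simp
    also have "\<dots> \<le> (\<Sum>k=1..n. v' k)" using v'(2,3) by (intro sum_mono) force
    finally show False using v v'(1) by simp
  qed
  moreover have "nabla_on n \<H> J \<alpha> \<noteq> {}" if J': "J \<subset> {1..n}" "2 \<le> card J" for J
  proof -
    have J: "J \<subseteq> {1..n}" using J'(1) by blast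
    obtain g where g: "admissible t g" "\<forall>k\<in>J. place_val (P k) g = v k" "\<forall>k\<in>{1..n} - J. v k < place_val (P k) g"
      using supp[OF J J'(2)] by blast
    show ?thesis by (rule nabla_on_profileI[OF prof J g(1)]) (use g in auto)
  qed
  ultimately show "\<alpha> \<in> relative_maximal_elements n \<H>"
    by (auto simp: relative_maximal_elements_def maximal_elements_def nabla_def)
qed

text \<open>Writing \<open>\<alpha> k = t lam k - N v k\<close> turns the sum of roundings in the criterion into \<open>- \<Sum>v k - offset t\<close>.\<close>

lemma profile_iff_cong:
  assumes t: "t < N"
  shows "(\<exists>v. profile t v \<alpha> \<and> (\<Sum>k=1..n. v k) = - offset t - \<rho>) \<longleftrightarrow>
    (\<forall>k\<in>{1..n}. [\<alpha> k - int (t * lam k) = 0] (mod int N)) \<and>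
    (\<Sum>k=1..n. \<lceil>real_of_int (\<alpha> k) / real N\<rceil>)
      - (\<Sum>k=1..r. \<lceil>real (t * lam k) / real N\<rceil> * int (place_degree rat_consts (P k))) = \<rho>"
  (is "_ \<longleftrightarrow> ?A \<and> ?S = \<rho>")
proof -
  have N0: "0 < real N" using N_gt_1 by simp
  have val: "?S = - (\<Sum>k=1..n. v k) - offset t" if v: "profile t v \<alpha>" for v
  proof -
    have "\<lceil>real_of_int (\<alpha> k) / real N\<rceil> = \<lceil>real (t * lam k) / real N\<rceil> * int (place_degree rat_consts (P k)) - v k"
      if k: "k \<in> {1..n}" for k
    proof -
      have "real_of_int (\<alpha> k) / real N = real (t * lam k) / real N - real_of_int (v k)"
      proof -
        have "\<alpha> k = int t * int (lam k) - int N * v k" using v k by (simp add: profile_def)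
        then have "real_of_int (\<alpha> k) = real_of_int (int t * int (lam k) - int N * v k)" by (simp only:)
        then show ?thesis using N0 by (simp add: field_simps)
      qed
      then show ?thesis using deg1[OF k] by (simp only: ceiling_diff_of_int)
    qed
    then have "(\<Sum>k=1..n. \<lceil>real_of_int (\<alpha> k) / real N\<rceil>)
        = (\<Sum>k=1..n. \<lceil>real (t * lam k) / real N\<rceil> * int (place_degree rat_consts (P k)) - v k)"
      by (intro sum.cong) auto
    then show ?thesis unfolding sum_split_n offset_def by (simp only: sum_subtractf)
  qed
  have ex: "(\<exists>v. profile t v \<alpha>) \<longleftrightarrow> ?A"
  proof
    assume "\<exists>v. profile t v \<alpha>"
    then obtain v where v: "profile t v \<alpha>" by blast
    show ?A
      using v by (auto simp: profile_def cong_0_iff)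
  next
    assume c: ?A
    have "\<exists>w. \<alpha> k = int t * int (lam k) - int N * w" if k: "k \<in> {1..n}" for k
    proof -
      have "int N dvd \<alpha> k - int (t * lam k)" using c k by (simp add: cong_0_iff)
      then obtain w where "\<alpha> k - int (t * lam k) = int N * w" by (rule dvdE)
      then show ?thesis by (intro exI[of _ "- w"]) simp
    qed
    then obtain v where "\<And>k. k \<in> {1..n} \<Longrightarrow> \<alpha> k = int t * int (lam k) - int N * v k" by metis
    then show "\<exists>v. profile t v \<alpha>" using t by (auto simp: profile_def)
  qed
  show ?thesis
  proof
    assume "\<exists>v. profile t v \<alpha> \<and> (\<Sum>k=1..n. v k) = - offset t - \<rho>"
    then obtain v where v: "profile t v \<alpha>" "(\<Sum>k=1..n. v k) = - offset t - \<rho>" by blast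
    then show "?A \<and> ?S = \<rho>"
      using ex val[OF v(1)] by auto
  next
    assume *: "?A \<and> ?S = \<rho>"
    then obtain v where v: "profile t v \<alpha>" using ex by blast
    then show "\<exists>v. profile t v \<alpha> \<and> (\<Sum>k=1..n. v k) = - offset t - \<rho>" using val[OF v] * by (intro exI[of _ v]) simp
  qed
qed

lemma profile_unique: "profile t v \<alpha> \<Longrightarrow> profile t' v' \<alpha> \<Longrightarrow> t = t'"
  using ord_at_cong_inj[of 1 t t' "v 1" "v' 1"] n_ge by (auto simp: profile_def)

lemma ex1_profile:
  "(\<exists>t v. profile t v \<alpha> \<and> (\<Sum>k=1..n. v k) = - offset t - \<rho>) \<longleftrightarrow>
   (\<exists>!t. t \<in> {0..N - 1} \<and> (\<forall>k\<in>{1..n}. [\<alpha> k - int (t * lam k) = 0] (mod int N)) \<and>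
    (\<Sum>k=1..n. \<lceil>real_of_int (\<alpha> k) / real N\<rceil>)
      - (\<Sum>k=1..r. \<lceil>real (t * lam k) / real N\<rceil> * int (place_degree rat_consts (P k))) = \<rho>)"
  (is "_ \<longleftrightarrow> (\<exists>!t. t \<in> {0..N - 1} \<and> ?A t \<and> ?B t)")
proof -
  have eq: "t \<in> {0..N - 1} \<and> ?A t \<and> ?B t \<longleftrightarrow> (\<exists>v. profile t v \<alpha> \<and> (\<Sum>k=1..n. v k) = - offset t - \<rho>)" for t
  proof (cases "t < N")
    case True
    then show ?thesis using profile_iff_cong[OF True, of \<alpha> \<rho>] by auto
  next
    case False
    then show ?thesis using N_gt_1 by (auto simp: profile_def)
  qed
  show ?thesis unfolding eq using profile_unique by blast
qed

end

theorem theorem3p6: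
  fixes p q e s m u r n :: nat
    and a :: "nat \<Rightarrow> 'k::{field,finite}"
    and h :: "'k poly fract"
    and T P :: "nat \<Rightarrow> 'k poly fract set"
    and \<gamma> lam :: "nat \<Rightarrow> nat"
    and \<iota> :: "'k poly fract \<Rightarrow> 'f::field"
    and y :: 'f
    and Q :: "nat \<Rightarrow> 'f set"
    and \<alpha> :: "nat \<Rightarrow> int"
    and \<Upsilon> :: "(nat \<Rightarrow> int) set"
    and \<rho> :: int
  assumes "1 \<le> m" and "m \<le> s"
    and "Factorial_Ring.prime p" and "1 \<le> e" and "q = p ^ e"
    and "CARD('k) = q ^ s"
    and "a m \<noteq> 0" and "a 0 \<noteq> 0" and "all_roots_in_base (linearized_poly q m a)"
    and "h \<noteq> 0"
    and "bij_betw T {1..u} (zeros rat_consts h)"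
    and "bij_betw P {1..r} (poles rat_consts h)"
    and "\<forall>k\<in>{1..u}. 0 < \<gamma> k"
    and "\<forall>k\<in>{1..r}. 0 < lam k \<and> \<not> p dvd lam k"
    and "principal_divisor rat_consts h =
           (\<lambda>R. (\<Sum>k=1..u. int (\<gamma> k) * of_bool (R = T k)) - (\<Sum>k=1..r. int (lam k) * of_bool (R = P k)))"
    and "linearized_function_field (linearized_poly q m a) h \<iota> y"
    and "2 \<le> n" and "n \<le> q ^ s" and "n \<le> r"
    and "\<forall>k\<in>{1..n}. place (ext_consts \<iota>) (Q k) \<and> lies_over \<iota> (Q k) (P k) \<and> place_degree (ext_consts \<iota>) (Q k) = 1"
    and "\<alpha> \<in> {1..n} \<rightarrow>\<^sub>E UNIV"
    and "(\<Upsilon> = absolute_maximal_elements n (gen_weierstrass_semigroup (ext_consts \<iota>) n Q) \<and> \<rho> = 0) \<or>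
         (\<Upsilon> = relative_maximal_elements n (gen_weierstrass_semigroup (ext_consts \<iota>) n Q) \<and> \<rho> = int n - 2)"
  shows "\<alpha> \<in> \<Upsilon> \<longleftrightarrow>
    (\<exists>!t. t \<in> {0..q ^ m - 1} \<and>
      (\<forall>k\<in>{1..n}. [\<alpha> k - int (t * lam k) = 0] (mod int (q ^ m))) \<and>
      (\<Sum>k=1..n. \<lceil>real_of_int (\<alpha> k) / real (q ^ m)\<rceil>)
        - (\<Sum>k=1..r. \<lceil>real (t * lam k) / real (q ^ m)\<rceil> * int (place_degree rat_consts (P k))) = \<rho>)"
proof -
  let ?L = "linearized_poly q m a"
  have lff: "\<iota> \<in> ring_hom ring_of_type_algebra ring_of_type_algebra"
    "poly (map_poly (\<iota> \<circ> const_fract) ?L) y = \<iota> h"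
    "generate_field ring_of_type_algebra (insert y (range \<iota>)) = UNIV"
    using assms(16) by (auto simp: linearized_function_field_def)
  have "CARD('k) = p ^ (e * s)" using assms(5,6) by (simp add: power_mult)
  then have char: "CHAR('k) = p" by (rule CHAR_eq_prime_of_CARD[OF assms(3)])
  interpret linearized_ext \<iota> p e q m a h y
    by unfold_locales (use ring_hom_type_algebraD[OF lff(1)] lff(2,3) char assms in auto)
  have P: "place rat_consts (P k)" "place_val (P k) h < 0" if "k \<in> {1..r}" for k
    using bij_betwE[OF assms(12)] that by (auto simp: poles_def)
  have inj: "inj_on P {1..r}" using assms(12) by (simp add: bij_betw_def)
  have val: "place_val (P k) h = - int (lam k)" if k: "k \<in> {1..r}" for k
  proof -
    have "P k \<noteq> T j" if j: "j \<in> {1..u}" for j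
    proof -
      have "T j \<in> zeros rat_consts h" using bij_betwE[OF assms(11)] j by blast
      then have "0 < place_val (T j) h" by (simp add: zeros_def)
      then show ?thesis using P(2)[OF k] by force
    qed
    then have T: "(\<Sum>j=1..u. int (\<gamma> j) * of_bool (P k = T j)) = 0" by (intro sum.neutral) auto
    have "(\<Sum>j=1..r. int (lam j) * of_bool (P k = P j)) = (\<Sum>j=1..r. if j = k then int (lam j) else 0)"
      using inj_on_eq_iff[OF inj k] by (intro sum.cong) auto
    also have "\<dots> = int (lam k)" using k by simp
    finally have "principal_divisor rat_consts h (P k) = - int (lam k)"
      using fun_cong[OF assms(15), of "P k"] T by simp
    then show ?thesis using P(1)[OF k] by (simp add: principal_divisor_def)
  qed
  interpret ramified_tuple \<iota> p e q m a h y P lam r n Q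
  proof
    show "ramified (P k) (lam k)" if "k \<in> {1..r}" for k
      using that P(1) val assms(14) by (simp add: ramified_def)
    show "inj_on P {1..r}" by (rule inj)
    show "h \<in> place_ring R" if R: "place rat_consts R" "R \<notin> P ` {1..r}" for R
    proof -
      have "R \<notin> poles rat_consts h" using R(2) assms(12) by (simp add: bij_betw_def)
      then have "0 \<le> place_val R h" using R(1) by (simp add: poles_def)
      then show ?thesis using rat_val_\<O>_iff[OF R(1) h0] by blast
    qed
  qed (use assms(17,19,20) in auto)
  interpret rational_ramified_tuple \<iota> p e q m a h y P lam r n Q
  proof
    show "place_degree rat_consts (P k) = 1" if k: "k \<in> {1..n}" for k
      using ramified_place_degree[OF Q(1)[OF k] Q(2)[OF k] ram[OF in_r[OF k]]] assms(20) k by simp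
    show "n = 2 \<or> (\<exists>c d :: 'k. c \<noteq> 0 \<and> d \<noteq> 0 \<and> c \<noteq> d)"
    proof (rule disjCI)
      assume *: "\<not> (\<exists>c d :: 'k. c \<noteq> 0 \<and> d \<noteq> 0 \<and> c \<noteq> d)"
      have "c = 0 \<or> c = 1" for c :: 'k using * zero_neq_one[where 'a = 'k] by metis
      then have "(UNIV :: 'k set) \<subseteq> {0, 1}" by auto
      then have "CARD('k) \<le> card {0, 1 :: 'k}" by (intro card_mono) auto
      then show "n = 2" using assms(6,17,18) by simp
    qed
  qed
  have N: "N = q ^ m" by (rule N_def)
  note crit = ex1_profile[of \<alpha> \<rho>, unfolded N]
  show ?thesis
    using assms(22)
  proof
    assume "\<Upsilon> = absolute_maximal_elements n (gen_weierstrass_semigroup (ext_consts \<iota>) n Q) \<and> \<rho> = 0"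
    then show ?thesis using absolute_maximal_iff[OF assms(21)] crit by simp
  next
    assume "\<Upsilon> = relative_maximal_elements n (gen_weierstrass_semigroup (ext_consts \<iota>) n Q) \<and> \<rho> = int n - 2"
    then show ?thesis using relative_maximal_iff[OF assms(21)] crit by simp
  qed
qed

end
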